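(* Let $E$ and $F$ be Banach lattices such that $F$ is $\sigma$-Dedekind complete. Let $S, T : E \to F$ be positive operators with $0 \le S \le T$ (that is, $0 \le Sx \le Tx$ for all $x \in E^{+}$). If $T$ is a weak$^{*}$ Dunford-Pettis operator, then $S$ is a weak$^{*}$ Dunford-Pettis operator.
   Context: A bounded linear operator $T : X \to Y$ between Banach spaces is called a weak$^{*}$ Dunford-Pettis operator if for every sequence $(x_n)$ in $X$ with $x_n \to 0$ weakly and every sequence $(f_n)$ in the dual $Y^{*}$ with $f_n \to 0$ in the weak$^{*}$ topology, one has $f_n(Tx_n) \to 0$. $E^{+}$ denotes the positive cone of a Banach lattice $E$. A linear operator $T:E\to F$ between Banach lattices is positive if $T(E^{+}) \subseteq F^{+}$ (positive operators between Banach lattices are automatically bounded). A Banach lattice is $\sigma$-Dedekind complete if every nonempty countable subset that is bounded above has a supremum. *)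

theory Defs
  imports "HOL-Analysis.Analysis" "HOL-Library.Lattice_Algebras"
begin

text \<open>Real Banach lattices. The modulus is that of \<^class>\<open>lattice_ab_group_add_abs\<close>,
  i.e. \<open>\<bar>x\<bar> = sup x (- x)\<close>.\<close>

class banach_lattice = banach + ordered_real_vector + lattice_ab_group_add_abs +
  assumes norm_mono_abs: "\<bar>x\<bar> \<le> \<bar>y\<bar> \<Longrightarrow> norm x \<le> norm y"

class sigma_dedekind_complete = order +
  assumes countable_bdd_above_has_lub:
    "A \<noteq> {} \<Longrightarrow> countable A \<Longrightarrow> bdd_above A \<Longrightarrow>
      \<exists>s. (\<forall>a\<in>A. a \<le> s) \<and> (\<forall>u. (\<forall>a\<in>A. a \<le> u) \<longrightarrow> s \<le> u)"

instance real :: banach_lattice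
  by standard simp

instance real :: sigma_dedekind_complete
  by standard (meson cSup_least cSup_upper)

text \<open>The weak topology is the initial topology for all bounded functionals: the functions
  \<open>('a \<Rightarrow>\<^sub>L real) \<Rightarrow> real\<close> carry the product topology.\<close>

definition weak_topology :: "'a::real_normed_vector topology" where
  "weak_topology =
    pullback_topology UNIV (\<lambda>x (f :: 'a \<Rightarrow>\<^sub>L real). blinfun_apply f x) euclidean"

text \<open>On scalar-valued operators the strong operator topology is pointwise convergence,
  i.e. the weak-* topology of the dual.\<close>

abbreviation weak_star_topology :: "('a::real_normed_vector \<Rightarrow>\<^sub>L real) topology" where
  "weak_star_topology \<equiv> strong_operator_topology"

lemma limitin_pullback_UNIV:
  "limitin (pullback_topology UNIV g T) f l F \<longleftrightarrow> limitin T (\<lambda>x. g (f x)) (g l) F"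
proof
  assume L: "limitin (pullback_topology UNIV g T) f l F"
  show "limitin T (\<lambda>x. g (f x)) (g l) F"
    unfolding limitin_def
  proof (intro conjI allI impI)
    show "g l \<in> topspace T"
      using limitin_topspace[OF L] by (simp add: topspace_pullback_topology)
    fix U assume U: "openin T U \<and> g l \<in> U"
    then have "openin (pullback_topology UNIV g T) (g -` U)" "l \<in> g -` U"
      by (auto simp: openin_pullback_topology)
    with L have "\<forall>\<^sub>F x in F. f x \<in> g -` U"
      unfolding limitin_def by blast
    then show "\<forall>\<^sub>F x in F. g (f x) \<in> U"
      by simp
  qed
next
  assume R: "limitin T (\<lambda>x. g (f x)) (g l) F"
  show "limitin (pullback_topology UNIV g T) f l F"
    unfolding limitin_def
  proof (intro conjI allI impI)
    show "l \<in> topspace (pullback_topology UNIV g T)"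
      using limitin_topspace[OF R] by (simp add: topspace_pullback_topology)
    fix V assume "openin (pullback_topology UNIV g T) V \<and> l \<in> V"
    then obtain U where U: "openin T U" "V = g -` U" "g l \<in> U"
      by (auto simp: openin_pullback_topology)
    with R show "\<forall>\<^sub>F x in F. f x \<in> V"
      unfolding limitin_def by simp
  qed
qed

lemma tendsto_fun_iff:
  fixes f :: "'c \<Rightarrow> 'a \<Rightarrow> 'b::topological_space"
  shows "(f \<longlongrightarrow> l) F \<longleftrightarrow> (\<forall>i. ((\<lambda>n. f n i) \<longlongrightarrow> l i) F)"
  using limitin_componentwise[of "\<lambda>_. euclidean" UNIV f l F]
  by (simp add: euclidean_product_topology)

lemma limitin_weak_topology_iff:
  fixes x :: "nat \<Rightarrow> 'a::real_normed_vector"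
  shows "limitin weak_topology x l sequentially \<longleftrightarrow>
    (\<forall>f :: 'a \<Rightarrow>\<^sub>L real. (\<lambda>n. blinfun_apply f (x n)) \<longlonglongrightarrow> blinfun_apply f l)"
  unfolding weak_topology_def limitin_pullback_UNIV by (simp add: tendsto_fun_iff)

lemma limitin_weak_star_topology_iff:
  fixes f :: "nat \<Rightarrow> 'a::real_normed_vector \<Rightarrow>\<^sub>L real"
  shows "limitin weak_star_topology f g sequentially \<longleftrightarrow>
    (\<forall>x. (\<lambda>n. blinfun_apply (f n) x) \<longlonglongrightarrow> blinfun_apply g x)"
  unfolding strong_operator_topology_def limitin_pullback_UNIV by (simp add: tendsto_fun_iff)

definition weak_star_dunford_pettis :: "('a::banach \<Rightarrow> 'b::banach) \<Rightarrow> bool" where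
  "weak_star_dunford_pettis T \<longleftrightarrow> bounded_linear T \<and>
    (\<forall>(x :: nat \<Rightarrow> 'a) (f :: nat \<Rightarrow> 'b \<Rightarrow>\<^sub>L real).
      limitin weak_topology x 0 sequentially \<longrightarrow>
      limitin weak_star_topology f 0 sequentially \<longrightarrow>
      (\<lambda>n. blinfun_apply (f n) (T (x n))) \<longlonglongrightarrow> 0)"

definition positive_operator :: "('a::banach_lattice \<Rightarrow> 'b::banach_lattice) \<Rightarrow> bool" where
  "positive_operator T \<longleftrightarrow> linear T \<and> (\<forall>x\<ge>0. 0 \<le> T x)"

end

theory Submission
  imports Defs
begin

text \<open>Let \<open>x\<^sub>n \<rightarrow> 0\<close> weakly in \<open>E\<close> and \<open>f\<^sub>n \<rightarrow> 0\<close> weak* in \<open>F'\<close>. Phillips' lemma in the form of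
  Rosenthal's lemma shows that on an order interval of a \<open>\<sigma>\<close>-Dedekind complete lattice a weak*
  null sequence is, up to \<open>\<epsilon>\<close>, dominated by finitely many of its members. Applied to \<open>F\<close>, and to
  \<open>E'\<close> with the \<open>x\<^sub>n\<close> as functionals, this reduces the claim to \<open>x\<^sub>n\<close> and \<open>f\<^sub>n\<close> lying in fixed
  order intervals \<open>[-u, u]\<close> and \<open>[-g, g]\<close>; the remainders are controlled because their moduli are
  again null sequences, to which the Dunford--Pettis property of \<open>T\<close> applies. On these order
  intervals \<open>S\<close> is approximated by operators \<open>\<Sum> l P T L\<close> with \<open>P\<close> a central operator of \<open>F\<close> and
  \<open>L\<close> a central operator of the principal ideal of \<open>u\<close>, as in the Kalton--Saab theorem. Since
  \<open>f\<^sub>n \<circ> P\<close> is weak* null and \<open>L x\<^sub>n\<close> is weakly null, such operators inherit the Dunford--Pettis property of \<open>T\<close>.\<close>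

text \<open>The obstacle is that weak and weak* null sequences need not stay null when moduli are
  taken, whereas domination by \<open>T\<close> only speaks about positive elements. So a fixed
  order interval has to be cut off before any estimate passes to |x_n| or |f_n|. What lies outside
  is positive and becomes a null sequence once the cut moves to infinity with n; this is why
  diagonal sequences occur. Sigma-Dedekind completeness of F is used twice: suprema of series make
  Rosenthal's lemma applicable, and band projections cut F according to the sign of an element. E
  has no such suprema. Its dual does, and the embedding of E into the bidual preserves the lattice
  operations, so the truncation result for E is read off from E'. Multipliers of E exist only on a
  principal ideal, where multiplication by x / u is built as a norm limit; hence u must be so large
  that its ideal contains every x_n. Such a multiplier need not extend to E, but a positive
  functional composed with it is dominated by that functional and does extend, which preserves weak
  nullity.\<close>

subsection \<open>Vector lattices\<close>

lemma diff_inf_pprt: "x - inf x w = pprt (x - w)" for x :: "'a::lattice_ab_group_add"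
  by (simp add: pprt_def add_sup_distrib_left sup_commute)

lemma pprt_add_le: "pprt (x + y) \<le> pprt x + pprt y" for x :: "'a::lattice_ab_group_add"
proof -
  have "x \<le> pprt x" "y \<le> pprt y" by (simp_all add: pprt_def)
  then have "x + y \<le> pprt x + pprt y" by (rule add_mono)
  then show ?thesis by (simp add: pprt_def)
qed

lemma le_pprt: "x \<le> pprt x" for x :: "'a::lattice_ab_group_add"
  by (simp add: pprt_def)

lemma nprt_le: "nprt x \<le> x" for x :: "'a::lattice_ab_group_add"
  by (simp add: nprt_def)

lemma pprt_le_iff: "pprt x \<le> y \<longleftrightarrow> x \<le> y \<and> 0 \<le> y" for x :: "'a::lattice_ab_group_add"
  by (simp add: pprt_def)

lemma pprt_le_abs: "pprt x \<le> \<bar>x\<bar>" for x :: "'a::lattice_ab_group_add_abs"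
  by (simp add: pprt_le_iff abs_ge_self)

lemma uminus_nprt_le_abs: "- nprt x \<le> \<bar>x\<bar>" for x :: "'a::lattice_ab_group_add_abs"
  using pprt_le_abs[of "- x"] by (simp add: pprt_neg)

lemma pprt_minus_nprt: "pprt x + - nprt x = \<bar>x\<bar>" for x :: "'a::lattice_ab_group_add_abs"
  by (simp add: abs_prts)

lemma inf_pprt_nprt: "inf (pprt x) (- nprt x) = 0" for x :: "'a::lattice_ab_group_add"
proof -
  have "inf (pprt x) (- nprt x) = inf (x + - nprt x) (0 + - nprt x)"
    using prts[of x] by (metis add_diff_cancel_right' add_0 uminus_add_conv_diff add.commute)
  also have "\<dots> = nprt x + - nprt x"
    by (simp only: add_inf_distrib_right[symmetric] nprt_def)
  finally show ?thesis by simp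
qed

lemma inf_add_le:
  fixes x :: "'a::lattice_ab_group_add"
  assumes "0 \<le> x" "0 \<le> y" "0 \<le> w"
  shows "inf (x + y) w \<le> inf x w + inf y w"
proof -
  have "inf x w + inf y w = inf (inf (x + y) (x + w)) (inf (w + y) (w + w))"
    by (simp add: add_sup_inf_distribs ac_simps inf_aci)
  moreover have "w \<le> x + w" "w \<le> w + y" "w \<le> w + w" using assms by auto
  ultimately show ?thesis
    by (simp add: le_infI1 le_infI2)
qed

lemma add_inf_le_inf: "inf x w + inf y v \<le> inf (x + y) (w + v)" for x :: "'a::lattice_ab_group_add"
  by (simp add: add_mono)

lemma disjoint_mono:
  fixes a :: "'a::lattice_ab_group_add"
  assumes "inf a b = 0" "0 \<le> a'" "a' \<le> a" "0 \<le> b'" "b' \<le> b"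
  shows "inf a' b' = 0"
proof (rule order.antisym)
  have "inf a' b' \<le> inf a b" by (rule inf_mono) (use assms in auto)
  then show "inf a' b' \<le> 0" using assms by simp
qed (use assms in simp)

text \<open>Integer multiples follow by induction from subadditivity of \<open>inf\<close>, and a
  real multiple lies below an integer one.\<close>

lemma disjoint_scaleR:
  fixes a :: "'a::{ordered_real_vector, lattice_ab_group_add}"
  assumes "inf a b = 0" "0 \<le> r"
  shows "inf a (r *\<^sub>R b) = 0"
proof -
  have ab: "0 \<le> a" "0 \<le> b" using assms by (metis inf_le1 inf_le2)+
  have "inf a (real n *\<^sub>R b) = 0" for n
  proof (induction n)
    case (Suc n)
    have "0 \<le> real n *\<^sub>R b" using ab by (intro scaleR_nonneg_nonneg) simp_all
    then have "inf (real (Suc n) *\<^sub>R b) a \<le> inf (real n *\<^sub>R b) a + inf b a"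
      using inf_add_le[of "real n *\<^sub>R b" b a] ab by (simp add: scaleR_left_distrib add.commute)
    also have "\<dots> = 0" using Suc assms by (simp add: inf_commute)
    finally show ?case using ab \<open>0 \<le> real n *\<^sub>R b\<close>
      by (intro order.antisym) (simp_all add: inf_commute scaleR_left_distrib)
  qed (use ab in \<open>simp add: inf_absorb2\<close>)
  moreover obtain n :: nat where n: "r \<le> real n" using real_arch_simple by blast
  ultimately have "inf a (real n *\<^sub>R b) = 0" by blast
  then show ?thesis
    by (rule disjoint_mono[OF _ ab(1) order_refl scaleR_nonneg_nonneg[OF assms(2) ab(2)]
          scaleR_right_mono[OF n ab(2)]])
qed

text \<open>The point is that \<open>m\<close> does not enter the upper bound.\<close>

lemma inf_scaleR_pprt_le:
  fixes y :: "'a::{ordered_real_vector, lattice_ab_group_add}"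
  assumes "0 \<le> y" "0 \<le> m" "0 \<le> n"
  shows "inf y (m *\<^sub>R pprt a) \<le> pprt (n *\<^sub>R a + y)"
proof -
  let ?z = "inf y (m *\<^sub>R pprt a)"
  have z0: "0 \<le> ?z" using assms by (simp add: scaleR_nonneg_nonneg)
  have "inf (- nprt a) (m *\<^sub>R pprt a) = 0"
    using inf_pprt_nprt[of a] assms by (intro disjoint_scaleR) (auto simp: inf_commute)
  then have "inf (m *\<^sub>R pprt a) (n *\<^sub>R (- nprt a)) = 0"
    using assms by (intro disjoint_scaleR) (auto simp: inf_commute)
  \<comment> \<open>Since \<open>?z\<close> is disjoint from n a^-, subtracting n a^- and taking the
    positive part gives \<open>?z\<close> back; after the subtraction, -n a^- can be replaced by the
    larger n a.\<close>
  then have "inf ?z (n *\<^sub>R (- nprt a)) = 0"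
    by (rule disjoint_mono) (use assms z0 in \<open>auto intro: scaleR_nonneg_nonneg scaleR_nonneg_nonpos\<close>)
  then have "?z = pprt (?z - n *\<^sub>R (- nprt a))"
    using diff_inf_pprt[of ?z "n *\<^sub>R (- nprt a)"] by simp
  also have "\<dots> \<le> pprt (n *\<^sub>R a + y)"
  proof (rule pprt_mono)
    have "n *\<^sub>R nprt a \<le> n *\<^sub>R a" using assms by (intro scaleR_left_mono nprt_le)
    then have "n *\<^sub>R nprt a + ?z \<le> n *\<^sub>R a + y" by (rule add_mono) simp
    then show "?z - n *\<^sub>R (- nprt a) \<le> n *\<^sub>R a + y" by (simp add: add.commute)
  qed
  finally show ?thesis .
qed

lemma pprt_diff_le: "pprt x - pprt y \<le> pprt (x - y)" for x :: "'a::lattice_ab_group_add"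
  using pprt_add_le[of y "x - y"] by (simp add: algebra_simps)

lemma abs_pprt_diff_le: "\<bar>pprt x - pprt y\<bar> \<le> \<bar>x - y\<bar>" for x :: "'a::lattice_ab_group_add_abs"
proof (rule abs_leI)
  show "pprt x - pprt y \<le> \<bar>x - y\<bar>"
    using pprt_diff_le pprt_le_abs by (rule order_trans)
  have "pprt y - pprt x \<le> \<bar>y - x\<bar>"
    using pprt_diff_le pprt_le_abs by (rule order_trans)
  then show "- (pprt x - pprt y) \<le> \<bar>x - y\<bar>" by (simp add: abs_minus_commute)
qed

lemma pprt_scaleR:
  fixes x :: "'a::{ordered_real_vector, lattice_ab_group_add}"
  assumes "0 \<le> c"
  shows "pprt (c *\<^sub>R x) = c *\<^sub>R pprt x"
proof (cases "c = 0")
  case False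
  have le: "pprt (c *\<^sub>R x) \<le> c *\<^sub>R pprt x" if "0 \<le> c" for c and x :: 'a
    using that by (auto simp: pprt_le_iff intro: scaleR_left_mono le_pprt scaleR_nonneg_nonneg)
  \<comment> \<open>The inequality for 1/c at \<open>c *\<^sub>R x\<close> is the missing converse
    of the inequality for c.\<close>
  have "pprt ((1/c) *\<^sub>R c *\<^sub>R x) \<le> (1/c) *\<^sub>R pprt (c *\<^sub>R x)" by (rule le) (use assms in simp)
  then have "c *\<^sub>R pprt x \<le> c *\<^sub>R (1/c) *\<^sub>R pprt (c *\<^sub>R x)"
    using False assms by (intro scaleR_left_mono) auto
  then show ?thesis using le[of c x] assms False by (simp add: order.antisym)
qed simp

lemma nprt_scaleR:
  fixes x :: "'a::{ordered_real_vector, lattice_ab_group_add}"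
  assumes "0 \<le> c"
  shows "nprt (c *\<^sub>R x) = c *\<^sub>R nprt x"
  using pprt_scaleR[OF assms, of "- x"] by (simp add: pprt_neg)

subsection \<open>Banach lattices\<close>

lemma norm_abs_lattice [simp]: "norm \<bar>x\<bar> = norm x" for x :: "'a::banach_lattice"
  by (intro order.antisym norm_mono_abs) simp_all

lemma norm_mono_pos: "0 \<le> x \<Longrightarrow> x \<le> y \<Longrightarrow> norm x \<le> norm y" for x :: "'a::banach_lattice"
  using norm_mono_abs[of x y] order_trans[of 0 x y] by (simp add: abs_of_nonneg)

lemma norm_le_of_abs_le: "\<bar>x\<bar> \<le> y \<Longrightarrow> norm x \<le> norm y" for x :: "'a::banach_lattice"
  using norm_mono_pos[of "\<bar>x\<bar>" y] by simp

lemma tendsto_pprt: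
  fixes f :: "'b \<Rightarrow> 'a::banach_lattice"
  assumes "(f \<longlongrightarrow> l) F"
  shows "((\<lambda>x. pprt (f x)) \<longlongrightarrow> pprt l) F"
proof (rule metric_tendsto_imp_tendsto[OF assms], rule eventuallyI)
  show "dist (pprt (f x)) (pprt l) \<le> dist (f x) l" for x
    by (simp add: dist_norm norm_mono_abs abs_pprt_diff_le)
qed

text \<open>Taking positive parts is norm continuous, so a limit of positive elements equals its own
  positive part.\<close>

lemma lim_nonneg:
  fixes f :: "nat \<Rightarrow> 'a::banach_lattice"
  assumes "f \<longlonglongrightarrow> l" "\<And>n. 0 \<le> f n"
  shows "0 \<le> l"
proof -
  have "(\<lambda>n. pprt (f n)) \<longlonglongrightarrow> pprt l" by (rule tendsto_pprt) fact
  then have "f \<longlonglongrightarrow> pprt l" using assms(2) by simp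
  then have "l = pprt l" using assms(1) LIMSEQ_unique by blast
  then show ?thesis by (metis zero_le_pprt)
qed

lemma lim_le:
  fixes f :: "nat \<Rightarrow> 'a::banach_lattice"
  assumes "f \<longlonglongrightarrow> l" "g \<longlonglongrightarrow> m" "\<And>n. f n \<le> g n"
  shows "l \<le> m"
proof -
  have "(\<lambda>n. g n - f n) \<longlonglongrightarrow> m - l" by (intro tendsto_diff assms)
  then have "0 \<le> m - l" by (rule lim_nonneg) (use assms in simp)
  then show ?thesis by simp
qed

lemma archimedean_le:
  fixes x :: "'a::banach_lattice"
  assumes "\<And>n::nat. x \<le> (1 / real (Suc n)) *\<^sub>R y + z"
  shows "x \<le> z"
proof (rule lim_le)
  show "(\<lambda>n::nat. x) \<longlonglongrightarrow> x" by simp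
  have "(\<lambda>n::nat. (1 / real (Suc n)) *\<^sub>R y + z) \<longlonglongrightarrow> 0 *\<^sub>R y + z"
    by (intro tendsto_intros LIMSEQ_Suc lim_1_over_n)
  then show "(\<lambda>n::nat. (1 / real (Suc n)) *\<^sub>R y + z) \<longlonglongrightarrow> z" by simp
qed (use assms in simp)

section \<open>Positive operators and their automatic continuity\<close>

lemma positive_operator_mono: "positive_operator T \<Longrightarrow> x \<le> y \<Longrightarrow> T x \<le> T y"
  unfolding positive_operator_def using linear_diff[of T y x] by (metis diff_ge_0_iff_ge)

lemma positive_operator_abs: "positive_operator T \<Longrightarrow> \<bar>T x\<bar> \<le> T \<bar>x\<bar>"
proof (rule abs_leI)
  assume T: "positive_operator T"
  show "T x \<le> T \<bar>x\<bar>" by (rule positive_operator_mono[OF T abs_ge_self])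
  have "T (- x) \<le> T \<bar>x\<bar>" by (rule positive_operator_mono[OF T abs_ge_minus_self])
  then show "- T x \<le> T \<bar>x\<bar>" using T by (simp add: positive_operator_def linear_neg)
qed

text \<open>If \<open>T\<close> were unbounded, suitably scaled moduli \<open>y n\<close> of norm
  2^-n would have images of norm at least n. Their sum \<open>s\<close> dominates every
  \<open>y n\<close>, so the norm of \<open>T s\<close> would be at least every n.\<close>

theorem positive_operator_bounded:
  fixes T :: "'a::banach_lattice \<Rightarrow> 'b::banach_lattice"
  assumes T: "positive_operator T"
  shows "bounded_linear T"
proof -
  have lin: "linear T" using T by (simp add: positive_operator_def)
  interpret linear T by (rule lin)
  have "\<exists>K. \<forall>x. norm (T x) \<le> norm x * K"
  proof (rule ccontr)
    assume "\<not> ?thesis"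
    then have "\<exists>x. norm (T x) > norm x * (2 ^ n * real n)" for n :: nat
      by (meson linorder_not_le)
    then obtain x where x: "norm (T (x n)) > norm (x n) * (2 ^ n * real n)" for n :: nat by metis
    have xn0: "norm (x n) > 0" for n
      using x[of n] by (auto simp: zero)
    define y where "y n = (1 / (2 ^ n * norm (x n))) *\<^sub>R \<bar>x n\<bar>" for n
    have ypos: "0 \<le> y n" for n unfolding y_def by (intro scaleR_nonneg_nonneg) simp_all
    have ny: "norm (y n) = (1/2) ^ n" for n
      using xn0[of n] by (simp add: y_def power_one_over)
    have sm: "summable y"
      by (rule summable_norm_cancel) (simp add: ny summable_geometric)
    define s where "s = suminf y"
    have yle: "y n \<le> s" for n
    proof (rule lim_le)
      show "(\<lambda>N. y n) \<longlonglongrightarrow> y n" by simp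
      have "y sums s" using sm s_def summable_sums by auto
      then have "(\<lambda>N. sum y {..<N}) \<longlonglongrightarrow> s" by (simp add: sums_def)
      then show "(\<lambda>N. sum y {..<N + Suc n}) \<longlonglongrightarrow> s" by (rule LIMSEQ_ignore_initial_segment)
      fix N
      have "sum y {n} \<le> sum y {..<N + Suc n}" by (rule sum_mono2) (use ypos in auto)
      then show "y n \<le> sum y {..<N + Suc n}" by simp
    qed
    have "real n \<le> norm (T s)" for n
    proof -
      have "T (y n) = (1 / (2 ^ n * norm (x n))) *\<^sub>R T \<bar>x n\<bar>"
        by (simp add: y_def scaleR)
      then have "norm (T (y n)) = norm (T \<bar>x n\<bar>) / (2 ^ n * norm (x n))" by simp
      also have "\<dots> \<ge> norm (T (x n)) / (2 ^ n * norm (x n))"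
        using positive_operator_abs[OF T, of "x n"]
        by (intro divide_right_mono norm_le_of_abs_le) auto
      moreover have "norm (T (x n)) / (2 ^ n * norm (x n)) \<ge> real n"
        using x[of n] xn0[of n] by (simp add: field_simps)
      ultimately have "real n \<le> norm (T (y n))" by linarith
      also have "\<dots> \<le> norm (T s)"
        using T ypos by (intro norm_mono_pos positive_operator_mono[OF T] yle) (simp add: positive_operator_def)
      finally show ?thesis .
    qed
    then show False using reals_Archimedean2 linorder_not_le by blast
  qed
  then show ?thesis
    by (auto simp: bounded_linear_def bounded_linear_axioms_def lin)
qed

subsection \<open>Additive maps on solid cones\<close>

text \<open>The positive cone of an ideal; the ideal itself consists of the x with |x| in
  \<open>D\<close>. The two instances are the whole positive cone and the cone of a principal ideal,
  so that one extension theory serves both.\<close>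

definition solid_cone :: "'a::banach_lattice set \<Rightarrow> bool" where
  "solid_cone D \<longleftrightarrow> 0 \<in> D \<and> (\<forall>x\<in>D. 0 \<le> x) \<and> (\<forall>x\<in>D. \<forall>y\<in>D. x + y \<in> D) \<and>
    (\<forall>x\<in>D. \<forall>y. 0 \<le> y \<longrightarrow> y \<le> x \<longrightarrow> y \<in> D)"

lemma solid_coneD:
  assumes "solid_cone D"
  shows "0 \<in> D" "x \<in> D \<Longrightarrow> 0 \<le> x" "x \<in> D \<Longrightarrow> y \<in> D \<Longrightarrow> x + y \<in> D"
    "x \<in> D \<Longrightarrow> 0 \<le> y \<Longrightarrow> y \<le> x \<Longrightarrow> y \<in> D"
  using assms unfolding solid_cone_def by blast+

lemma solid_cone_of_nat:
  assumes D: "solid_cone D" and x: "x \<in> D"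
  shows "real n *\<^sub>R x \<in> D"
proof (induction n)
  case (Suc n)
  then show ?case using solid_coneD(3)[OF D x Suc] by (simp add: scaleR_left_distrib)
qed (simp add: solid_coneD[OF D])

lemma solid_cone_scaleR:
  assumes D: "solid_cone D" and x: "x \<in> D" and c: "0 \<le> c"
  shows "c *\<^sub>R x \<in> D"
proof -
  obtain n :: nat where n: "c \<le> real n" using real_arch_simple by blast
  have x0: "0 \<le> x" using solid_coneD[OF D] x by blast
  show ?thesis
    by (rule solid_coneD(4)[OF D solid_cone_of_nat[OF D x, of n]])
      (simp_all add: scaleR_nonneg_nonneg[OF c x0] scaleR_right_mono[OF n x0])
qed

lemma solid_cone_nonneg: "solid_cone {x::'a::banach_lattice. 0 \<le> x}"
  unfolding solid_cone_def by auto

definition additive_on :: "'a::banach_lattice set \<Rightarrow> ('a \<Rightarrow> 'b::banach_lattice) \<Rightarrow> bool" where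
  "additive_on D p \<longleftrightarrow> (\<forall>x\<in>D. 0 \<le> p x) \<and> (\<forall>x\<in>D. \<forall>y\<in>D. p (x + y) = p x + p y)"

lemma additive_onD:
  assumes "additive_on D p"
  shows "x \<in> D \<Longrightarrow> 0 \<le> p x" "x \<in> D \<Longrightarrow> y \<in> D \<Longrightarrow> p (x + y) = p x + p y"
  using assms unfolding additive_on_def by blast+

lemma additive_on_mono:
  assumes D: "solid_cone D" and p: "additive_on D p" and "y \<in> D" "0 \<le> x" "x \<le> y"
  shows "p x \<le> p y"
proof -
  have D1: "x \<in> D" by (rule solid_coneD(4)[OF D \<open>y \<in> D\<close>]) (use assms in auto)
  have D2: "y - x \<in> D" by (rule solid_coneD(4)[OF D \<open>y \<in> D\<close>]) (use assms in auto)
  have "p (x + (y - x)) = p x + p (y - x)" by (rule additive_onD(2)[OF p D1 D2])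
  then show ?thesis using additive_onD(1)[OF p D2] by simp
qed

lemma additive_on_0:
  assumes D: "solid_cone D" and p: "additive_on D p"
  shows "p 0 = 0"
  using additive_onD(2)[OF p solid_coneD(1)[OF D] solid_coneD(1)[OF D]] by simp

lemma additive_on_of_nat:
  assumes D: "solid_cone D" and p: "additive_on D p" and x: "x \<in> D"
  shows "p (real n *\<^sub>R x) = real n *\<^sub>R p x"
proof (induction n)
  case (Suc n)
  have "p (x + real n *\<^sub>R x) = p x + p (real n *\<^sub>R x)"
    by (rule additive_onD(2)[OF p x solid_cone_of_nat[OF D x]])
  then show ?case using Suc by (simp add: scaleR_left_distrib)
qed (simp add: additive_on_0[OF D p])

text \<open>Bracketing c between k/m and (k+1)/m, monotonicity determines the value at c x up to
  \<open>p x\<close> / m, and this error disappears by the Archimedean property.\<close>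

lemma additive_on_scaleR:
  assumes D: "solid_cone D" and p: "additive_on D p" and x: "x \<in> D" and c: "0 \<le> c"
  shows "p (c *\<^sub>R x) = c *\<^sub>R p x"
proof -
  have x0: "0 \<le> x" and px: "0 \<le> p x" using solid_coneD[OF D] additive_onD[OF p] x by blast+
  have cx: "c *\<^sub>R x \<in> D" by (rule solid_cone_scaleR[OF D x c])
  have bounds: "p (c *\<^sub>R x) \<le> (1 / real (Suc n)) *\<^sub>R p x + c *\<^sub>R p x \<and>
      c *\<^sub>R p x \<le> (1 / real (Suc n)) *\<^sub>R p x + p (c *\<^sub>R x)" for n
  proof -
    let ?m = "Suc n"
    define k where "k = nat \<lfloor>c * real ?m\<rfloor>"
    have k1: "real k \<le> c * real ?m" and k2: "c * real ?m \<le> real (Suc k)"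
    proof -
      have "real k = real_of_int \<lfloor>c * real ?m\<rfloor>" unfolding k_def using c by (intro of_nat_nat) simp
      then show "real k \<le> c * real ?m" "c * real ?m \<le> real (Suc k)" by linarith+
    qed
    have e: "real ?m *\<^sub>R p (c *\<^sub>R x) = p ((c * real ?m) *\<^sub>R x)"
      using additive_on_of_nat[OF D p cx, of ?m] by (simp add: mult.commute)
    have "p ((c * real ?m) *\<^sub>R x) \<le> p (real (Suc k) *\<^sub>R x)"
      using c x0 by (intro additive_on_mono[OF D p solid_cone_of_nat[OF D x]]
          scaleR_right_mono[OF k2 x0] scaleR_nonneg_nonneg) auto
    then have u: "real ?m *\<^sub>R p (c *\<^sub>R x) \<le> real (Suc k) *\<^sub>R p x"
      unfolding e additive_on_of_nat[OF D p x] .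
    have "p (real k *\<^sub>R x) \<le> p ((c * real ?m) *\<^sub>R x)"
      using c x0 by (intro additive_on_mono[OF D p solid_cone_scaleR[OF D x]]
          scaleR_right_mono[OF k1 x0] scaleR_nonneg_nonneg) auto
    then have l: "real k *\<^sub>R p x \<le> real ?m *\<^sub>R p (c *\<^sub>R x)"
      unfolding e additive_on_of_nat[OF D p x] .
    have "(1 / real ?m) *\<^sub>R (real ?m *\<^sub>R p (c *\<^sub>R x)) \<le> (1 / real ?m) *\<^sub>R (real (Suc k) *\<^sub>R p x)"
      by (rule scaleR_left_mono[OF u]) simp
    also have "(1 / real ?m) *\<^sub>R (real (Suc k) *\<^sub>R p x) \<le> (1 / real ?m + c) *\<^sub>R p x"
    proof -
      have "real (Suc k) \<le> 1 + c * real ?m" using k1 by simp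
      then have "(1 / real ?m) * real (Suc k) \<le> (1 / real ?m) * (1 + c * real ?m)"
        by (intro mult_left_mono) auto
      then have "(1 / real ?m) * real (Suc k) \<le> 1 / real ?m + c" by (simp add: distrib_left del: of_nat_Suc)
      from scaleR_right_mono[OF this px] show ?thesis by simp
    qed
    finally have U: "p (c *\<^sub>R x) \<le> (1 / real ?m + c) *\<^sub>R p x" by simp
    have "(1 / real ?m) * (c * real ?m) \<le> (1 / real ?m) * (1 + real k)"
      by (intro mult_left_mono) (use k2 in auto)
    then have "c \<le> 1 / real ?m + (1 / real ?m) * real k" by (simp add: distrib_left del: of_nat_Suc)
    from scaleR_right_mono[OF this px]
    have "c *\<^sub>R p x \<le> (1 / real ?m + (1 / real ?m) * real k) *\<^sub>R p x" .
    also have "\<dots> = (1 / real ?m) *\<^sub>R p x + (1 / real ?m) *\<^sub>R (real k *\<^sub>R p x)"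
      by (simp add: scaleR_left_distrib)
    also have "\<dots> \<le> (1 / real ?m) *\<^sub>R p x + (1 / real ?m) *\<^sub>R (real ?m *\<^sub>R p (c *\<^sub>R x))"
      by (intro add_left_mono scaleR_left_mono l) simp
    finally show ?thesis using U by (simp add: scaleR_left_distrib del: of_nat_Suc)
  qed
  show ?thesis
    by (rule order.antisym; rule archimedean_le[of _ "p x"]) (use bounds in blast)+
qed

text \<open>Kantorovich's extension of an additive map from a cone to the ideal it
  generates.\<close>

definition cone_ext :: "('a::banach_lattice \<Rightarrow> 'b::banach_lattice) \<Rightarrow> 'a \<Rightarrow> 'b" where
  "cone_ext p x = p (pprt x) - p (- nprt x)"

lemma abs_in_cone:
  assumes D: "solid_cone D" and "\<bar>x\<bar> \<in> D"
  shows "pprt x \<in> D" "- nprt x \<in> D"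
  using solid_coneD(4)[OF D assms(2)] pprt_le_abs[of x] uminus_nprt_le_abs[of x]
  by (simp_all del: neg_inf_eq_sup)

lemma cone_ext_eq:
  assumes D: "solid_cone D" and p: "additive_on D p" and x: "x \<in> D"
  shows "cone_ext p x = p x"
  using solid_coneD(2)[OF D x] additive_on_0[OF D p] by (simp add: cone_ext_def)

text \<open>Two representations of an element as a difference of cone elements give the same value,
  because adding them crosswise yields an equation inside the cone. Additivity of the extension
  rests on this freedom.\<close>

lemma cone_ext_diff:
  assumes D: "solid_cone D" and p: "additive_on D p" and ab: "a \<in> D" "b \<in> D"
  shows "cone_ext p (a - b) = p a - p b"
proof -
  have ab0: "0 \<le> a" "0 \<le> b" using ab solid_coneD[OF D] by blast+
  have "pprt (a - b) \<le> a" using ab0 by (simp add: pprt_le_iff)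
  then have 1: "pprt (a - b) \<in> D" using solid_coneD(4)[OF D ab(1)] by simp
  have "- nprt (a - b) \<le> b" using ab0 pprt_neg[of "a - b"] by (simp add: pprt_le_iff flip: pprt_neg)
  then have 2: "- nprt (a - b) \<in> D" using solid_coneD(4)[OF D ab(2)] by simp
  have "pprt (a - b) + b = a + - nprt (a - b)" using prts[of "a - b"] by (simp add: algebra_simps)
  then have "p (pprt (a - b)) + p b = p a + p (- nprt (a - b))"
    using additive_onD(2)[OF p 1 ab(2)] additive_onD(2)[OF p ab(1) 2] by simp
  then show ?thesis by (simp add: cone_ext_def algebra_simps)
qed

lemma cone_ext_add:
  assumes D: "solid_cone D" and p: "additive_on D p" and xy: "\<bar>x\<bar> \<in> D" "\<bar>y\<bar> \<in> D"
  shows "cone_ext p (x + y) = cone_ext p x + cone_ext p y"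
proof -
  note a = abs_in_cone[OF D xy(1)] and b = abs_in_cone[OF D xy(2)]
  have "x + y = (pprt x + pprt y) - (- nprt x + - nprt y)"
    by (subst (1) prts[of x], subst (1) prts[of y]) (simp add: algebra_simps)
  then have "cone_ext p (x + y) = p (pprt x + pprt y) - p (- nprt x + - nprt y)"
    using cone_ext_diff[OF D p solid_coneD(3)[OF D a(1) b(1)] solid_coneD(3)[OF D a(2) b(2)]] by simp
  then show ?thesis
    using additive_onD(2)[OF p a(1) b(1)] additive_onD(2)[OF p a(2) b(2)] by (simp add: cone_ext_def)
qed

lemma cone_ext_minus: "cone_ext p (- x) = - cone_ext p x"
  by (simp add: cone_ext_def pprt_neg nprt_neg)

lemma cone_ext_scaleR:
  assumes D: "solid_cone D" and p: "additive_on D p" and x: "\<bar>x\<bar> \<in> D"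
  shows "cone_ext p (c *\<^sub>R x) = c *\<^sub>R cone_ext p x"
proof -
  note a = abs_in_cone[OF D x]
  have pos: "cone_ext p (c *\<^sub>R x) = c *\<^sub>R cone_ext p x" if "0 \<le> c" for c
    using additive_on_scaleR[OF D p a(1) that] additive_on_scaleR[OF D p a(2) that] that
    by (simp add: cone_ext_def pprt_scaleR nprt_scaleR scaleR_diff_right)
  show ?thesis
  proof (cases "0 \<le> c")
    case False
    then show ?thesis using pos[of "- c"] by (simp add: cone_ext_minus)
  qed (rule pos)
qed

lemma cone_ext_bounded_linear:
  assumes p: "additive_on {x. 0 \<le> x} p"
  shows "bounded_linear (cone_ext p)" "\<And>x. 0 \<le> x \<Longrightarrow> cone_ext p x = p x"
    "positive_operator (cone_ext p)"
proof -
  show e: "cone_ext p x = p x" if "0 \<le> x" for x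
    using cone_ext_eq[OF solid_cone_nonneg p] that by simp
  show "positive_operator (cone_ext p)"
    unfolding positive_operator_def
  proof (intro conjI allI impI linearI)
    fix x y c
    show "cone_ext p (x + y) = cone_ext p x + cone_ext p y"
      by (rule cone_ext_add[OF solid_cone_nonneg p]) auto
    show "cone_ext p (c *\<^sub>R x) = c *\<^sub>R cone_ext p x"
      by (rule cone_ext_scaleR[OF solid_cone_nonneg p]) auto
    show "0 \<le> cone_ext p x" if "0 \<le> x" using e[OF that] additive_onD(1)[OF p] that by simp
  qed
  then show "bounded_linear (cone_ext p)" by (rule positive_operator_bounded)
qed

subsection \<open>Functionals with values in a copy of the real line\<close>

text \<open>The lattice structure on the dual space is an instance of the type constructor of bounded
  linear maps, so the range has to be constrained by a class; up to isomorphism,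
  \<^typ>\<open>real\<close> is its only nontrivial member.\<close>

class real_line = banach_lattice + conditionally_complete_linorder + one +
  assumes norm_scaleR_one: "norm x *\<^sub>R 1 = \<bar>x\<bar>"

instance real :: real_line
  by standard simp

lemma real_line_one_nonneg: "0 \<le> (1::'a::real_line)"
proof (cases "(1::'a) = 0")
  case False
  have "0 \<le> (1 / norm (1::'a)) *\<^sub>R \<bar>1::'a\<bar>" by (intro scaleR_nonneg_nonneg) simp_all
  also have "\<dots> = 1" using False by (simp flip: norm_scaleR_one)
  finally show ?thesis .
qed simp

text \<open>An inequality rather than an equation, because the class also admits the zero space,
  where 1 = 0.\<close>

lemma norm_real_line_one_le: "norm (1::'a::real_line) \<le> 1"
  using norm_scaleR_one[of "1::'a"] real_line_one_nonneg
  by (metis abs_of_nonneg order_refl real_vector.scale_right_imp_eq scaleR_one norm_zero zero_le_one)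

lemma real_line_le: "(x::'a::real_line) \<le> norm x *\<^sub>R 1"
  by (simp add: norm_scaleR_one abs_ge_self)

text \<open>The Riesz-Kantorovich supremum. With \<open>D\<close> the whole cone it is the positive
  part of a functional; with \<open>D\<close> the cone of an ideal and \<open>q\<close> positive it
  is the least positive extension of \<open>q\<close>.\<close>

definition rk_sup :: "'a::banach_lattice set \<Rightarrow> ('a \<Rightarrow> 'b::real_line) \<Rightarrow> 'a \<Rightarrow> 'b" where
  "rk_sup D q x = Sup {q y | y. y \<in> D \<and> y \<le> x}"

context
  fixes D :: "'a::banach_lattice set" and q :: "'a \<Rightarrow> 'b::real_line"
  assumes D: "solid_cone D"
    and add: "\<And>x y. x \<in> D \<Longrightarrow> y \<in> D \<Longrightarrow> q (x + y) = q x + q y"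
    and bdd: "\<And>x. 0 \<le> x \<Longrightarrow> bdd_above {q y | y. y \<in> D \<and> y \<le> x}"
begin

lemma rk_sup_upper: "0 \<le> x \<Longrightarrow> y \<in> D \<Longrightarrow> y \<le> x \<Longrightarrow> q y \<le> rk_sup D q x"
  unfolding rk_sup_def by (rule cSup_upper) (use bdd in auto)

lemma rk_sup_least: "0 \<le> x \<Longrightarrow> (\<And>y. y \<in> D \<Longrightarrow> y \<le> x \<Longrightarrow> q y \<le> c) \<Longrightarrow> rk_sup D q x \<le> c"
  unfolding rk_sup_def by (rule cSup_least) (use solid_coneD(1)[OF D] in auto)

text \<open>Riesz decomposition: an element z below x + y splits into \<open>inf z x\<close>, which
  is below x, and (z - x)^+, which is below y, and solidity keeps both parts in \<open>D\<close>.
  For the converse, competitors for x and for y add up to one for x + y.\<close>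

lemma additive_on_rk_sup: "additive_on {x. 0 \<le> x} (rk_sup D q)"
  unfolding additive_on_def
proof (intro conjI ballI)
  have q0: "q 0 = 0" using add[OF solid_coneD(1)[OF D] solid_coneD(1)[OF D]] by simp
  fix x :: 'a assume "x \<in> {x. 0 \<le> x}"
  then have x: "0 \<le> x" by simp
  show "0 \<le> rk_sup D q x" using rk_sup_upper[OF x solid_coneD(1)[OF D] x] q0 by simp
  fix y :: 'a assume "y \<in> {x. 0 \<le> x}"
  then have y: "0 \<le> y" by simp
  have xy: "0 \<le> x + y" using x y by simp
  show "rk_sup D q (x + y) = rk_sup D q x + rk_sup D q y"
  proof (rule order.antisym)
    show "rk_sup D q (x + y) \<le> rk_sup D q x + rk_sup D q y"
    proof (rule rk_sup_least[OF xy])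
      fix z assume z: "z \<in> D" "z \<le> x + y"
      have z0: "0 \<le> z" using solid_coneD(2)[OF D z(1)] .
      have d: "z - inf z x = pprt (z - x)" by (rule diff_inf_pprt)
      have zd: "0 \<le> z - inf z x" unfolding d by simp
      have 1: "inf z x \<in> D" by (rule solid_coneD(4)[OF D z(1)]) (use z0 x in auto)
      have 2: "z - inf z x \<in> D"
        by (rule solid_coneD(4)[OF D z(1) zd]) (use z0 x in \<open>simp_all del: diff_inf_eq_sup\<close>)
      have 3: "z - inf z x \<le> y" unfolding d using z(2) y by (simp add: pprt_le_iff algebra_simps)
      have "q z = q (inf z x) + q (z - inf z x)"
        using add[OF 1 2] by (simp del: diff_inf_eq_sup)
      also have "\<dots> \<le> rk_sup D q x + rk_sup D q y"
        by (intro add_mono rk_sup_upper x y 1 2 3) simp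
      finally show "q z \<le> rk_sup D q x + rk_sup D q y" .
    qed
    have "rk_sup D q x \<le> rk_sup D q (x + y) - rk_sup D q y"
    proof (rule rk_sup_least[OF x])
      fix a assume a: "a \<in> D" "a \<le> x"
      have "rk_sup D q y \<le> rk_sup D q (x + y) - q a"
      proof (rule rk_sup_least[OF y])
        fix b assume b: "b \<in> D" "b \<le> y"
        have "q a + q b = q (a + b)" using add a b by simp
        also have "\<dots> \<le> rk_sup D q (x + y)"
          by (intro rk_sup_upper xy solid_coneD(3)[OF D a(1) b(1)] add_mono a b)
        finally show "q b \<le> rk_sup D q (x + y) - q a" by (simp add: algebra_simps)
      qed
      then show "q a \<le> rk_sup D q (x + y) - rk_sup D q y" by (simp add: algebra_simps)
    qed
    then show "rk_sup D q x + rk_sup D q y \<le> rk_sup D q (x + y)" by (simp add: algebra_simps)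
  qed
qed

end

section \<open>The dual as a Banach lattice\<close>

instantiation blinfun :: (banach_lattice, real_line) banach_lattice
begin

definition less_eq_blinfun :: "('a \<Rightarrow>\<^sub>L 'b) \<Rightarrow> ('a \<Rightarrow>\<^sub>L 'b) \<Rightarrow> bool" where
  "f \<le> g \<longleftrightarrow> (\<forall>x\<ge>0. blinfun_apply f x \<le> blinfun_apply g x)"

definition less_blinfun :: "('a \<Rightarrow>\<^sub>L 'b) \<Rightarrow> ('a \<Rightarrow>\<^sub>L 'b) \<Rightarrow> bool" where
  "(f :: 'a \<Rightarrow>\<^sub>L 'b) < g \<longleftrightarrow> f \<le> g \<and> \<not> g \<le> f"

text \<open>The only supremum that has to be constructed: \<open>sup\<close> and \<open>inf\<close>
  are obtained from the positive part of f - g by translation.\<close>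

definition blinfun_pos_part :: "('a \<Rightarrow>\<^sub>L 'b) \<Rightarrow> 'a \<Rightarrow>\<^sub>L 'b" where
  "blinfun_pos_part f = Blinfun (cone_ext (rk_sup {x. 0 \<le> x} (blinfun_apply f)))"

definition sup_blinfun :: "('a \<Rightarrow>\<^sub>L 'b) \<Rightarrow> ('a \<Rightarrow>\<^sub>L 'b) \<Rightarrow> 'a \<Rightarrow>\<^sub>L 'b" where
  "sup f g = g + blinfun_pos_part (f - g)"

definition inf_blinfun :: "('a \<Rightarrow>\<^sub>L 'b) \<Rightarrow> ('a \<Rightarrow>\<^sub>L 'b) \<Rightarrow> 'a \<Rightarrow>\<^sub>L 'b" where
  "inf f g = f - blinfun_pos_part (f - g)"

definition abs_blinfun :: "('a \<Rightarrow>\<^sub>L 'b) \<Rightarrow> 'a \<Rightarrow>\<^sub>L 'b" where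
  "\<bar>f :: 'a \<Rightarrow>\<^sub>L 'b\<bar> = sup f (- f)"

lemma bdd_above_functional:
  fixes f :: "'a \<Rightarrow>\<^sub>L 'b"
  shows "bdd_above {blinfun_apply f y | y. y \<in> {y. 0 \<le> y} \<and> y \<le> x}"
proof (rule bdd_aboveI)
  fix r assume "r \<in> {blinfun_apply f y | y. y \<in> {y. 0 \<le> y} \<and> y \<le> x}"
  then obtain y where y: "r = f y" "0 \<le> y" "y \<le> x" by blast
  have "norm (f y) \<le> norm f * norm x"
    by (rule order_trans[OF norm_blinfun mult_left_mono[OF norm_mono_pos[OF y(2,3)]]]) simp
  then have "norm (f y) *\<^sub>R (1::'b) \<le> (norm f * norm x) *\<^sub>R 1"
    by (rule scaleR_right_mono[OF _ real_line_one_nonneg])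
  then show "r \<le> (norm f * norm x) *\<^sub>R 1"
    using real_line_le[of "f y"] y(1) by (meson order_trans)
qed

lemma blinfun_pos_part:
  fixes f :: "'a \<Rightarrow>\<^sub>L 'b"
  assumes "0 \<le> x"
  shows "blinfun_apply (blinfun_pos_part f) x = rk_sup {x. 0 \<le> x} (blinfun_apply f) x"
proof -
  have a: "additive_on {x. 0 \<le> x} (rk_sup {x. 0 \<le> x} (blinfun_apply f))"
    by (rule additive_on_rk_sup[OF solid_cone_nonneg]) (use bdd_above_functional in \<open>auto simp: blinfun.add_right\<close>)
  show ?thesis
    using cone_ext_bounded_linear(1,2)[OF a] assms
    by (simp add: blinfun_pos_part_def bounded_linear_Blinfun_apply)
qed

lemma blinfun_pos_part_upper:
  "0 \<le> y \<Longrightarrow> y \<le> x \<Longrightarrow> blinfun_apply f y \<le> blinfun_apply (blinfun_pos_part f) x"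
  for f :: "'a \<Rightarrow>\<^sub>L 'b"
  using order_trans[of 0 y x] rk_sup_upper[OF solid_cone_nonneg, of "blinfun_apply f" x y] bdd_above_functional[of f]
  by (simp add: blinfun_pos_part blinfun.add_right)

lemma blinfun_pos_part_least:
  "0 \<le> x \<Longrightarrow> (\<And>y. 0 \<le> y \<Longrightarrow> y \<le> x \<Longrightarrow> blinfun_apply f y \<le> c) \<Longrightarrow> blinfun_apply (blinfun_pos_part f) x \<le> c"
  for f :: "'a \<Rightarrow>\<^sub>L 'b"
  using rk_sup_least[OF solid_cone_nonneg, of "blinfun_apply f" x c] bdd_above_functional[of f]
  by (simp add: blinfun_pos_part blinfun.add_right)

lemma blinfun_pos_part_ge: "f \<le> blinfun_pos_part f" "0 \<le> blinfun_pos_part f" for f :: "'a \<Rightarrow>\<^sub>L 'b"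
proof -
  show "f \<le> blinfun_pos_part f"
    unfolding less_eq_blinfun_def using blinfun_pos_part_upper by blast
  show "0 \<le> blinfun_pos_part f"
    unfolding less_eq_blinfun_def using blinfun_pos_part_upper[of 0 _ f] by (simp add: blinfun.zero_right)
qed

lemma blinfun_pos_part_le:
  fixes f :: "'a \<Rightarrow>\<^sub>L 'b"
  assumes "f \<le> g" "0 \<le> g"
  shows "blinfun_pos_part f \<le> g"
  unfolding less_eq_blinfun_def
proof (intro allI impI)
  fix x :: 'a assume x: "0 \<le> x"
  show "blinfun_pos_part f x \<le> g x"
  proof (rule blinfun_pos_part_least[OF x])
    fix y assume y: "0 \<le> y" "y \<le> x"
    have "f y \<le> g y" using assms(1) y by (simp add: less_eq_blinfun_def)
    also have "\<dots> \<le> g y + g (x - y)" using assms(2) y by (simp add: less_eq_blinfun_def)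
    also have "\<dots> = g x" by (simp flip: blinfun.add_right)
    finally show "f y \<le> g x" .
  qed
qed

instance
proof
  fix f g h :: "'a \<Rightarrow>\<^sub>L 'b"
  show add: "g \<le> h \<Longrightarrow> f + g \<le> f + h" for f g h :: "'a \<Rightarrow>\<^sub>L 'b"
    by (simp add: less_eq_blinfun_def blinfun.add_left)
  have le_iff: "f \<le> g \<longleftrightarrow> f - g \<le> 0" "f \<le> g \<longleftrightarrow> 0 \<le> g - f" for f g :: "'a \<Rightarrow>\<^sub>L 'b"
    by (simp_all add: less_eq_blinfun_def blinfun.diff_left)
  show "(f < g) = (f \<le> g \<and> \<not> g \<le> f)" by (rule less_blinfun_def)
  show "f \<le> f" by (simp add: less_eq_blinfun_def)
  show tr: "f \<le> g \<Longrightarrow> g \<le> h \<Longrightarrow> f \<le> h" for f g h :: "'a \<Rightarrow>\<^sub>L 'b"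
    unfolding less_eq_blinfun_def by (meson order_trans)
  show "f = g" if "f \<le> g" "g \<le> f"
  proof (rule blinfun_eqI)
    fix x
    have e: "f y = g y" if "0 \<le> y" for y
      using that \<open>f \<le> g\<close> \<open>g \<le> f\<close> by (simp add: less_eq_blinfun_def order.antisym)
    have "f (pprt x) - f (- nprt x) = g (pprt x) - g (- nprt x)" by (simp add: e)
    then show "f x = g x"
      by (metis blinfun.diff_right prts diff_minus_eq_add)
  qed
  show "a *\<^sub>R f \<le> a *\<^sub>R g" if "f \<le> g" "0 \<le> a" for a
    using that by (simp add: less_eq_blinfun_def blinfun.scaleR_left scaleR_left_mono)
  show "a *\<^sub>R f \<le> b *\<^sub>R f" if "a \<le> b" "0 \<le> f" for a b
    using that by (simp add: less_eq_blinfun_def blinfun.scaleR_left scaleR_right_mono)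
  have i1: "f - blinfun_pos_part (f - g) \<le> f" and i2: "f - blinfun_pos_part (f - g) \<le> g"
    and s1: "g \<le> g + blinfun_pos_part (f - g)" and s2: "f \<le> g + blinfun_pos_part (f - g)"
    for f g :: "'a \<Rightarrow>\<^sub>L 'b"
    using blinfun_pos_part_ge[of "f - g"]
    by (simp_all add: less_eq_blinfun_def blinfun.add_left blinfun.diff_left algebra_simps)
  show "inf f g \<le> f" "inf f g \<le> g" by (simp_all add: inf_blinfun_def i1 i2)
  show "f \<le> sup f g" "g \<le> sup f g" by (simp_all add: sup_blinfun_def s1 s2)
  show "f \<le> inf g h" if "f \<le> g" "f \<le> h"
  proof -
    have "blinfun_pos_part (g - h) \<le> g - f"
      by (rule blinfun_pos_part_le)
        (use that in \<open>simp_all add: less_eq_blinfun_def blinfun.diff_left\<close>)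
    then show ?thesis
      by (simp add: inf_blinfun_def less_eq_blinfun_def blinfun.add_left blinfun.diff_left algebra_simps)
  qed
  show "sup g h \<le> f" if "g \<le> f" "h \<le> f"
  proof -
    have "blinfun_pos_part (g - h) \<le> f - h"
      by (rule blinfun_pos_part_le)
        (use that in \<open>simp_all add: less_eq_blinfun_def blinfun.diff_left\<close>)
    then show ?thesis
      by (simp add: sup_blinfun_def less_eq_blinfun_def blinfun.add_left blinfun.diff_left algebra_simps)
  qed
  show "\<bar>f\<bar> = sup f (- f)" by (rule abs_blinfun_def)
  show "norm f \<le> norm g" if fg: "\<bar>f\<bar> \<le> \<bar>g\<bar>"
  proof (rule norm_blinfun_bound)
    fix x :: 'a
    \<comment> \<open>By the formula for \<open>sup\<close>, |g| is (2 g)^+ - g. For z between 0 and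
      y, the number 2 g z - g y is the value of g at z - (y - z), whose modulus is at most
      y.\<close>
    have ub: "\<bar>g\<bar> y \<le> (norm g * norm y) *\<^sub>R 1" if y: "0 \<le> y" for y
    proof -
      have "blinfun_pos_part (g - - g) y \<le> (norm g * norm y) *\<^sub>R 1 + g y"
      proof (rule blinfun_pos_part_least[OF y])
        fix z assume z: "0 \<le> z" "z \<le> y"
        have "(g - - g) z - g y = g (z - (y - z))"
          by (simp add: blinfun.diff_left blinfun.add_left blinfun.diff_right blinfun.minus_left)
        also have "\<dots> \<le> norm (g (z - (y - z))) *\<^sub>R 1" by (rule real_line_le)
        also have "\<dots> \<le> (norm g * norm y) *\<^sub>R 1"
        proof -
          have "\<bar>z - (y - z)\<bar> \<le> y"
            by (rule abs_leI) (use z in \<open>simp_all add: algebra_simps add_mono\<close>)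
          then have "norm (z - (y - z)) \<le> norm y" by (rule norm_le_of_abs_le)
          then have "norm (g (z - (y - z))) \<le> norm g * norm y"
            by (meson norm_blinfun order_trans mult_left_mono norm_ge_zero)
          then show ?thesis by (rule scaleR_right_mono[OF _ real_line_one_nonneg])
        qed
        finally show "(g - - g) z \<le> (norm g * norm y) *\<^sub>R 1 + g y" by (simp add: algebra_simps)
      qed
      then show ?thesis
        by (simp add: abs_blinfun_def sup_blinfun_def blinfun.add_left blinfun.diff_left blinfun.minus_left algebra_simps)
    qed
    have "f (pprt x) \<le> \<bar>f\<bar> (pprt x)" "(- f) (pprt x) \<le> \<bar>f\<bar> (pprt x)"
      "f (- nprt x) \<le> \<bar>f\<bar> (- nprt x)" "(- f) (- nprt x) \<le> \<bar>f\<bar> (- nprt x)"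
      using s1[of "- f" f] s2[of f "- f"]
      by (simp_all add: abs_blinfun_def sup_blinfun_def less_eq_blinfun_def)
    then have "f (pprt x) + (- f) (- nprt x) \<le> \<bar>f\<bar> (pprt x) + \<bar>f\<bar> (- nprt x)"
      "(- f) (pprt x) + f (- nprt x) \<le> \<bar>f\<bar> (pprt x) + \<bar>f\<bar> (- nprt x)"
      by (blast intro: add_mono)+
    moreover have "f x = f (pprt x) + f (nprt x)"
      by (simp flip: blinfun.add_right prts)
    then have "f (pprt x) + (- f) (- nprt x) = f x" "(- f) (pprt x) + f (- nprt x) = - f x"
      by (simp_all add: blinfun.minus_left blinfun.minus_right)
    moreover have "\<bar>f\<bar> (pprt x) + \<bar>f\<bar> (- nprt x) = \<bar>f\<bar> \<bar>x\<bar>"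
      by (simp add: abs_prts flip: blinfun.add_right)
    ultimately have "\<bar>f x\<bar> \<le> \<bar>f\<bar> \<bar>x\<bar>" by (intro abs_leI) simp_all
    also have "\<dots> \<le> \<bar>g\<bar> \<bar>x\<bar>" using fg by (simp add: less_eq_blinfun_def)
    also have "\<dots> \<le> (norm g * norm x) *\<^sub>R 1" using ub[of "\<bar>x\<bar>"] by simp
    finally have "norm (f x) \<le> norm ((norm g * norm x) *\<^sub>R (1::'b))" by (rule norm_le_of_abs_le)
    also have "\<dots> \<le> norm g * norm x"
      using mult_left_mono[OF norm_real_line_one_le[where ?'a = 'b], of "norm g * norm x"] by simp
    finally show "norm (f x) \<le> norm g * norm x" .
  qed simp
qed

end

lemma blinfun_nonneg: "0 \<le> f \<Longrightarrow> 0 \<le> x \<Longrightarrow> 0 \<le> blinfun_apply f x"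
  for f :: "'a::banach_lattice \<Rightarrow>\<^sub>L 'b::real_line"
  by (auto simp: less_eq_blinfun_def)

lemma blinfun_mono: "0 \<le> f \<Longrightarrow> x \<le> y \<Longrightarrow> blinfun_apply f x \<le> blinfun_apply f y"
  for f :: "'a::banach_lattice \<Rightarrow>\<^sub>L 'b::real_line"
  using blinfun_nonneg[of f "y - x"] by (simp add: blinfun.diff_right)

lemma blinfun_leD: "f \<le> g \<Longrightarrow> 0 \<le> x \<Longrightarrow> blinfun_apply f x \<le> blinfun_apply g x"
  for f :: "'a::banach_lattice \<Rightarrow>\<^sub>L 'b::real_line"
  by (simp add: less_eq_blinfun_def)

lemma additive_on_blinfun:
  fixes p :: "'a::banach_lattice \<Rightarrow> 'b::banach_lattice"
  assumes p: "additive_on {x. 0 \<le> x} p"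
  obtains P where "\<And>x. 0 \<le> x \<Longrightarrow> blinfun_apply P x = p x"
proof
  show "Blinfun (cone_ext p) x = p x" if "0 \<le> x" for x
    using cone_ext_bounded_linear(1,2)[OF p] that by (simp add: bounded_linear_Blinfun_apply)
qed

lemma pprt_blinfun: "pprt f = blinfun_pos_part f" for f :: "'a::banach_lattice \<Rightarrow>\<^sub>L 'b::real_line"
  by (simp add: pprt_def sup_blinfun_def)

text \<open>The pointwise supremum is additive on the cone since two indices can be replaced by
  their maximum. Subtracting \<open>s 0\<close> first makes it positive, as the extension from the
  cone requires.\<close>

lemma incseq_blinfun_lub:
  fixes s :: "nat \<Rightarrow> 'a::banach_lattice \<Rightarrow>\<^sub>L 'b::real_line"
  assumes inc: "\<And>m n. m \<le> n \<Longrightarrow> s m \<le> s n" and ub: "\<And>n. s n \<le> g"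
  obtains h where "\<And>n. s n \<le> h" "\<And>u. (\<And>n. s n \<le> u) \<Longrightarrow> h \<le> u"
proof -
  define p where "p x = (SUP n. (s n - s 0) x)" for x
  have bdd: "bdd_above (range (\<lambda>n. (s n - s 0) x))" if "0 \<le> x" for x
    using blinfun_leD[OF ub that]
    by (intro bdd_aboveI[of _ "(g - s 0) x"]) (auto simp: blinfun.diff_left)
  have up: "(s n - s 0) x \<le> p x" if "0 \<le> x" for x n
    unfolding p_def by (rule cSUP_upper[OF _ bdd[OF that]]) simp
  have least: "p x \<le> c" if "\<And>n. (s n - s 0) x \<le> c" for x c
    unfolding p_def by (rule cSUP_least) (use that in auto)
  have "additive_on {x. 0 \<le> x} p"
    unfolding additive_on_def
  proof (intro conjI ballI)
    fix x :: 'a assume "x \<in> {x. 0 \<le> x}"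
    then have x: "0 \<le> x" by simp
    show "0 \<le> p x" using up[OF x, of 0] by simp
    fix y :: 'a assume "y \<in> {x. 0 \<le> x}"
    then have y: "0 \<le> y" by simp
    show "p (x + y) = p x + p y"
    proof (rule order.antisym)
      show "p (x + y) \<le> p x + p y"
        using up[OF x] up[OF y] by (intro least) (simp add: blinfun.add_right add_mono)
      have "p x \<le> p (x + y) - p y"
      proof (rule least)
        fix m
        have "p y \<le> p (x + y) - (s m - s 0) x"
        proof (rule least)
          fix n
          have "(s m - s 0) x + (s n - s 0) y \<le> (s (max m n) - s 0) x + (s (max m n) - s 0) y"
            using blinfun_leD[OF inc x, of m "max m n"] blinfun_leD[OF inc y, of n "max m n"]
            by (simp add: blinfun.diff_left add_mono)
          also have "\<dots> \<le> p (x + y)"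
            using up[of "x + y" "max m n"] x y by (simp add: blinfun.add_right)
          finally show "(s n - s 0) y \<le> p (x + y) - (s m - s 0) x"
            by (simp add: le_diff_eq add.commute)
        qed
        then show "(s m - s 0) x \<le> p (x + y) - p y"
          by (simp add: le_diff_eq add.commute)
      qed
      then show "p x + p y \<le> p (x + y)" by (simp add: le_diff_eq)
    qed
  qed
  then obtain P where P: "\<And>x. 0 \<le> x \<Longrightarrow> blinfun_apply P x = p x"
    by (rule additive_on_blinfun) blast
  show thesis
  proof
    show "s n \<le> s 0 + P" for n
      unfolding less_eq_blinfun_def
      using up[of _ n] P by (simp add: blinfun.add_left blinfun.diff_left diff_le_eq add.commute)
    show "s 0 + P \<le> u" if "\<And>n. s n \<le> u" for u
      unfolding less_eq_blinfun_def
    proof (intro allI impI)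
      fix x :: 'a assume x: "0 \<le> x"
      have "p x \<le> (u - s 0) x"
        using blinfun_leD[OF that x] by (intro least) (simp add: blinfun.diff_left)
      then show "(s 0 + P) x \<le> u x" using P[OF x]
        by (simp add: blinfun.add_left blinfun.diff_left le_diff_eq add.commute)
    qed
  qed
qed

text \<open>Suprema of initial segments of an enumeration reduce the claim to an increasing
  sequence. This instance allows the results on weak* null sequences to be applied to functionals on
  E'.\<close>

instance blinfun :: (banach_lattice, real_line) sigma_dedekind_complete
proof
  fix A :: "('a \<Rightarrow>\<^sub>L 'b) set"
  assume A: "A \<noteq> {}" "countable A" "bdd_above A"
  define a where "a = from_nat_into A"
  have ra: "range a = A" using A unfolding a_def by (simp add: range_from_nat_into)
  obtain g where g: "\<And>f. f \<in> A \<Longrightarrow> f \<le> g" using A(3) by (auto simp: bdd_above_def)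
  define s where "s = rec_nat (a 0) (\<lambda>n f. sup f (a (Suc n)))"
  have s0: "s 0 = a 0" and sS: "s (Suc n) = sup (s n) (a (Suc n))" for n
    by (simp_all add: s_def)
  have inc: "s m \<le> s n" if "m \<le> n" for m n
    by (rule lift_Suc_mono_le[OF _ that]) (simp add: sS)
  have le: "s n \<le> u" if "\<And>f. f \<in> A \<Longrightarrow> f \<le> u" for u n
    using that by (induction n) (auto simp: s0 sS simp flip: ra)
  have as: "a n \<le> s n" for n by (cases n) (simp_all add: s0 sS)
  obtain h where h: "\<And>n. s n \<le> h" "\<And>u. (\<And>n. s n \<le> u) \<Longrightarrow> h \<le> u"
    using incseq_blinfun_lub[of s g] inc le g by blast
  have "h \<le> u" if "\<forall>f\<in>A. f \<le> u" for u
    using that le by (intro h(2)) blast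
  moreover have "a n \<le> h" for n using as h(1) by (rule order_trans)
  ultimately have "(\<forall>f\<in>A. f \<le> h) \<and> (\<forall>u. (\<forall>f\<in>A. f \<le> u) \<longrightarrow> h \<le> u)"
    by (auto simp flip: ra)
  then show "\<exists>s. (\<forall>a\<in>A. a \<le> s) \<and> (\<forall>u. (\<forall>a\<in>A. a \<le> u) \<longrightarrow> s \<le> u)" ..
qed

lemma abs_blinfun_apply_le: "\<bar>blinfun_apply f x\<bar> \<le> blinfun_apply \<bar>f\<bar> \<bar>x\<bar>"
  for f :: "'a::banach_lattice \<Rightarrow>\<^sub>L real"
proof -
  have "f (pprt x) \<le> \<bar>f\<bar> (pprt x)" "(- f) (pprt x) \<le> \<bar>f\<bar> (pprt x)"
    "f (- nprt x) \<le> \<bar>f\<bar> (- nprt x)" "(- f) (- nprt x) \<le> \<bar>f\<bar> (- nprt x)"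
    by (intro blinfun_leD abs_ge_self abs_ge_minus_self; simp)+
  moreover have "f x = f (pprt x) + f (nprt x)"
    by (simp flip: blinfun.add_right prts)
  moreover have "\<bar>f\<bar> \<bar>x\<bar> = \<bar>f\<bar> (pprt x) + \<bar>f\<bar> (- nprt x)"
    by (simp add: abs_prts flip: blinfun.add_right)
  ultimately show ?thesis
    by (simp add: blinfun.minus_left blinfun.minus_right)
qed

lemma pprt_blinfun_approx:
  fixes f :: "'a::banach_lattice \<Rightarrow>\<^sub>L real"
  assumes "0 \<le> x" "c < blinfun_apply (pprt f) x"
  obtains y where "0 \<le> y" "y \<le> x" "c < blinfun_apply f y"
  using blinfun_pos_part_least[OF assms(1), of f c] assms(2) by (fastforce simp: pprt_blinfun)

text \<open>One of the two values f^+ x and f^- x is at least half of |f| x. Asking for a quarter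
  leaves the slack by which the Riesz-Kantorovich supremum can be replaced by the value at an actual
  y.\<close>

lemma abs_blinfun_approx:
  fixes f :: "'a::banach_lattice \<Rightarrow>\<^sub>L real"
  assumes x: "0 \<le> x"
  shows "\<exists>y. 0 \<le> y \<and> y \<le> x \<and> blinfun_apply \<bar>f\<bar> x \<le> 4 * \<bar>blinfun_apply f y\<bar>"
proof (cases "\<bar>f\<bar> x > 0")
  case True
  have "\<bar>f\<bar> = pprt f + pprt (- f)" by (simp add: abs_prts pprt_neg)
  then have e: "\<bar>f\<bar> x = pprt f x + pprt (- f) x" by (simp add: blinfun.add_left)
  then have "\<bar>f\<bar> x / 4 < pprt f x \<or> \<bar>f\<bar> x / 4 < pprt (- f) x" using True by linarith
  then show ?thesis
  proof
    assume "\<bar>f\<bar> x / 4 < pprt f x"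
    from pprt_blinfun_approx[OF x this] obtain y where "0 \<le> y" "y \<le> x" "\<bar>f\<bar> x / 4 < f y" .
    then show ?thesis by (intro exI[of _ y]) auto
  next
    assume "\<bar>f\<bar> x / 4 < pprt (- f) x"
    from pprt_blinfun_approx[OF x this] obtain y where "0 \<le> y" "y \<le> x" "\<bar>f\<bar> x / 4 < (- f) y" .
    then show ?thesis by (intro exI[of _ y]) (auto simp: blinfun.minus_left)
  qed
next
  case False
  then show ?thesis using x by (intro exI[of _ 0]) auto
qed

subsection \<open>Functionals on principal ideals\<close>

definition ideal_cone :: "'a::banach_lattice \<Rightarrow> 'a set" where
  "ideal_cone u = {y. 0 \<le> y \<and> (\<exists>c\<ge>0. y \<le> c *\<^sub>R u)}"

lemma solid_cone_ideal: "solid_cone (ideal_cone u)"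
  unfolding solid_cone_def
proof (intro conjI ballI allI impI)
  show "0 \<in> ideal_cone u" unfolding ideal_cone_def by (auto intro!: exI[of _ 0])
  fix x assume x: "x \<in> ideal_cone u"
  then show "0 \<le> x" by (simp add: ideal_cone_def)
  show "x + y \<in> ideal_cone u" if y: "y \<in> ideal_cone u" for y
  proof -
    obtain c d where cd: "0 \<le> c" "x \<le> c *\<^sub>R u" "0 \<le> d" "y \<le> d *\<^sub>R u"
      using x y by (auto simp: ideal_cone_def)
    have "x + y \<le> (c + d) *\<^sub>R u" using cd by (simp add: scaleR_left_distrib add_mono)
    then show ?thesis using x y cd unfolding ideal_cone_def
      by (intro CollectI conjI exI[of _ "c + d"]) simp_all
  qed
  show "y \<in> ideal_cone u" if "0 \<le> y" "y \<le> x" for y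
    using x that order_trans unfolding ideal_cone_def by blast
qed

lemma ideal_cone_self: "0 \<le> u \<Longrightarrow> u \<in> ideal_cone u"
  unfolding ideal_cone_def by (auto intro!: exI[of _ 1])

text \<open>The Riesz-Kantorovich extension from the ideal is the least positive one. Hence it stays
  below \<open>h\<close> and vanishes on whatever is disjoint from \<open>u\<close>.\<close>

lemma functional_extension:
  fixes q :: "'a::banach_lattice \<Rightarrow> real" and h :: "'a \<Rightarrow>\<^sub>L real"
  assumes q: "additive_on (ideal_cone u) q" and h: "0 \<le> h"
    and qh: "\<And>y. y \<in> ideal_cone u \<Longrightarrow> q y \<le> blinfun_apply h y"
  obtains r where "0 \<le> r" "r \<le> h" "\<And>y. y \<in> ideal_cone u \<Longrightarrow> blinfun_apply r y = q y"
    "\<And>x. 0 \<le> x \<Longrightarrow> inf x u = 0 \<Longrightarrow> blinfun_apply r x = 0"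
proof -
  let ?D = "ideal_cone u"
  note D = solid_cone_ideal[of u]
  have qhx: "q y \<le> h x" if "y \<in> ?D" "y \<le> x" for x y
    using qh[OF that(1)] blinfun_mono[OF h that(2)] by simp
  have bdd: "bdd_above {q y | y. y \<in> ?D \<and> y \<le> x}" for x
    by (rule bdd_aboveI[of _ "h x"]) (use qhx in auto)
  have add: "q (x + y) = q x + q y" if "x \<in> ?D" "y \<in> ?D" for x y
    using additive_onD(2)[OF q] that by simp
  note upper = rk_sup_upper[OF D add bdd] and least = rk_sup_least[OF D add bdd]
  obtain r where r: "\<And>x. 0 \<le> x \<Longrightarrow> blinfun_apply r x = rk_sup ?D q x"
    using additive_on_blinfun[OF additive_on_rk_sup[OF D add bdd]] by blast
  have q0: "q 0 = 0" by (rule additive_on_0[OF D q])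
  show thesis
  proof
    show "0 \<le> r" unfolding less_eq_blinfun_def
      using upper[OF _ _ _ solid_coneD(1)[OF D]] r q0 by auto
    show "r \<le> h" unfolding less_eq_blinfun_def
      using least qhx r by (metis (no_types, lifting))
    show "r y = q y" if y: "y \<in> ?D" for y
    proof -
      have y0: "0 \<le> y" using solid_coneD[OF D] y by blast
      have "rk_sup ?D q y \<le> q y"
        by (rule least) (use y y0 additive_on_mono[OF D q y] solid_coneD(2)[OF D] in auto)
      moreover have "q y \<le> rk_sup ?D q y" by (rule upper) (use y y0 in auto)
      ultimately show ?thesis using r[OF y0] by simp
    qed
    show "r x = 0" if x: "0 \<le> x" "inf x u = 0" for x
    proof -
      have "q y \<le> 0" if y: "y \<in> ?D" "y \<le> x" for y
      proof -
        obtain c where c: "0 \<le> y" "0 \<le> c" "y \<le> c *\<^sub>R u" using y by (auto simp: ideal_cone_def)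
        have "y \<le> inf x (c *\<^sub>R u)" using y c by simp
        also have "\<dots> = 0" by (rule disjoint_scaleR[OF x(2) c(2)])
        finally have "y = 0" using c by (simp add: order.antisym)
        then show ?thesis using q0 by simp
      qed
      then have "rk_sup ?D q x \<le> 0" by (intro least) (use x in auto)
      moreover have "0 \<le> rk_sup ?D q x" using upper[OF _ _ x(1) solid_coneD(1)[OF D] x(1)] q0 by simp
      ultimately show ?thesis using r[OF x(1)] by simp
    qed
  qed
qed

section \<open>The canonical embedding into the bidual\<close>

definition evaluation :: "'a::banach_lattice \<Rightarrow> ('a \<Rightarrow>\<^sub>L real) \<Rightarrow>\<^sub>L real" where
  "evaluation x = Blinfun (\<lambda>f. blinfun_apply f x)"

lemma evaluation_apply [simp]: "blinfun_apply (evaluation x) f = blinfun_apply f x"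
  by (simp add: evaluation_def bounded_linear_Blinfun_apply blinfun.bounded_linear_left)

text \<open>Restricting h to the ideal of x^+ and extending minimally gives r between 0 and h with r
  (x^-) = 0. Then r x = h (x^+), so the Riesz-Kantorovich supremum over [0, h] attains this
  value.\<close>

lemma pprt_evaluation: "pprt (evaluation x) = evaluation (pprt x)"
proof (rule order.antisym)
  have "evaluation x \<le> evaluation (pprt x)" "0 \<le> evaluation (pprt x)"
    by (auto simp: less_eq_blinfun_def[where 'a = "'a \<Rightarrow>\<^sub>L real"] intro: blinfun_mono blinfun_nonneg le_pprt)
  then show "pprt (evaluation x) \<le> evaluation (pprt x)" by (simp add: pprt_le_iff)
  show "evaluation (pprt x) \<le> pprt (evaluation x)"
    unfolding less_eq_blinfun_def[where 'a = "'a \<Rightarrow>\<^sub>L real"]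
  proof (intro allI impI)
    fix h :: "'a \<Rightarrow>\<^sub>L real" assume h: "0 \<le> h"
    have "additive_on (ideal_cone (pprt x)) (blinfun_apply h)"
      unfolding additive_on_def
      by (auto simp: blinfun.add_right ideal_cone_def intro: blinfun_nonneg h)
    then obtain r where r: "0 \<le> r" "r \<le> h" "\<And>y. y \<in> ideal_cone (pprt x) \<Longrightarrow> blinfun_apply r y = h y"
      "\<And>y. 0 \<le> y \<Longrightarrow> inf y (pprt x) = 0 \<Longrightarrow> blinfun_apply r y = 0"
      using functional_extension[of "pprt x" "blinfun_apply h" h] h by blast
    have "r (- nprt x) = 0" by (rule r(4)) (use inf_pprt_nprt[of x] in \<open>simp_all add: inf_commute\<close>)
    then have "h (pprt x) = r (pprt x) + r (nprt x)"
      using r(3)[OF ideal_cone_self[of "pprt x"]] by (simp add: blinfun.minus_right)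
    also have "\<dots> = evaluation x r" by (simp flip: blinfun.add_right prts)
    also have "\<dots> \<le> pprt (evaluation x) h"
      unfolding pprt_blinfun by (rule blinfun_pos_part_upper[OF r(1,2)])
    finally show "evaluation (pprt x) h \<le> pprt (evaluation x) h" by simp
  qed
qed

lemma evaluation_linear:
  "evaluation (x + y) = evaluation x + evaluation y" "evaluation (x - y) = evaluation x - evaluation y"
  "evaluation (- x) = - evaluation x"
  "evaluation (c *\<^sub>R x) = c *\<^sub>R evaluation x" "evaluation 0 = 0"
  by (auto intro!: blinfun_eqI simp: blinfun.bilinear_simps)

lemma evaluation_sum: "evaluation (sum x A) = (\<Sum>i\<in>A. evaluation (x i))"
  by (induction A rule: infinite_finite_induct) (simp_all add: evaluation_linear)

lemma abs_evaluation: "\<bar>evaluation x\<bar> = evaluation \<bar>x\<bar>"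
proof -
  have "\<bar>evaluation x\<bar> = pprt (evaluation x) + pprt (- evaluation x)" by (simp add: abs_prts pprt_neg)
  also have "\<dots> = evaluation (pprt x + pprt (- x))"
    by (simp add: pprt_evaluation evaluation_linear flip: evaluation_linear(3))
  also have "pprt x + pprt (- x) = \<bar>x\<bar>" by (simp add: abs_prts pprt_neg)
  finally show ?thesis .
qed

subsection \<open>The uniform boundedness principle\<close>

lemma uniform_boundedness:
  fixes f :: "nat \<Rightarrow> 'a::banach \<Rightarrow>\<^sub>L 'b::real_normed_vector"
  assumes bdd: "\<And>x. \<exists>c. \<forall>n. norm (blinfun_apply (f n) x) \<le> c"
  obtains K where "0 \<le> K" "\<And>n. norm (f n) \<le> K"
proof -
  define C where "C k = {x. \<forall>n. norm (f n x) \<le> real k}" for k :: nat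
  have cl: "closed (C k)" for k
    unfolding C_def by (intro closed_Collect_all closed_Collect_le continuous_intros)
  have "(\<Union>k. C k) = UNIV"
  proof (intro equalityI subsetI UNIV_I)
    fix x
    obtain c where c: "\<forall>n. norm (f n x) \<le> c" using bdd by blast
    obtain k :: nat where "c \<le> real k" using real_arch_simple by blast
    then have "x \<in> C k" using c order_trans unfolding C_def by blast
    then show "x \<in> (\<Union>k. C k)" by blast
  qed
  moreover have "euclidean interior_of (\<Union>(range C)) = {}" if "\<And>k. interior (C k) = {}"
    by (rule Baire_category_alt)
      (use that cl in \<open>auto simp: completely_metrizable_space_euclidean\<close>)
  ultimately obtain k where "interior (C k) \<noteq> {}" by fastforce
  then obtain a e where e: "0 < e" "ball a e \<subseteq> C k" by (auto simp: mem_interior)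
  show thesis
  proof
    \<comment> \<open>A vector of norm e / 2 has an image of norm at most 2 k, as the difference of
      the images of two points of the ball; 4 k / e is the quotient.\<close>
    show "0 \<le> 4 * real k / e" using e by simp
    fix n
    show "norm (f n) \<le> 4 * real k / e"
    proof (rule norm_blinfun_bound)
      fix x
      show "norm (f n x) \<le> 4 * real k / e * norm x"
      proof (cases "x = 0")
        case False
        define z where "z = (e / (2 * norm x)) *\<^sub>R x"
        have "norm z < e" using e False by (simp add: z_def)
        then have "a + z \<in> C k" "a \<in> C k" using e by (auto simp: dist_norm subset_iff)
        then have "norm (f n (a + z)) \<le> real k" "norm (f n a) \<le> real k" by (simp_all add: C_def)
        then have "norm (f n z) \<le> 2 * real k"
          using norm_triangle_ineq4[of "f n (a + z)" "f n a"] by (simp add: blinfun.add_right)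
        then show ?thesis using e False
          by (simp add: z_def blinfun.scaleR_right field_simps)
      qed (simp add: blinfun.zero_right)
    qed (use e in simp)
  qed
qed

lemma weak_star_null_bounded:
  fixes f :: "nat \<Rightarrow> 'a::banach_lattice \<Rightarrow>\<^sub>L real"
  assumes "\<And>y. (\<lambda>n. blinfun_apply (f n) y) \<longlonglongrightarrow> 0"
  obtains C where "0 \<le> C" "\<And>n. blinfun_apply \<bar>f n\<bar> t \<le> C"
proof -
  have "\<exists>c. \<forall>n. norm (f n x) \<le> c" for x
    using convergent_imp_Bseq[OF convergentI[OF assms[of x]]] by (auto simp: Bseq_def)
  then obtain K where K: "0 \<le> K" "\<And>n. norm (f n) \<le> K" by (rule uniform_boundedness) blast
  show thesis
  proof
    show "0 \<le> K * norm t" using K by simp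
    fix n
    have "\<bar>f n\<bar> t \<le> norm (\<bar>f n\<bar> t)" by simp
    also have "\<dots> \<le> norm \<bar>f n\<bar> * norm t" by (rule norm_blinfun)
    also have "\<dots> \<le> K * norm t" using K(2)[of n] by (intro mult_right_mono) auto
    finally show "\<bar>f n\<bar> t \<le> K * norm t" .
  qed
qed

subsection \<open>Rosenthal's lemma\<close>

text \<open>Kupka's argument: split the index set into infinitely many infinite pieces; if none of them
  works, picking a bad index in each piece lowers the total mass by \<open>\<delta>\<close>.\<close>

lemma rosenthal_aux:
  fixes \<mu> :: "nat \<Rightarrow> nat set \<Rightarrow> real"
  assumes nonneg: "\<And>n A. 0 \<le> \<mu> n A"
    and super: "\<And>n A B. A \<inter> B = {} \<Longrightarrow> \<mu> n A + \<mu> n B \<le> \<mu> n (A \<union> B)"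
    and \<delta>: "0 < \<delta>"
    and "infinite M" "\<forall>n\<in>M. \<mu> n M \<le> real K * \<delta>"
  shows "\<exists>M'\<subseteq>M. infinite M' \<and> (\<forall>n\<in>M'. \<mu> n (M' - {n}) < \<delta>)"
  using assms(4,5)
proof (induction K arbitrary: M)
  have mono: "\<mu> n A \<le> \<mu> n B" if "A \<subseteq> B" for n A B
    using super[of A "B - A" n] nonneg[of n "B - A"] that by (simp add: Un_absorb1)
  {
    case 0
    then show ?case
      using \<delta> mono[of "M - {n}" M n for n] by (intro exI[of _ M]) (fastforce intro: le_less_trans)
  next
    case (Suc K)
    define g where "g p i = enumerate M (prod_encode (p, i))" for p i
    have gM: "g p i \<in> M" for p i using Suc.prems(1) by (simp add: g_def enumerate_in_set)
    have ginj: "g p i = g p' i' \<longleftrightarrow> p = p' \<and> i = i'" for p i p' i'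
      using strict_mono_eq[OF strict_mono_enumerate[OF Suc.prems(1)]] by (simp add: g_def)
    define N where "N p = range (g p)" for p
    have Ninf: "infinite (N p)" for p
      unfolding N_def by (rule range_inj_infinite) (simp add: inj_def ginj)
    show ?case
    proof (cases "\<exists>p. \<forall>k\<in>N p. \<mu> k (N p - {k}) < \<delta>")
      case True
      then show ?thesis using Ninf gM unfolding N_def by blast
    next
      case False
      then have "\<forall>p. \<exists>i. \<mu> (g p i) (N p - {g p i}) \<ge> \<delta>" unfolding N_def by (auto simp: not_less)
      then obtain i where i: "\<And>p. \<mu> (g p (i p)) (N p - {g p (i p)}) \<ge> \<delta>" by metis
      define M1 where "M1 = range (\<lambda>p. g p (i p))"
      have M1: "M1 \<subseteq> M" using gM by (auto simp: M1_def)
      have inf1: "infinite M1" unfolding M1_def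
        by (rule range_inj_infinite) (simp add: inj_def ginj)
      have "\<mu> n M1 \<le> real K * \<delta>" if "n \<in> M1" for n
      proof -
        obtain p where p: "n = g p (i p)" using \<open>n \<in> M1\<close> by (auto simp: M1_def)
        \<comment> \<open>\<open>M1\<close> meets \<open>N p\<close> only in the chosen bad index
          \<open>n\<close>, so the mass of at least \<delta> on the rest of \<open>N p\<close> is
          lost in passing from \<open>M\<close> to \<open>M1\<close>.\<close>
        have "M1 \<inter> (N p - {n}) = {}" by (auto simp: M1_def N_def p ginj)
        then have "\<mu> n M1 + \<mu> n (N p - {n}) \<le> \<mu> n (M1 \<union> (N p - {n}))" by (rule super)
        also have "\<dots> \<le> \<mu> n M" by (rule mono) (use M1 gM in \<open>auto simp: N_def\<close>)
        also have "\<dots> \<le> real (Suc K) * \<delta>" using Suc.prems(2) M1 that by blast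
        finally show ?thesis using i[of p] p by (simp add: algebra_simps)
      qed
      then show ?thesis using Suc.IH[OF inf1] M1 by blast
    qed
  }
qed

lemma rosenthal:
  fixes \<mu> :: "nat \<Rightarrow> nat set \<Rightarrow> real"
  assumes nonneg: "\<And>n A. 0 \<le> \<mu> n A"
    and super: "\<And>n A B. A \<inter> B = {} \<Longrightarrow> \<mu> n A + \<mu> n B \<le> \<mu> n (A \<union> B)"
    and bdd: "\<And>n. \<mu> n M \<le> C" and \<delta>: "0 < \<delta>" and M: "infinite M"
  obtains M' where "M' \<subseteq> M" "infinite M'" "\<And>n. n \<in> M' \<Longrightarrow> \<mu> n (M' - {n}) < \<delta>"
proof -
  obtain K :: nat where "C / \<delta> \<le> real K" using real_arch_simple by blast
  then have "\<mu> n M \<le> real K * \<delta>" for n using bdd[of n] \<delta> by (simp add: field_simps)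
  then have "\<exists>M'\<subseteq>M. infinite M' \<and> (\<forall>n\<in>M'. \<mu> n (M' - {n}) < \<delta>)"
    using rosenthal_aux[where \<mu> = \<mu> and \<delta> = \<delta> and M = M and K = K] nonneg super \<delta> M by blast
  then show thesis using that by blast
qed

subsection \<open>Weak* null sequences on order intervals\<close>

text \<open>Sigma-Dedekind completeness provides the order sum \<open>B A\<close> of the terms with
  index in \<open>A\<close>, a superadditive set function. If |f n (b n)| >= e infinitely often,
  Rosenthal's lemma selects \<open>M'\<close> such that the terms other than the n-th contribute
  less than e / 2 to f n (B M'). Then the single element \<open>B M'\<close> violates weak*
  convergence.\<close>

lemma weak_star_null_order_series:
  fixes f :: "nat \<Rightarrow> 'a::{banach_lattice, sigma_dedekind_complete} \<Rightarrow>\<^sub>L real"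
    and b :: "nat \<Rightarrow> 'a"
  assumes f: "\<And>y. (\<lambda>n. blinfun_apply (f n) y) \<longlonglongrightarrow> 0"
    and b: "\<And>k. 0 \<le> b k" and bt: "\<And>K. (\<Sum>k<K. b k) \<le> t"
  shows "(\<lambda>n. blinfun_apply (f n) (b n)) \<longlonglongrightarrow> 0"
proof (rule ccontr)
  assume "\<not> ?thesis"
  then obtain e where e: "0 < e" "\<And>N. \<exists>n\<ge>N. \<not> \<bar>f n (b n)\<bar> < e"
    by (auto simp: LIMSEQ_iff)
  define M where "M = {n. e \<le> \<bar>f n (b n)\<bar>}"
  have Minf: "infinite M"
    unfolding infinite_nat_iff_unbounded_le M_def using e(2) by (force simp: not_less)
  define s where "s A K = (\<Sum>k<K. if k \<in> A then b k else 0)" for A K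
  have s0: "0 \<le> s A K" for A K unfolding s_def by (rule sum_nonneg) (use b in auto)
  have st: "s A K \<le> t" for A K
    unfolding s_def by (rule order_trans[OF sum_mono bt[of K]]) (use b in auto)
  have smono: "s A K \<le> s A L" if "K \<le> L" for A K L
    unfolding s_def by (rule sum_mono2) (use that b in auto)
  have "\<exists>l. (\<forall>a\<in>range (s A). a \<le> l) \<and> (\<forall>u. (\<forall>a\<in>range (s A). a \<le> u) \<longrightarrow> l \<le> u)" for A
    by (rule countable_bdd_above_has_lub) (use st in \<open>auto simp: bdd_above_def\<close>)
  then have "\<exists>l. (\<forall>K. s A K \<le> l) \<and> (\<forall>u. (\<forall>K. s A K \<le> u) \<longrightarrow> l \<le> u)" for A
    by (simp add: image_iff) 
  then obtain B where up: "\<And>A K. s A K \<le> B A" and least: "\<And>A u. (\<And>K. s A K \<le> u) \<Longrightarrow> B A \<le> u"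
    by metis
  have B0: "0 \<le> B A" for A using s0[of A 0] up[of A 0] by (rule order_trans)
  have Bt: "B A \<le> t" for A by (rule least) (rule st)
  have Bsuper: "B A + B A' \<le> B (A \<union> A')" if "A \<inter> A' = {}" for A A'
  proof -
    have "B A \<le> B (A \<union> A') - B A'"
    proof (rule least)
      fix K
      have "B A' \<le> B (A \<union> A') - s A K"
      proof (rule least)
        fix L
        have "s A K + s A' L \<le> s A (max K L) + s A' (max K L)"
          by (intro add_mono smono) auto
        also have "\<dots> = s (A \<union> A') (max K L)"
          unfolding s_def sum.distrib[symmetric] using that by (intro sum.cong) auto
        also have "\<dots> \<le> B (A \<union> A')" by (rule up)
        finally show "s A' L \<le> B (A \<union> A') - s A K" by (simp add: algebra_simps)
      qed
      then show "s A K \<le> B (A \<union> A') - B A'" by (simp add: algebra_simps)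
    qed
    then show ?thesis by (simp add: algebra_simps)
  qed
  have Binsert: "B A = b n + B (A - {n})" if "n \<in> A" for A n
  proof (rule order.antisym)
    show "B A \<le> b n + B (A - {n})"
    proof (rule least)
      fix K
      have "s A K = (\<Sum>k<K. if k = n then b n else 0) + s (A - {n}) K"
        unfolding s_def sum.distrib[symmetric] using that by (intro sum.cong) auto
      also have "\<dots> \<le> b n + B (A - {n})"
        by (intro add_mono up) (use b in auto)
      finally show "s A K \<le> b n + B (A - {n})" .
    qed
    have "s {n} (Suc n) = b n" unfolding s_def by (subst sum.lessThan_Suc) simp
    then have "b n \<le> B {n}" using up[of "{n}" "Suc n"] by simp
    then have "b n + B (A - {n}) \<le> B {n} + B (A - {n})" by simp
    also have "\<dots> \<le> B ({n} \<union> (A - {n}))" by (rule Bsuper) auto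
    also have "{n} \<union> (A - {n}) = A" using that by auto
    finally show "b n + B (A - {n}) \<le> B A" .
  qed
  obtain C where C: "\<And>n. blinfun_apply \<bar>f n\<bar> t \<le> C" using weak_star_null_bounded[OF f] by metis
  obtain M' where M': "M' \<subseteq> M" "infinite M'" "\<And>n. n \<in> M' \<Longrightarrow> \<bar>f n\<bar> (B (M' - {n})) < e / 2"
  proof (rule rosenthal[of "\<lambda>n A. \<bar>f n\<bar> (B A)" M C "e / 2"])
    show "0 \<le> \<bar>f n\<bar> (B A)" for n A by (rule blinfun_nonneg) (simp_all add: B0)
    show "\<bar>f n\<bar> (B A) + \<bar>f n\<bar> (B A') \<le> \<bar>f n\<bar> (B (A \<union> A'))" if "A \<inter> A' = {}" for n A A'
      unfolding blinfun.add_right[symmetric] by (rule blinfun_mono[OF _ Bsuper[OF that]]) simp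
    show "\<bar>f n\<bar> (B M) \<le> C" for n
      using blinfun_mono[OF _ Bt, of "\<bar>f n\<bar>" M] C[of n] by simp
  qed (use e Minf in auto)
  have big: "e / 2 \<le> \<bar>f n (B M')\<bar>" if "n \<in> M'" for n
  proof -
    have "f n (B M') = f n (b n) + f n (B (M' - {n}))"
      using Binsert[OF that] by (simp add: blinfun.add_right)
    moreover have "\<bar>f n (B (M' - {n}))\<bar> < e / 2"
      using abs_blinfun_apply_le[of "f n" "B (M' - {n})"] M'(3)[OF that] B0 by simp
    moreover have "e \<le> \<bar>f n (b n)\<bar>" using that M'(1) by (auto simp: M_def)
    ultimately show ?thesis by linarith
  qed
  obtain N where N: "\<And>n. n \<ge> N \<Longrightarrow> \<bar>f n (B M')\<bar> < e / 2"
    using LIMSEQ_D[OF f[of "B M'"], of "e / 2"] e(1) by auto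
  obtain n where "n \<in> M'" "n \<ge> N" using M'(2) unfolding infinite_nat_iff_unbounded_le by blast
  then show False using big N by fastforce
qed

text \<open>Inside [0, b n] there is some \<open>y n\<close> on which f n itself reaches a quarter
  of |f n| (b n), and the \<open>y n\<close> are bounded by the same series.\<close>

lemma abs_weak_star_null_order_series:
  fixes f :: "nat \<Rightarrow> 'a::{banach_lattice, sigma_dedekind_complete} \<Rightarrow>\<^sub>L real"
    and b :: "nat \<Rightarrow> 'a"
  assumes f: "\<And>y. (\<lambda>n. blinfun_apply (f n) y) \<longlonglongrightarrow> 0"
    and b: "\<And>k. 0 \<le> b k" and bt: "\<And>K. (\<Sum>k<K. b k) \<le> t"
  shows "(\<lambda>n. blinfun_apply \<bar>f n\<bar> (b n)) \<longlonglongrightarrow> 0"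
proof -
  have "\<forall>n. \<exists>y. 0 \<le> y \<and> y \<le> b n \<and> \<bar>f n\<bar> (b n) \<le> 4 * \<bar>f n y\<bar>"
    using abs_blinfun_approx[OF b] by blast
  then obtain y where y: "\<And>n. 0 \<le> y n" "\<And>n. y n \<le> b n"
      "\<And>n. blinfun_apply \<bar>f n\<bar> (b n) \<le> 4 * \<bar>blinfun_apply (f n) (y n)\<bar>"
    by metis
  have "(\<lambda>n. f n (y n)) \<longlonglongrightarrow> 0"
    by (rule weak_star_null_order_series[OF f y(1)]) (rule order_trans[OF sum_mono[OF y(2)] bt])
  then have lim: "(\<lambda>n. 4 * \<bar>f n (y n)\<bar>) \<longlonglongrightarrow> 0"
    using tendsto_mult_right_zero tendsto_rabs_zero by blast
  show ?thesis
  proof (rule tendsto_sandwich[OF _ _ tendsto_const lim])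
    show "\<forall>\<^sub>F n in sequentially. 0 \<le> \<bar>f n\<bar> (b n)"
      using b by (intro always_eventually allI blinfun_nonneg) simp_all
  qed (use y(3) in simp)
qed

text \<open>Otherwise there are bad pairs (k, n) with k arbitrarily large. Each single |f n| is
  summable on the \<open>b k\<close>, so n must grow as well, and bad pairs increasing in both
  coordinates contradict \<open>abs_weak_star_null_order_series\<close>.\<close>

lemma abs_weak_star_null_uniform:
  fixes f :: "nat \<Rightarrow> 'a::{banach_lattice, sigma_dedekind_complete} \<Rightarrow>\<^sub>L real"
    and b :: "nat \<Rightarrow> 'a"
  assumes f: "\<And>y. (\<lambda>n. blinfun_apply (f n) y) \<longlonglongrightarrow> 0"
    and b: "\<And>k. 0 \<le> b k" and bt: "\<And>K. (\<Sum>k<K. b k) \<le> t" and d: "0 < d"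
  shows "\<exists>K. \<forall>k\<ge>K. \<forall>n. blinfun_apply \<bar>f n\<bar> (b k) < d"
proof (rule ccontr)
  assume neg: "\<not> ?thesis"
  have lim: "(\<lambda>k. \<bar>g\<bar> (b k)) \<longlonglongrightarrow> 0" for g :: "'a \<Rightarrow>\<^sub>L real"
  proof (rule summable_LIMSEQ_zero, rule bounded_imp_summable)
    show "0 \<le> \<bar>g\<bar> (b k)" for k using b by (intro blinfun_nonneg) simp_all
    fix n
    have "(\<Sum>k\<le>n. \<bar>g\<bar> (b k)) = \<bar>g\<bar> (\<Sum>k<Suc n. b k)"
      by (simp add: blinfun.sum_right lessThan_Suc_atMost)
    also have "\<dots> \<le> \<bar>g\<bar> t" by (rule blinfun_mono[OF _ bt]) simp
    finally show "(\<Sum>k\<le>n. \<bar>g\<bar> (b k)) \<le> \<bar>g\<bar> t" .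
  qed
  have ex: "\<exists>k>N. \<exists>n>N. d \<le> \<bar>f n\<bar> (b k)" for N
  proof -
    have "\<forall>\<^sub>F k in sequentially. \<forall>n\<in>{..N}. \<bar>f n\<bar> (b k) < d"
      using order_tendstoD(2)[OF lim d] by (intro eventually_ball_finite) auto
    then obtain K where K: "\<And>k n. k \<ge> K \<Longrightarrow> n \<le> N \<Longrightarrow> \<bar>f n\<bar> (b k) < d"
      by (auto simp: eventually_sequentially)
    obtain k n where kn: "k \<ge> max K (Suc N)" "d \<le> \<bar>f n\<bar> (b k)"
      using neg unfolding not_ex not_all not_imp not_less by metis
    then have "n > N" using K[of k n] by fastforce
    then show ?thesis using kn by (intro exI[of _ k]) auto
  qed
  have "\<exists>F. \<forall>i. d \<le> \<bar>f (snd (F i))\<bar> (b (fst (F i))) \<and>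
      fst (F i) < fst (F (Suc i)) \<and> snd (F i) < snd (F (Suc i))"
  proof (rule dependent_nat_choice)
    show "\<exists>x. d \<le> \<bar>f (snd x)\<bar> (b (fst x))" using ex[of 0] by auto
    fix x :: "nat \<times> nat" and i :: nat
    obtain k n where "k > max (fst x) (snd x)" "n > max (fst x) (snd x)" "d \<le> \<bar>f n\<bar> (b k)"
      using ex by blast
    then show "\<exists>y. d \<le> \<bar>f (snd y)\<bar> (b (fst y)) \<and> fst x < fst y \<and> snd x < snd y"
      by (intro exI[of _ "(k, n)"]) auto
  qed
  then obtain F where FF: "\<forall>i. d \<le> \<bar>f (snd (F i))\<bar> (b (fst (F i))) \<and>
      fst (F i) < fst (F (Suc i)) \<and> snd (F i) < snd (F (Suc i))" ..
  then have m1: "strict_mono (fst \<circ> F)" and m2: "strict_mono (snd \<circ> F)"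
    and F: "\<And>i. d \<le> \<bar>f (snd (F i))\<bar> (b (fst (F i)))"
    by (simp_all add: strict_mono_Suc_iff)
  have "(\<lambda>i. \<bar>f (snd (F i))\<bar> (b (fst (F i)))) \<longlonglongrightarrow> 0"
  proof (rule abs_weak_star_null_order_series)
    show "(\<lambda>i. f (snd (F i)) y) \<longlonglongrightarrow> 0" for y
      using LIMSEQ_subseq_LIMSEQ[OF f m2, of y] by (simp add: o_def)
    fix K
    have "(\<Sum>i<K. b (fst (F i))) = sum b ((fst \<circ> F) ` {..<K})"
      using strict_mono_imp_inj_on[OF m1] by (subst sum.reindex) (auto intro: inj_on_subset)
    also have "\<dots> \<le> sum b {..<Suc (Max (insert 0 ((fst \<circ> F) ` {..<K})))}"
      by (rule sum_mono2) (use b in \<open>auto simp: less_Suc_eq_le\<close>)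
    also have "\<dots> \<le> t" by (rule bt)
    finally show "(\<Sum>i<K. b (fst (F i))) \<le> t" .
  qed (rule b)
  from order_tendstoD(2)[OF this d] F show False
    by (auto simp: eventually_sequentially not_less[symmetric])
qed

text \<open>If no p worked, jumping from each p to a bad q would cut the sequence into increments
  forming an order bounded series, each increment having mass above \<open>d\<close> for some
  functional.\<close>

lemma abs_weak_star_null_incseq:
  fixes f :: "nat \<Rightarrow> 'a::{banach_lattice, sigma_dedekind_complete} \<Rightarrow>\<^sub>L real"
    and a :: "nat \<Rightarrow> 'a"
  assumes f: "\<And>y. (\<lambda>n. blinfun_apply (f n) y) \<longlonglongrightarrow> 0"
    and a: "\<And>m n. m \<le> n \<Longrightarrow> a m \<le> a n" "\<And>n. 0 \<le> a n" "\<And>n. a n \<le> t" and d: "0 < d"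
  shows "\<exists>p. \<forall>q\<ge>p. \<forall>n. blinfun_apply \<bar>f n\<bar> (a q - a p) \<le> d"
proof (rule ccontr)
  assume "\<not> ?thesis"
  then have "\<forall>p. \<exists>q\<ge>p. \<exists>n. d < \<bar>f n\<bar> (a q - a p)" by (auto simp: not_le)
  then obtain Q N where Q: "\<And>p. Q p \<ge> p" "\<And>p. d < blinfun_apply \<bar>f (N p)\<bar> (a (Q p) - a p)" by metis
  define P where "P j = (Q ^^ j) 0" for j
  define c where "c j = a (P (Suc j)) - a (P j)" for j
  have "(\<Sum>j<J. c j) \<le> t" for J
  proof -
    have "(\<Sum>j<J. c j) = a (P J) - a (P 0)"
      unfolding c_def by (rule sum_lessThan_telescope)
    also have "\<dots> \<le> a (P J)" using a(2)[of "P 0"] by simp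
    also have "\<dots> \<le> t" by (rule a(3))
    finally show ?thesis .
  qed
  moreover have "0 \<le> c j" for j
    using a(1)[OF Q(1)[of "P j"]] by (simp add: c_def P_def)
  ultimately obtain K where "\<forall>n. \<bar>f n\<bar> (c K) < d"
    using abs_weak_star_null_uniform[OF f, of c t d] d by blast
  moreover have "d < \<bar>f (N (P K))\<bar> (c K)" using Q(2)[of "P K"] by (simp add: c_def P_def)
  ultimately show False by (meson less_asym)
qed

lemma abs_weak_star_null_decseq:
  fixes f :: "nat \<Rightarrow> 'a::{banach_lattice, sigma_dedekind_complete} \<Rightarrow>\<^sub>L real"
    and a :: "nat \<Rightarrow> 'a"
  assumes f: "\<And>y. (\<lambda>n. blinfun_apply (f n) y) \<longlonglongrightarrow> 0"
    and a: "\<And>m n. m \<le> n \<Longrightarrow> a n \<le> a m" "\<And>n. 0 \<le> a n" "\<And>n. a n \<le> t" and d: "0 < d"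
  shows "\<exists>p. \<forall>q\<ge>p. \<forall>n. blinfun_apply \<bar>f n\<bar> (a p - a q) \<le> d"
  using abs_weak_star_null_incseq[OF f, of "\<lambda>n. t - a n" t d] a d by simp

text \<open>On an element witnessing that the m-th sum fails to dominate, the weight m forces each
  of the first m functionals to be at most C / m in modulus. Weight and number of terms share one
  index so that the family is increasing.\<close>

definition weighted_partial_sum :: "(nat \<Rightarrow> 'a::banach_lattice) \<Rightarrow> nat \<Rightarrow> 'a" where
  "weighted_partial_sum x m = real m *\<^sub>R (\<Sum>k<m. \<bar>x k\<bar>)"

lemma weighted_partial_sum_nonneg: "0 \<le> weighted_partial_sum x m"
  unfolding weighted_partial_sum_def by (intro scaleR_nonneg_nonneg sum_nonneg) simp_all

lemma weighted_partial_sum_mono: "m \<le> n \<Longrightarrow> weighted_partial_sum x m \<le> weighted_partial_sum x n"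
  unfolding weighted_partial_sum_def
  by (intro scaleR_mono sum_mono2 sum_nonneg) auto

lemma pprt_diff_inf_le: "pprt (x - inf v w) \<le> pprt (x - v) + pprt (x - w)"
  for x :: "'a::lattice_ab_group_add"
proof -
  have "x - inf v w = sup (x - v) (x - w)" by (simp add: add_sup_distrib_left)
  also have "\<dots> \<le> pprt (x - v) + pprt (x - w)"
    by (intro le_supI add_increasing add_increasing2 le_pprt zero_le_pprt)
  finally show ?thesis by (simp add: pprt_le_iff del: diff_inf_eq_sup)
qed

text \<open>Drewnowski's argument for uniformly exhaustive families of measures, with suprema and infima
  in place of unions and intersections.\<close>

theorem weak_star_null_uniformly_dominated:
  fixes f :: "nat \<Rightarrow> 'a::{banach_lattice, sigma_dedekind_complete} \<Rightarrow>\<^sub>L real"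
  assumes f: "\<And>y. (\<lambda>n. blinfun_apply (f n) y) \<longlonglongrightarrow> 0" and t: "0 \<le> t" and e: "0 < e"
  shows "\<exists>m. \<forall>n. blinfun_apply (pprt (\<bar>f n\<bar> - weighted_partial_sum f m)) t \<le> e"
proof (rule ccontr)
  assume "\<not> ?thesis"
  then have "\<exists>n a. 0 \<le> a \<and> a \<le> t \<and> e < (\<bar>f n\<bar> - weighted_partial_sum f m) a" for m
    using pprt_blinfun_approx[OF t] by (metis not_le)
  then obtain N a where a: "\<And>m. 0 \<le> a m" "\<And>m. a m \<le> t"
      "\<And>m. e < blinfun_apply (\<bar>f (N m)\<bar> - weighted_partial_sum f m) (a m)" by metis
  obtain C where C: "0 \<le> C" "\<And>n. blinfun_apply \<bar>f n\<bar> t \<le> C" using weak_star_null_bounded[OF f] by metis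
  \<comment> \<open>Along powers of two the values of a fixed functional on the \<open>A j\<close>
    eventually decay geometrically, so they can be summed over a tail.\<close>
  define A where "A j = a (2 ^ j)" for j :: nat
  define M where "M j = N (2 ^ j)" for j :: nat
  have A: "0 \<le> A j" "A j \<le> t" for j using a by (simp_all add: A_def)
  have nonneg: "0 \<le> \<bar>f n\<bar> x" if "0 \<le> x" for n x by (rule blinfun_nonneg) (simp_all add: that)
  have mono: "\<bar>f n\<bar> x \<le> \<bar>f n\<bar> y" if "x \<le> y" for n x y by (rule blinfun_mono) (simp_all add: that)
  have big: "e + weighted_partial_sum f (2 ^ j) (A j) < \<bar>f (M j)\<bar> (A j)" for j
    using a(3)[of "2 ^ j"] by (simp add: A_def M_def blinfun.diff_left)
  have bigA: "e < \<bar>f (M j)\<bar> (A j)" for j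
    using big[of j] blinfun_nonneg[OF weighted_partial_sum_nonneg A(1), of f "2 ^ j" j] by linarith
  have small: "\<bar>f k\<bar> (A j) \<le> C * (1/2) ^ j" if "k < 2 ^ j" for k j
  proof -
    have "\<bar>f k\<bar> (A j) \<le> (\<Sum>i<2^j. \<bar>f i\<bar> (A j))"
      by (rule member_le_sum[of k "{..<2^j}" "\<lambda>i. \<bar>f i\<bar> (A j)"]) (use that A nonneg in auto)
    then have "2 ^ j * \<bar>f k\<bar> (A j) \<le> weighted_partial_sum f (2 ^ j) (A j)"
      by (simp add: weighted_partial_sum_def blinfun.scaleR_left blinfun.sum_left)
    also have "\<dots> \<le> C" using big[of j] mono[OF A(2), of "M j" j] C(2)[of "M j"] e by linarith
    finally show ?thesis by (simp add: power_one_over field_simps)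
  qed
  \<comment> \<open>\<open>U j d\<close> is the supremum of \<open>A j\<close>, ...,
    \<open>A (j + d)\<close>, a finite stage of the supremum over the tail from j.\<close>
  define U where "U j = rec_nat (A j) (\<lambda>d x. sup x (A (j + Suc d)))" for j
  have U0: "U j 0 = A j" and US: "U j (Suc d) = sup (U j d) (A (j + Suc d))" for j d
    by (simp_all add: U_def)
  have Ut: "0 \<le> U j d" "U j d \<le> t" for j d
    by (induction d) (auto simp: U0 US A intro: le_supI1)
  have Umono: "U j c \<le> U j d" if "c \<le> d" for j c d
    by (rule lift_Suc_mono_le[OF _ that]) (simp add: US)
  have UA: "A (j + d) \<le> U j d" for j d by (cases d) (simp_all add: U0 US)
  have Usum: "\<bar>f n\<bar> (U j d) \<le> (\<Sum>i\<le>d. \<bar>f n\<bar> (A (j + i)))" for n j d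
  proof (induction d)
    case (Suc d)
    have "U j (Suc d) \<le> U j d + A (j + Suc d)"
      unfolding US using Ut A by (intro le_supI) (auto intro: add_increasing add_increasing2)
    then have "\<bar>f n\<bar> (U j (Suc d)) \<le> \<bar>f n\<bar> (U j d) + \<bar>f n\<bar> (A (j + Suc d))"
      using mono by (simp flip: blinfun.add_right)
    then show ?case using Suc by simp
  qed (simp add: U0)
  \<comment> \<open>Passing from \<open>A p\<close> to \<open>W p\<close> will cost 2 h and from
    \<open>W p\<close> to \<open>W q\<close> another h; the contradiction needs 3 h < e.\<close>
  define h where "h = e / 8"
  have h: "0 < h" using e by (simp add: h_def)
  have "\<exists>p. \<forall>q\<ge>p. \<forall>n. \<bar>f n\<bar> (U j q - U j p) \<le> h * (1/2) ^ j" for j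
    by (rule abs_weak_star_null_incseq[OF f, of "U j" t]) (use Umono Ut h in auto)
  then obtain D where D: "\<And>j q n. q \<ge> D j \<Longrightarrow> blinfun_apply \<bar>f n\<bar> (U j q - U j (D j)) \<le> h * (1/2) ^ j"
    by metis
  define V where "V j = U j (D j)" for j
  \<comment> \<open>\<open>V j\<close> stands for the supremum of the tail from j, up to an error
    uniform in n, and \<open>W p\<close> is the infimum of \<open>V 0\<close>, ...,
    \<open>V p\<close>. The sequence \<open>W\<close> plays the part of the upper limit of the sets
    \<open>A j\<close>.\<close>
  define W where "W = rec_nat (V 0) (\<lambda>p x. inf x (V (Suc p)))"
  have W0: "W 0 = V 0" and WS: "W (Suc p) = inf (W p) (V (Suc p))" for p
    by (simp_all add: W_def)
  have Wt: "0 \<le> W p" "W p \<le> t" for p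
    by (induction p) (auto simp: W0 WS V_def Ut intro: le_infI1)
  have Wdec: "W q \<le> W p" if "p \<le> q" for p q
    by (rule lift_Suc_antimono_le[OF _ that]) (simp add: WS)
  have WV: "W p \<le> V p" for p by (cases p) (simp_all add: W0 WS)
  obtain p where p: "\<And>q n. q \<ge> p \<Longrightarrow> blinfun_apply \<bar>f n\<bar> (W p - W q) \<le> h"
    using abs_weak_star_null_decseq[OF f, of W t h] Wdec Wt h by blast
  have AV: "\<bar>f n\<bar> (pprt (A q - V j)) \<le> h * (1/2) ^ j" if "j \<le> q" for n q j
  proof -
    let ?r = "max (q - j) (D j)"
    have "A q \<le> U j (q - j)" using UA[of j "q - j"] that by simp
    also have "\<dots> \<le> U j ?r" by (rule Umono) simp
    finally have "A q - V j \<le> U j ?r - V j" by simp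
    moreover have "0 \<le> U j ?r - V j" unfolding V_def using Umono[of "D j" ?r j] by simp
    ultimately have "pprt (A q - V j) \<le> U j ?r - V j" by (simp add: pprt_le_iff)
    then have "\<bar>f n\<bar> (pprt (A q - V j)) \<le> \<bar>f n\<bar> (U j ?r - V j)" by (rule mono)
    also have "\<dots> \<le> h * (1/2) ^ j" unfolding V_def by (rule D) simp
    finally show ?thesis .
  qed
  have AW: "\<bar>f n\<bar> (pprt (A q - W r)) \<le> h * (\<Sum>j\<le>r. (1/2) ^ j)" if "r \<le> q" for n q r
    using that
  proof (induction r)
    case (Suc r)
    have "\<bar>f n\<bar> (pprt (A q - W (Suc r))) \<le> \<bar>f n\<bar> (pprt (A q - W r) + pprt (A q - V (Suc r)))"
      unfolding WS by (rule mono[OF pprt_diff_inf_le])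
    also have "\<dots> \<le> h * (\<Sum>j\<le>r. (1/2) ^ j) + h * (1/2) ^ Suc r"
      unfolding blinfun.add_right by (intro add_mono Suc.IH AV) (use Suc.prems in auto)
    finally show ?case by (simp add: algebra_simps)
  qed (use AV[of 0 q n] in \<open>simp add: W0\<close>)
  have geo: "(\<Sum>j\<le>r. (1/2::real) ^ j) \<le> 2" for r
  proof -
    have "(\<Sum>j<Suc r. (1/2::real) ^ j) \<le> (\<Sum>j. (1/2) ^ j)"
      by (intro sum_le_suminf summable_geometric) auto
    then show ?thesis by (simp add: suminf_geometric lessThan_Suc_atMost del: sum.lessThan_Suc)
  qed
  \<comment> \<open>Uniformly in n, little of the mass of \<open>A p\<close> lies outside
    \<open>W p\<close>: the losses h / 2^j at the levels j <= p sum to at most 2 h.\<close>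
  have lower: "\<bar>f n\<bar> (A p) \<le> \<bar>f n\<bar> (W p) + 2 * h" for n
  proof -
    have "\<bar>f n\<bar> (A p) - \<bar>f n\<bar> (W p) \<le> \<bar>f n\<bar> (pprt (A p - W p))"
      unfolding blinfun.diff_right[symmetric] by (rule mono[OF le_pprt])
    also have "\<dots> \<le> h * 2"
      using AW[of p p n] geo[of p] h by (meson mult_left_mono less_imp_le order_refl order_trans)
    finally show ?thesis by simp
  qed
  \<comment> \<open>For a fixed functional, however, the mass of \<open>W q\<close> tends to 0,
    being bounded by its mass on the tail from q. The functional with index \<open>M p\<close> has
    mass above e on \<open>A p\<close>, which is incompatible with both bounds.\<close>
  have upper: "\<bar>f n\<bar> (W q) \<le> 2 * C * (1/2) ^ q" if "n < 2 ^ q" for n q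
  proof -
    have "\<bar>f n\<bar> (W q) \<le> \<bar>f n\<bar> (U q (D q))" using mono[OF WV] by (simp add: V_def)
    also have "\<dots> \<le> (\<Sum>i\<le>D q. \<bar>f n\<bar> (A (q + i)))" by (rule Usum)
    also have "\<dots> \<le> (\<Sum>i\<le>D q. C * (1/2) ^ q * (1/2) ^ i)"
    proof (rule sum_mono)
      fix i
      have "n < 2 ^ (q + i)" using that by (rule order_less_le_trans) simp
      then show "\<bar>f n\<bar> (A (q + i)) \<le> C * (1/2) ^ q * (1/2) ^ i"
        using small[of n "q + i"] by (simp add: power_add mult.assoc)
    qed
    also have "\<dots> = C * (1/2) ^ q * (\<Sum>i\<le>D q. (1/2) ^ i)" by (simp add: sum_distrib_left)
    also have "\<dots> \<le> C * (1/2) ^ q * 2" by (intro mult_left_mono geo) (use C in simp)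
    finally show ?thesis by simp
  qed
  have "e - 3 * h \<le> 2 * C * (1/2) ^ q" if q: "q \<ge> p" "M p < 2 ^ q" for q
  proof -
    have "\<bar>f (M p)\<bar> (W p) - \<bar>f (M p)\<bar> (W q) \<le> h"
      using p[OF q(1)] by (simp add: blinfun.diff_right)
    then show ?thesis using lower[of "M p"] bigA[of p] upper[OF q(2)] by linarith
  qed
  then have "\<forall>\<^sub>F q in sequentially. e - 3 * h \<le> 2 * C * (1/2) ^ q"
  proof -
    have "M p < 2 ^ q" if "q \<ge> M p" for q
      by (rule le_less_trans[OF that less_exp])
    then show ?thesis using \<open>\<And>q. p \<le> q \<Longrightarrow> M p < 2 ^ q \<Longrightarrow> _ q\<close>
      by (intro eventually_sequentiallyI[of "max p (M p)"]) auto
  qed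
  moreover have "(\<lambda>q. 2 * C * (1/2) ^ q) \<longlonglongrightarrow> 2 * C * 0"
    by (intro tendsto_intros) simp
  ultimately have "e - 3 * h \<le> 0"
    using tendsto_lowerbound[of "\<lambda>q. 2 * C * (1/2) ^ q" 0 sequentially "e - 3 * h"] by simp
  then show False using e by (simp add: h_def)
qed

text \<open>The x n, read as functionals on the sigma-Dedekind complete dual, are weak* null there.
  Since \<open>evaluation\<close> commutes with moduli and positive parts, the conclusion returns to
  the space itself.\<close>

lemma weakly_null_uniformly_dominated:
  fixes x :: "nat \<Rightarrow> 'a::banach_lattice" and h :: "'a \<Rightarrow>\<^sub>L real"
  assumes x: "\<And>h :: 'a \<Rightarrow>\<^sub>L real. (\<lambda>n. blinfun_apply h (x n)) \<longlonglongrightarrow> 0"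
    and h: "0 \<le> h" and e: "0 < e"
  shows "\<exists>m. \<forall>n. blinfun_apply h (pprt (\<bar>x n\<bar> - weighted_partial_sum x m)) \<le> e"
proof -
  have w: "weighted_partial_sum (\<lambda>n. evaluation (x n)) m = evaluation (weighted_partial_sum x m)" for m
    by (simp add: weighted_partial_sum_def abs_evaluation evaluation_linear evaluation_sum)
  have "\<exists>m. \<forall>n. blinfun_apply (pprt (\<bar>evaluation (x n)\<bar> - weighted_partial_sum (\<lambda>n. evaluation (x n)) m)) h \<le> e"
    by (rule weak_star_null_uniformly_dominated[OF _ h e]) (simp add: x)
  then show ?thesis
    by (simp add: w abs_evaluation pprt_evaluation flip: evaluation_linear(2))
qed

subsection \<open>Diagonal sequences\<close>

lemma slow_diagonal:
  fixes a :: "nat \<Rightarrow> nat \<Rightarrow> real"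
  assumes a: "\<And>m. a m \<longlonglongrightarrow> 0"
  obtains \<mu> where "filterlim \<mu> at_top sequentially" "(\<lambda>n. a (\<mu> n) n) \<longlonglongrightarrow> 0"
proof -
  have "\<exists>N. \<forall>n\<ge>N. \<bar>a m n\<bar> < inverse (real (Suc m))" for m
    using LIMSEQ_D[OF a[of m], of "inverse (real (Suc m))"] by simp
  then obtain N where N: "\<And>m n. n \<ge> N m \<Longrightarrow> \<bar>a m n\<bar> < inverse (real (Suc m))" by metis
  \<comment> \<open>The largest m whose threshold \<open>N m\<close> has been passed; the cap m <= n
    makes the set finite and the inserted 0 makes it nonempty.\<close>
  define \<mu> where "\<mu> n = Max (insert 0 {m. m \<le> n \<and> N m \<le> n})" for n
  have fin: "finite (insert 0 {m. m \<le> n \<and> N m \<le> n})" for n by simp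
  have ge: "M \<le> \<mu> n" if "n \<ge> max M (N M)" for n M
    unfolding \<mu>_def by (rule Max_ge[OF fin]) (use that in auto)
  have NM: "N (\<mu> n) \<le> n" if "n \<ge> N 0" for n
    using Max_in[OF fin, of n] that unfolding \<mu>_def[symmetric] by auto
  show thesis
  proof
    show "filterlim \<mu> at_top sequentially"
      unfolding filterlim_at_top
      by (intro allI eventually_sequentiallyI[of "max M (N M)" for M]) (rule ge)
    show "(\<lambda>n. a (\<mu> n) n) \<longlonglongrightarrow> 0"
    proof (rule LIMSEQ_I)
      fix r :: real assume "0 < r"
      then obtain M where M: "inverse (real (Suc M)) < r" using reals_Archimedean by blast
      have "norm (a (\<mu> n) n - 0) < r" if "n \<ge> max (N 0) (max M (N M))" for n
      proof -
        have "\<bar>a (\<mu> n) n\<bar> < inverse (real (Suc (\<mu> n)))" using NM that by (intro N) auto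
        also have "\<dots> \<le> inverse (real (Suc M))" using ge[of M n] that by (simp add: field_simps)
        finally show ?thesis using M by simp
      qed
      then show "\<exists>no. \<forall>n\<ge>no. norm (a (\<mu> n) n - 0) < r" by blast
    qed
  qed
qed

text \<open>Exchanges a statement about one fixed m for one about all diagonals: if every m failed
  infinitely often, the failures could be strung along a single diagonal.\<close>

lemma eventually_le_of_diagonals:
  fixes a :: "nat \<Rightarrow> nat \<Rightarrow> real"
  assumes a: "\<And>\<mu>. filterlim \<mu> at_top sequentially \<Longrightarrow> (\<lambda>n. a (\<mu> n) n) \<longlonglongrightarrow> 0" and e: "0 < e"
  shows "\<exists>m. \<forall>\<^sub>F n in sequentially. a m n \<le> e"
proof (rule ccontr)
  assume "\<not> ?thesis"
  then have neg: "\<exists>n\<ge>N. e < a m n" for m N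
    by (auto simp: eventually_sequentially not_le)
  have "\<exists>N. \<forall>m. e < a m (N m) \<and> N m < N (Suc m)"
    by (rule dependent_nat_choice[where P = "\<lambda>m n. e < a m n" and Q = "\<lambda>m n n'. n < n'"])
      (use neg Suc_le_eq in blast)+
  then obtain N where N: "\<And>m. e < a m (N m)" and "strict_mono N" by (auto simp: strict_mono_Suc_iff)
  \<comment> \<open>On the range of \<open>N\<close> this is the inverse of \<open>N\<close>, which
    puts the bad pairs on the diagonal; elsewhere the identity ensures divergence to
    infinity.\<close>
  define \<mu> where "\<mu> n = (if n \<in> range N then inv N n else n)" for n
  have \<mu>N: "\<mu> (N m) = m" for m
    using strict_mono_imp_inj_on[OF \<open>strict_mono N\<close>] by (simp add: \<mu>_def)
  have "filterlim \<mu> at_top sequentially"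
    unfolding filterlim_at_top
  proof (intro allI)
    fix B
    have "B \<le> \<mu> n" if n: "n \<ge> max B (N B)" for n
    proof (cases "n \<in> range N")
      case True
      then obtain m where m: "n = N m" by blast
      then have "B \<le> m" using n strict_mono_less_eq[OF \<open>strict_mono N\<close>] by simp
      then show ?thesis using \<mu>N m by simp
    qed (use n in \<open>simp add: \<mu>_def\<close>)
    then show "\<forall>\<^sub>F n in sequentially. B \<le> \<mu> n" by (rule eventually_sequentiallyI)
  qed
  then have "(\<lambda>n. a (\<mu> n) n) \<longlonglongrightarrow> 0" by (rule a)
  then have "((\<lambda>n. a (\<mu> n) n) \<circ> N) \<longlonglongrightarrow> 0" by (rule LIMSEQ_subseq_LIMSEQ) fact
  then have "\<forall>\<^sub>F m in sequentially. a m (N m) < e"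
    using order_tendstoD(2)[OF _ e] by (simp add: o_def \<mu>N)
  then obtain m where "a m (N m) < e" by (auto simp: eventually_sequentially)
  then show False using N[of m] by simp
qed

subsection \<open>Weak* Dunford--Pettis operators\<close>

lemma weak_star_dunford_pettis_iff:
  "weak_star_dunford_pettis T \<longleftrightarrow> bounded_linear T \<and>
    (\<forall>x (f :: nat \<Rightarrow> 'b \<Rightarrow>\<^sub>L real). (\<forall>h :: 'a \<Rightarrow>\<^sub>L real. (\<lambda>n. blinfun_apply h (x n)) \<longlonglongrightarrow> 0) \<longrightarrow>
      (\<forall>y. (\<lambda>n. blinfun_apply (f n) y) \<longlonglongrightarrow> 0) \<longrightarrow>
      (\<lambda>n. blinfun_apply (f n) (T (x n))) \<longlonglongrightarrow> 0)"
  for T :: "'a::banach \<Rightarrow> 'b::banach"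
  unfolding weak_star_dunford_pettis_def limitin_weak_topology_iff limitin_weak_star_topology_iff
  by (simp add: blinfun.zero_right blinfun.zero_left)

lemma weak_star_dunford_pettisD:
  fixes T :: "'a::banach \<Rightarrow> 'b::banach" and f :: "nat \<Rightarrow> 'b \<Rightarrow>\<^sub>L real"
  assumes "weak_star_dunford_pettis T"
    and "\<And>h :: 'a \<Rightarrow>\<^sub>L real. (\<lambda>n. blinfun_apply h (x n)) \<longlonglongrightarrow> 0"
    and "\<And>y. (\<lambda>n. blinfun_apply (f n) y) \<longlonglongrightarrow> 0"
  shows "(\<lambda>n. blinfun_apply (f n) (T (x n))) \<longlonglongrightarrow> 0"
  using assms by (simp add: weak_star_dunford_pettis_iff)

lemma weak_star_null_dominated:
  fixes f g :: "nat \<Rightarrow> 'a::banach_lattice \<Rightarrow>\<^sub>L real"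
  assumes "\<And>t. 0 \<le> t \<Longrightarrow> (\<lambda>n. blinfun_apply \<bar>g n\<bar> t) \<longlonglongrightarrow> 0"
  shows "(\<lambda>n. blinfun_apply (g n) y) \<longlonglongrightarrow> 0"
  by (rule Lim_null_comparison[OF _ assms[of "\<bar>y\<bar>"]]) (simp_all add: abs_blinfun_apply_le)

text \<open>As |f n| need not be weak* null, it is bounded by \<open>g n + ?G (\<mu> n)\<close>. If
  \<mu> grows slowly, the second term is null on the weakly null \<open>y n\<close>; since \<mu>
  tends to infinity, uniform domination makes \<open>g n\<close> weak* null and \<open>dp\<close>
  applies to it.\<close>

lemma abs_weak_star_null_of_weak_star_null:
  fixes f :: "nat \<Rightarrow> 'a::{banach_lattice, sigma_dedekind_complete} \<Rightarrow>\<^sub>L real"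
  assumes f: "\<And>y. (\<lambda>n. blinfun_apply (f n) y) \<longlonglongrightarrow> 0"
    and y0: "\<And>n. 0 \<le> y n" and y: "\<And>h :: 'a \<Rightarrow>\<^sub>L real. (\<lambda>n. blinfun_apply h (y n)) \<longlonglongrightarrow> 0"
    and dp: "\<And>g :: nat \<Rightarrow> 'a \<Rightarrow>\<^sub>L real. (\<And>z. (\<lambda>n. blinfun_apply (g n) z) \<longlonglongrightarrow> 0) \<Longrightarrow>
      (\<lambda>n. blinfun_apply (g n) (y n)) \<longlonglongrightarrow> 0"
  shows "(\<lambda>n. blinfun_apply \<bar>f n\<bar> (y n)) \<longlonglongrightarrow> 0"
proof -
  let ?G = "weighted_partial_sum f"
  obtain \<mu> where \<mu>: "filterlim \<mu> at_top sequentially" "(\<lambda>n. ?G (\<mu> n) (y n)) \<longlonglongrightarrow> 0"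
    by (rule slow_diagonal[of "\<lambda>m n. ?G m (y n)"]) (use y in auto)
  define g where "g n = pprt (\<bar>f n\<bar> - ?G (\<mu> n))" for n
  have g0: "0 \<le> g n" for n by (simp add: g_def)
  have "(\<lambda>n. \<bar>g n\<bar> t) \<longlonglongrightarrow> 0" if t: "0 \<le> t" for t
  proof (rule LIMSEQ_I)
    fix e :: real assume e: "0 < e"
    obtain m where m: "\<And>n. pprt (\<bar>f n\<bar> - ?G m) t \<le> e / 2"
      using weak_star_null_uniformly_dominated[OF f t, of "e / 2"] e by auto
    have "norm (\<bar>g n\<bar> t - 0) < e" if n: "m \<le> \<mu> n" for n
    proof -
      have "g n \<le> pprt (\<bar>f n\<bar> - ?G m)"
        unfolding g_def by (intro pprt_mono diff_left_mono weighted_partial_sum_mono n)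
      then have "g n t \<le> e / 2" using blinfun_leD[OF _ t] m order_trans by blast
      then show ?thesis using blinfun_nonneg[OF g0 t, of n] g0[of n] e by simp
    qed
    moreover have "\<forall>\<^sub>F n in sequentially. m \<le> \<mu> n" using \<mu>(1) by (simp add: filterlim_at_top)
    ultimately show "\<exists>N. \<forall>n\<ge>N. norm (\<bar>g n\<bar> t - 0) < e" by (auto simp: eventually_sequentially)
  qed
  then have "(\<lambda>n. g n z) \<longlonglongrightarrow> 0" for z by (rule weak_star_null_dominated)
  then have "(\<lambda>n. g n (y n)) \<longlonglongrightarrow> 0" by (rule dp)
  from tendsto_add[OF this \<mu>(2)] have lim: "(\<lambda>n. g n (y n) + ?G (\<mu> n) (y n)) \<longlonglongrightarrow> 0" by simp
  show ?thesis
  proof (rule tendsto_sandwich[OF _ _ tendsto_const lim]; intro always_eventually allI)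
    fix n
    show "0 \<le> \<bar>f n\<bar> (y n)" by (rule blinfun_nonneg) (simp_all add: y0)
    have "\<bar>f n\<bar> \<le> g n + ?G (\<mu> n)"
      using le_pprt[of "\<bar>f n\<bar> - ?G (\<mu> n)"] by (simp add: g_def diff_le_eq)
    from blinfun_leD[OF this y0[of n]] show "\<bar>f n\<bar> (y n) \<le> g n (y n) + ?G (\<mu> n) (y n)"
      by (simp add: blinfun.add_left)
  qed
qed

text \<open>Along any diagonal the positive remainders \<open>z n\<close> are weakly null by uniform
  domination in E, so the Dunford-Pettis property of \<open>T\<close> makes \<open>T (z n)\<close>
  satisfy the hypotheses of the previous lemma.\<close>

lemma weak_star_dunford_pettis_truncation:
  fixes T :: "'a::banach_lattice \<Rightarrow> 'b::{banach_lattice, sigma_dedekind_complete}"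
    and f :: "nat \<Rightarrow> 'b \<Rightarrow>\<^sub>L real"
  assumes T: "positive_operator T" "weak_star_dunford_pettis T"
    and x: "\<And>h :: 'a \<Rightarrow>\<^sub>L real. (\<lambda>n. blinfun_apply h (x n)) \<longlonglongrightarrow> 0"
    and f: "\<And>y. (\<lambda>n. blinfun_apply (f n) y) \<longlonglongrightarrow> 0" and e: "0 < e"
  shows "\<exists>m. \<forall>\<^sub>F n in sequentially.
    blinfun_apply \<bar>f n\<bar> (T (pprt (\<bar>x n\<bar> - weighted_partial_sum x m))) \<le> e"
proof (rule eventually_le_of_diagonals[OF _ e])
  have bl: "bounded_linear T" using T(2) by (simp add: weak_star_dunford_pettis_iff)
  fix \<mu> :: "nat \<Rightarrow> nat" assume \<mu>: "filterlim \<mu> at_top sequentially"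
  define z where "z n = pprt (\<bar>x n\<bar> - weighted_partial_sum x (\<mu> n))" for n
  have z0: "0 \<le> z n" for n by (simp add: z_def)
  have z: "(\<lambda>n. h (z n)) \<longlonglongrightarrow> 0" for h :: "'a \<Rightarrow>\<^sub>L real"
  proof (rule LIMSEQ_I)
    fix e :: real assume e: "0 < e"
    obtain m where m: "\<And>n. \<bar>h\<bar> (pprt (\<bar>x n\<bar> - weighted_partial_sum x m)) \<le> e / 2"
      using weakly_null_uniformly_dominated[OF x, of "\<bar>h\<bar>" "e / 2"] e by auto
    have "norm (h (z n) - 0) < e" if n: "m \<le> \<mu> n" for n
    proof -
      have "z n \<le> pprt (\<bar>x n\<bar> - weighted_partial_sum x m)"
        unfolding z_def by (intro pprt_mono diff_left_mono weighted_partial_sum_mono n)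
      then have "\<bar>h\<bar> (z n) \<le> \<bar>h\<bar> (pprt (\<bar>x n\<bar> - weighted_partial_sum x m))" by (intro blinfun_mono) auto
      also have "\<dots> \<le> e / 2" by (rule m)
      finally show ?thesis using abs_blinfun_apply_le[of h "z n"] z0[of n] e by simp
    qed
    moreover have "\<forall>\<^sub>F n in sequentially. m \<le> \<mu> n" using \<mu> by (simp add: filterlim_at_top)
    ultimately show "\<exists>N. \<forall>n\<ge>N. norm (h (z n) - 0) < e" by (auto simp: eventually_sequentially)
  qed
  have "(\<lambda>n. \<bar>f n\<bar> (T (z n))) \<longlonglongrightarrow> 0"
  proof (rule abs_weak_star_null_of_weak_star_null[OF f])
    show "0 \<le> T (z n)" for n using T(1) z0 by (simp add: positive_operator_def)
    show "(\<lambda>n. h (T (z n))) \<longlonglongrightarrow> 0" for h :: "'b \<Rightarrow>\<^sub>L real"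
      using z[of "h o\<^sub>L Blinfun T"] by (simp add: bounded_linear_Blinfun_apply[OF bl])
    show "(\<lambda>n. g n (T (z n))) \<longlonglongrightarrow> 0" if "\<And>y. (\<lambda>n. blinfun_apply (g n) y) \<longlonglongrightarrow> 0"
      for g :: "nat \<Rightarrow> 'b \<Rightarrow>\<^sub>L real"
      by (rule weak_star_dunford_pettisD[OF T(2) z that])
  qed
  then show "(\<lambda>n. \<bar>f n\<bar> (T (pprt (\<bar>x n\<bar> - weighted_partial_sum x (\<mu> n))))) \<longlonglongrightarrow> 0"
    by (simp add: z_def)
qed

subsection \<open>Central operators\<close>

text \<open>Models multiplication by a function with values in [0, 1]. Linearity is demanded only on
  the ideal with positive cone \<open>D\<close>, since \<open>L\<close> is a total function without
  meaning outside of it.\<close>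

definition center_on :: "'a::banach_lattice set \<Rightarrow> ('a \<Rightarrow> 'a) \<Rightarrow> bool" where
  "center_on D L \<longleftrightarrow> (\<forall>x y. \<bar>x\<bar> \<in> D \<longrightarrow> \<bar>y\<bar> \<in> D \<longrightarrow> L (x + y) = L x + L y) \<and>
    (\<forall>c x. \<bar>x\<bar> \<in> D \<longrightarrow> L (c *\<^sub>R x) = c *\<^sub>R L x) \<and> (\<forall>x\<in>D. 0 \<le> L x \<and> L x \<le> x)"

lemma center_onD:
  assumes "center_on D L"
  shows "\<bar>x\<bar> \<in> D \<Longrightarrow> \<bar>y\<bar> \<in> D \<Longrightarrow> L (x + y) = L x + L y"
    "\<bar>x\<bar> \<in> D \<Longrightarrow> L (c *\<^sub>R x) = c *\<^sub>R L x" "x \<in> D \<Longrightarrow> 0 \<le> L x" "x \<in> D \<Longrightarrow> L x \<le> x"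
  using assms unfolding center_on_def by blast+

lemma abs_mem_cone:
  assumes D: "solid_cone D" and x: "x \<in> D"
  shows "\<bar>x\<bar> \<in> D"
  using x solid_coneD(2)[OF D x] by simp

lemma center_on_diff:
  assumes L: "center_on D L" and xy: "\<bar>x\<bar> \<in> D" "\<bar>y\<bar> \<in> D"
  shows "L (x - y) = L x - L y"
  using center_onD(1)[OF L xy(1), of "- 1 *\<^sub>R y"] center_onD(2)[OF L xy(2), of "- 1"] xy by simp

lemma center_on_abs_le:
  assumes D: "solid_cone D" and L: "center_on D L" and x: "\<bar>x\<bar> \<in> D"
  shows "\<bar>L x\<bar> \<le> \<bar>x\<bar>"
proof -
  note a = abs_in_cone[OF D x]
  have "L x = L (pprt x) - L (- nprt x)"
    using center_on_diff[OF L abs_mem_cone[OF D a(1)] abs_mem_cone[OF D a(2)]]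
    by (simp flip: prts)
  moreover have le: "0 \<le> L (pprt x)" "L (pprt x) \<le> pprt x" "0 \<le> L (- nprt x)" "L (- nprt x) \<le> - nprt x"
    using center_onD(3,4)[OF L] a by blast+
  moreover have "L (pprt x) + - L (- nprt x) \<le> pprt x + - nprt x"
    by (rule add_mono[OF le(2) order_trans[of _ 0]]) (use le(3) in simp_all)
  moreover have "- L (pprt x) + L (- nprt x) \<le> pprt x + - nprt x"
    by (rule add_mono[OF order_trans[of _ 0] le(4)]) (use le(1) in simp_all)
  ultimately have "L x \<le> pprt x + - nprt x" "- L x \<le> pprt x + - nprt x" by simp_all
  then show ?thesis unfolding pprt_minus_nprt by (rule abs_leI)
qed

lemma center_on_mem:
  assumes D: "solid_cone D" and L: "center_on D L"
  shows "x \<in> D \<Longrightarrow> L x \<in> D" "\<bar>x\<bar> \<in> D \<Longrightarrow> \<bar>L x\<bar> \<in> D"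
  using solid_coneD(4)[OF D] center_onD(3,4)[OF L] center_on_abs_le[OF D L] abs_ge_zero by blast+

lemma center_on_id: "solid_cone D \<Longrightarrow> center_on D (\<lambda>x. x)"
  unfolding center_on_def by (auto dest: solid_coneD)

lemma center_on_compose:
  assumes D: "solid_cone D" and L: "center_on D L" and M: "center_on D M"
  shows "center_on D (\<lambda>x. L (M x))"
  unfolding center_on_def
proof (intro conjI allI impI ballI)
  show "L (M (x + y)) = L (M x) + L (M y)" if "\<bar>x\<bar> \<in> D" "\<bar>y\<bar> \<in> D" for x y
    using that center_on_mem(2)[OF D M] center_onD(1)[OF L] center_onD(1)[OF M] by simp
  show "L (M (c *\<^sub>R x)) = c *\<^sub>R L (M x)" if "\<bar>x\<bar> \<in> D" for c x
    using that center_on_mem(2)[OF D M] center_onD(2)[OF L] center_onD(2)[OF M] by simp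
  fix x assume x: "x \<in> D"
  show "0 \<le> L (M x)" by (rule center_onD(3)[OF L center_on_mem(1)[OF D M x]])
  show "L (M x) \<le> x"
    by (rule order_trans[OF center_onD(4)[OF L center_on_mem(1)[OF D M x]] center_onD(4)[OF M x]])
qed

lemma center_on_compl:
  assumes D: "solid_cone D" and L: "center_on D L"
  shows "center_on D (\<lambda>x. x - L x)"
  unfolding center_on_def
  by (auto simp: center_onD[OF L] scaleR_diff_right)

lemma center_on_cone_ext:
  assumes D: "solid_cone D" and p: "additive_on D p" and le: "\<And>y. y \<in> D \<Longrightarrow> p y \<le> y"
  shows "center_on D (cone_ext p)"
  unfolding center_on_def
  using cone_ext_add[OF D p] cone_ext_scaleR[OF D p] cone_ext_eq[OF D p] additive_onD(1)[OF p] le by simp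

lemma center_on_bounded_linear:
  assumes L: "center_on {x. 0 \<le> x} L"
  shows "bounded_linear L"
proof (rule positive_operator_bounded)
  show "positive_operator L"
    using center_onD[OF L] by (auto simp: positive_operator_def intro: linearI)
qed

text \<open>The band projection of the positive part of d, as the supremum over n of inf y (n d^+):
  it fixes d^+ and annihilates the disjoint d^-.\<close>

lemma band_multiplier:
  fixes d :: "'a::{banach_lattice, sigma_dedekind_complete}"
  obtains Q where "center_on {x. 0 \<le> x} Q" "Q d = pprt d"
proof -
  let ?D = "{x::'a. 0 \<le> x}"
  note D = solid_cone_nonneg[where 'a = 'a]
  define s where "s y n = inf y (real n *\<^sub>R pprt d)" for y n
  have sy: "s y n \<le> y" for y n by (simp add: s_def)
  have s0: "0 \<le> s y n" if "0 \<le> y" for y n using that by (simp add: s_def scaleR_nonneg_nonneg)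
  have "\<exists>l. (\<forall>a\<in>range (s y). a \<le> l) \<and> (\<forall>u. (\<forall>a\<in>range (s y). a \<le> u) \<longrightarrow> l \<le> u)" for y
    by (rule countable_bdd_above_has_lub) (use sy in \<open>auto simp: bdd_above_def\<close>)
  then have "\<exists>l. (\<forall>n. s y n \<le> l) \<and> (\<forall>u. (\<forall>n. s y n \<le> u) \<longrightarrow> l \<le> u)" for y
    by (simp add: image_iff)
  then obtain p where up: "\<And>y n. s y n \<le> p y" and least: "\<And>y u. (\<And>n. s y n \<le> u) \<Longrightarrow> p y \<le> u"
    by metis
  have py: "p y \<le> y" for y by (rule least) (rule sy)
  have p: "additive_on ?D p"
    unfolding additive_on_def
  proof (intro conjI ballI)
    fix x :: 'a assume "x \<in> ?D"
    then have x: "0 \<le> x" by simp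
    show "0 \<le> p x" by (rule order_trans[OF s0[OF x] up[of x 0]])
    fix y :: 'a assume "y \<in> ?D"
    then have y: "0 \<le> y" by simp
    show "p (x + y) = p x + p y"
    proof (rule order.antisym)
      show "p (x + y) \<le> p x + p y"
      proof (rule least)
        fix n
        have "s (x + y) n \<le> s x n + s y n"
          unfolding s_def by (rule inf_add_le) (use x y in \<open>auto intro: scaleR_nonneg_nonneg\<close>)
        also have "\<dots> \<le> p x + p y" by (intro add_mono up)
        finally show "s (x + y) n \<le> p x + p y" .
      qed
      have "p x \<le> p (x + y) - p y"
      proof (rule least)
        fix m
        have "p y \<le> p (x + y) - s x m"
        proof (rule least)
          fix n
          have "s x m + s y n \<le> s (x + y) (m + n)"
            unfolding s_def using add_inf_le_inf[of x "real m *\<^sub>R pprt d" y "real n *\<^sub>R pprt d"]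
            by (simp add: scaleR_left_distrib)
          also have "\<dots> \<le> p (x + y)" by (rule up)
          finally show "s y n \<le> p (x + y) - s x m" by (simp add: le_diff_eq add.commute)
        qed
        then show "s x m \<le> p (x + y) - p y" by (simp add: le_diff_eq add.commute)
      qed
      then show "p x + p y \<le> p (x + y)" by (simp add: le_diff_eq)
    qed
  qed
  show thesis
  proof
    show "center_on ?D (cone_ext p)" by (rule center_on_cone_ext[OF D p py])
    have "pprt d \<le> p (pprt d)" using up[of "pprt d" 1] by (simp add: s_def)
    then have 1: "p (pprt d) = pprt d" using py by (simp add: order.antisym)
    have "s (- nprt d) n = 0" for n
      unfolding s_def by (rule disjoint_scaleR) (use inf_pprt_nprt[of d] in \<open>simp_all add: inf_commute\<close>)
    then have "p (- nprt d) \<le> 0" by (intro least) simp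
    moreover have "0 \<le> p (- nprt d)" by (rule additive_onD(1)[OF p]) simp
    ultimately have 2: "p (- nprt d) = 0" by (rule order.antisym)
    show "cone_ext p d = pprt d" by (simp add: cone_ext_def 1 2)
  qed
qed

section \<open>Multipliers of a principal ideal\<close>

lemma lim_le_eventually:
  fixes f :: "nat \<Rightarrow> 'a::banach_lattice"
  assumes "f \<longlonglongrightarrow> l" "g \<longlonglongrightarrow> m" "\<forall>\<^sub>F n in sequentially. f n \<le> g n"
  shows "l \<le> m"
proof -
  obtain N where N: "\<And>n. n \<ge> N \<Longrightarrow> f n \<le> g n" using assms(3) by (auto simp: eventually_sequentially)
  show ?thesis
    by (rule lim_le[OF LIMSEQ_ignore_initial_segment[OF assms(1), of N]
          LIMSEQ_ignore_initial_segment[OF assms(2), of N]]) (simp add: N)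
qed

lemma convergent_of_geometric_steps:
  fixes a :: "nat \<Rightarrow> 'a::banach"
  assumes "\<forall>\<^sub>F j in sequentially. norm (a (Suc j) - a j) \<le> C * (1/2) ^ j"
  shows "convergent a"
proof -
  have "summable (\<lambda>j. a (Suc j) - a j)"
    by (rule summable_comparison_test_ev[OF assms]) (intro summable_mult summable_geometric, simp)
  then have "(\<lambda>n. \<Sum>j<n. a (Suc j) - a j) \<longlonglongrightarrow> (\<Sum>j. a (Suc j) - a j)" by (rule summable_LIMSEQ)
  then have "(\<lambda>n. a n - a 0) \<longlonglongrightarrow> (\<Sum>j. a (Suc j) - a j)" by (simp add: sum_lessThan_telescope)
  from tendsto_add[OF this tendsto_const[of "a 0"]] show ?thesis by (simp add: convergent_def) blast
qed

text \<open>Lowering all levels by one brings in a single new term at the bottom; after division by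
  the number 2^j of levels this error vanishes.\<close>

lemma sum_shift_le:
  fixes g :: "real \<Rightarrow> 'a::ordered_ab_group_add"
  assumes "g (-1) \<le> y" "0 \<le> y" "\<And>k. 0 \<le> g k"
  shows "(\<Sum>k<n. g (real k - 1)) \<le> y + (\<Sum>k<n. g (real k))"
proof (cases n)
  case (Suc m)
  have "(\<Sum>k<Suc m. g (real k - 1)) = g (-1) + (\<Sum>k<m. g (real k))"
    by (subst sum.lessThan_Suc_shift) simp
  also have "\<dots> \<le> y + (\<Sum>k<Suc m. g (real k))"
    using assms(1,3) by (intro add_mono) simp_all
  finally show ?thesis using Suc by simp
qed (use assms in simp)

lemma sum_even_odd: "(\<Sum>l<2 * n. g l) = (\<Sum>k<n. g (2 * k) + g (2 * k + 1))"
  for g :: "nat \<Rightarrow> 'a::comm_monoid_add"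
  by (induction n) (simp_all add: add.assoc)

text \<open>\<open>slab u v N k y\<close> plays the role of the product of \<open>y\<close> with the indicator function of the set
  \<open>v > (k / N) u\<close>; averaging over \<open>k\<close> turns these into the product of \<open>y\<close> with \<open>v / u\<close>.\<close>

definition slab :: "'a::banach_lattice \<Rightarrow> 'a \<Rightarrow> real \<Rightarrow> real \<Rightarrow> 'a \<Rightarrow> 'a" where
  "slab u v N k y = inf y (N *\<^sub>R pprt (N *\<^sub>R v - k *\<^sub>R u))"

definition slab_mean :: "'a::banach_lattice \<Rightarrow> 'a \<Rightarrow> nat \<Rightarrow> 'a \<Rightarrow> 'a" where
  "slab_mean u v j y = (1/2) ^ j *\<^sub>R (\<Sum>k<2^j. slab u v (2 ^ j) (real k) y)"

context
  fixes u v :: "'a::banach_lattice"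
  assumes u: "0 \<le> u" and v: "0 \<le> v" "v \<le> u"
begin

lemma slab_bounds: "0 \<le> y \<Longrightarrow> 0 \<le> N \<Longrightarrow> 0 \<le> slab u v N k y" "slab u v N k y \<le> y"
  by (simp_all add: slab_def scaleR_nonneg_nonneg)

lemma slab_antimono: "0 \<le> N \<Longrightarrow> k \<le> l \<Longrightarrow> slab u v N l y \<le> slab u v N k y"
  unfolding slab_def
  by (intro inf_mono order_refl scaleR_left_mono pprt_mono diff_left_mono scaleR_right_mono u)

text \<open>An arbitrarily large multiplier costs only one level: with a = N v - k u,
  \<open>inf_scaleR_pprt_le\<close> gives the bound (N a + y)^+, and y <= N u turns it into N (a +
  u)^+, which explains the factor N in \<open>slab\<close>.\<close>

lemma inf_le_slab:
  assumes y: "0 \<le> y" "y \<le> c *\<^sub>R u" and c: "c \<le> N" "0 \<le> N" and m: "0 \<le> m"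
  shows "inf y (m *\<^sub>R pprt (N *\<^sub>R v - k *\<^sub>R u)) \<le> slab u v N (k - 1) y"
proof -
  let ?a = "N *\<^sub>R v - k *\<^sub>R u"
  have "inf y (m *\<^sub>R pprt ?a) \<le> pprt (N *\<^sub>R ?a + y)" by (rule inf_scaleR_pprt_le[OF y(1) m c(2)])
  also have "\<dots> \<le> pprt (N *\<^sub>R ?a + N *\<^sub>R u)"
    by (intro pprt_mono add_left_mono order_trans[OF y(2)] scaleR_right_mono c u)
  also have "N *\<^sub>R ?a + N *\<^sub>R u = N *\<^sub>R (N *\<^sub>R v - (k - 1) *\<^sub>R u)" by (simp add: algebra_simps)
  also have "pprt \<dots> = N *\<^sub>R pprt (N *\<^sub>R v - (k - 1) *\<^sub>R u)" by (rule pprt_scaleR[OF c(2)])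
  finally show ?thesis by (simp add: slab_def)
qed

lemma sum_slab_shift_le:
  assumes "0 \<le> y" "0 \<le> N"
  shows "(\<Sum>k<n. slab u v N (real k - 1) y) \<le> y + (\<Sum>k<n. slab u v N (real k) y)"
  by (rule sum_shift_le) (use assms slab_bounds in auto)

lemma slab_double: "slab u v (2 * N) (2 * k) y = inf y ((4 * N) *\<^sub>R pprt (N *\<^sub>R v - k *\<^sub>R u))"
proof -
  have "(2 * N) *\<^sub>R v - (2 * k) *\<^sub>R u = 2 *\<^sub>R (N *\<^sub>R v - k *\<^sub>R u)" by (simp add: scaleR_diff_right)
  then show ?thesis by (simp add: slab_def pprt_scaleR)
qed

text \<open>On the doubled grid the slab at level 2 k lies between the coarse slabs at k and k - 1,
  and the slab at 2 k + 1 between its even neighbours. Each shift by one level costs at most y in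
  the sum.\<close>

lemma slab_mean_step:
  assumes y: "0 \<le> y" "y \<le> c *\<^sub>R u" and c: "c \<le> 2 ^ j"
  shows "\<bar>slab_mean u v (Suc j) y - slab_mean u v j y\<bar> \<le> (1/2) ^ j *\<^sub>R y"
proof -
  let ?N = "2 ^ j :: real" and ?n = "2 ^ j :: nat"
  let ?t = "\<lambda>k. slab u v ?N k y" and ?s = "\<lambda>k. slab u v (2 * ?N) k y"
  let ?S = "\<Sum>k<?n. ?t (real k)"
  have t0: "0 \<le> ?t k" for k by (rule slab_bounds) (use y in auto)
  have up: "?s (2 * k) \<le> ?t (k - 1)" for k
    unfolding slab_double by (rule inf_le_slab[OF y c]) auto
  have lo: "?t k \<le> ?s (2 * k)" for k
    unfolding slab_double unfolding slab_def by (intro inf_mono order_refl scaleR_right_mono) auto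
  have ev: "(\<Sum>l<2 * ?n. ?s (real l)) = (\<Sum>k<?n. ?s (2 * real k) + ?s (2 * real k + 1))"
    by (subst sum_even_odd) (simp add: add.commute)
  have odd_le: "?s (2 * k + 1) \<le> ?s (2 * k)" and odd_ge: "?s (2 * (k + 1)) \<le> ?s (2 * k + 1)" for k
    by (rule slab_antimono; simp)+
  have "(\<Sum>l<2 * ?n. ?s (real l)) \<le> (\<Sum>k<?n. ?t (real k - 1) + ?t (real k - 1))"
    unfolding ev by (intro sum_mono add_mono up order_trans[OF odd_le up])
  also have "\<dots> \<le> (y + ?S) + (y + ?S)"
    unfolding sum.distrib by (intro add_mono sum_slab_shift_le y) simp_all
  finally have U: "(\<Sum>l<2 * ?n. ?s (real l)) \<le> 2 *\<^sub>R (y + ?S)" by (simp only: scaleR_2)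
  have "?S \<le> y + (\<Sum>k<?n. ?t (real k + 1))"
  proof -
    have "(\<Sum>k<?n. ?t (real k)) \<le> (\<Sum>k<Suc ?n. ?t (real k))" using t0 by simp
    also have "\<dots> = ?t 0 + (\<Sum>k<?n. ?t (real k + 1))" by (subst sum.lessThan_Suc_shift) (simp add: add.commute)
    also have "\<dots> \<le> y + (\<Sum>k<?n. ?t (real k + 1))" by (intro add_right_mono slab_bounds)
    finally show ?thesis .
  qed
  then have "?S + ?S \<le> y + ((\<Sum>k<?n. ?t (real k + 1)) + ?S)"
    by (simp add: add.assoc)
  also have "\<dots> \<le> y + (\<Sum>l<2 * ?n. ?s (real l))"
    unfolding ev sum.distrib[symmetric]
    by (subst (2) add.commute) (intro add_left_mono sum_mono add_mono lo order_trans[OF lo odd_ge])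
  finally have L: "2 *\<^sub>R ?S - y \<le> (\<Sum>l<2 * ?n. ?s (real l))"
    by (simp add: scaleR_2 diff_le_eq add.commute)
  have m: "slab_mean u v (Suc j) y = ((1/2) ^ j / 2) *\<^sub>R (\<Sum>l<2 * ?n. ?s (real l))"
    by (simp add: slab_mean_def mult.commute)
  have "slab_mean u v (Suc j) y \<le> ((1/2) ^ j / 2) *\<^sub>R (2 *\<^sub>R (y + ?S))"
    unfolding m by (rule scaleR_left_mono[OF U]) simp
  also have "\<dots> = (1/2) ^ j *\<^sub>R y + slab_mean u v j y"
    by (simp add: slab_mean_def scaleR_right_distrib)
  finally have 1: "slab_mean u v (Suc j) y - slab_mean u v j y \<le> (1/2) ^ j *\<^sub>R y" by (simp add: diff_le_eq)
  have "slab_mean u v j y - ((1/2) ^ j / 2) *\<^sub>R y = ((1/2) ^ j / 2) *\<^sub>R (2 *\<^sub>R ?S - y)"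
    by (simp add: slab_mean_def scaleR_diff_right)
  also have "\<dots> \<le> slab_mean u v (Suc j) y"
    unfolding m by (rule scaleR_left_mono[OF L]) simp
  finally have "slab_mean u v j y - slab_mean u v (Suc j) y \<le> ((1/2) ^ j / 2) *\<^sub>R y"
    by (simp add: diff_le_eq add.commute)
  also have "\<dots> \<le> (1/2) ^ j *\<^sub>R y" by (rule scaleR_right_mono[OF _ y(1)]) simp
  finally show ?thesis using 1 by (intro abs_leI) simp_all
qed

lemma slab_mean_bounds:
  assumes y: "0 \<le> y"
  shows "0 \<le> slab_mean u v j y" "slab_mean u v j y \<le> y"
proof -
  show "0 \<le> slab_mean u v j y"
    unfolding slab_mean_def by (intro scaleR_nonneg_nonneg sum_nonneg slab_bounds y) auto
  have "slab_mean u v j y \<le> (1/2) ^ j *\<^sub>R (\<Sum>k<(2::nat)^j. y)"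
    unfolding slab_mean_def by (intro scaleR_left_mono sum_mono slab_bounds) auto
  also have "\<dots> = y" by (simp add: sum_constant_scaleR power_one_over)
  finally show "slab_mean u v j y \<le> y" .
qed

lemma slab_mean_subadd:
  assumes "0 \<le> y" "0 \<le> z"
  shows "slab_mean u v j (y + z) \<le> slab_mean u v j y + slab_mean u v j z"
  unfolding slab_mean_def scaleR_right_distrib[symmetric] sum.distrib[symmetric] slab_def
  by (intro scaleR_left_mono sum_mono inf_add_le assms scaleR_nonneg_nonneg) auto

text \<open>Adding two slabs doubles the multiplier, which one level absorbs; averaging reduces that
  level to the error term.\<close>

lemma slab_mean_superadd:
  assumes yz: "0 \<le> y" "0 \<le> z" "y + z \<le> c *\<^sub>R u" and c: "c \<le> 2 ^ j"
  shows "slab_mean u v j y + slab_mean u v j z \<le> slab_mean u v j (y + z) + (1/2) ^ j *\<^sub>R (y + z)"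
proof -
  let ?N = "2 ^ j :: real"
  have yz0: "0 \<le> y + z" using yz by simp
  have "slab u v ?N k y + slab u v ?N k z \<le> slab u v ?N (k - 1) (y + z)" for k
  proof -
    have "slab u v ?N k y + slab u v ?N k z \<le> inf (y + z) ((2 * ?N) *\<^sub>R pprt (?N *\<^sub>R v - k *\<^sub>R u))"
      unfolding slab_def mult_2 scaleR_left_distrib by (rule add_inf_le_inf)
    also have "\<dots> \<le> slab u v ?N (k - 1) (y + z)"
      by (rule inf_le_slab[OF yz0 yz(3) c]) simp_all
    finally show ?thesis .
  qed
  then have "(\<Sum>k<(2::nat)^j. slab u v ?N (real k) y) + (\<Sum>k<(2::nat)^j. slab u v ?N (real k) z)
      \<le> (\<Sum>k<(2::nat)^j. slab u v ?N (real k - 1) (y + z))"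
    unfolding sum.distrib[symmetric] by (intro sum_mono)
  also have "\<dots> \<le> (y + z) + (\<Sum>k<(2::nat)^j. slab u v ?N (real k) (y + z))"
    by (rule sum_slab_shift_le) (use yz0 in auto)
  finally have "(1/2) ^ j *\<^sub>R ((\<Sum>k<(2::nat)^j. slab u v ?N (real k) y) + (\<Sum>k<(2::nat)^j. slab u v ?N (real k) z))
      \<le> (1/2) ^ j *\<^sub>R ((y + z) + (\<Sum>k<(2::nat)^j. slab u v ?N (real k) (y + z)))"
    by (intro scaleR_left_mono) auto
  then show ?thesis
    by (simp add: slab_mean_def scaleR_right_distrib add.assoc add.commute add.left_commute)
qed

text \<open>The layers inf u (w - k u)^+ of w = 2^j v equal inf w ((k + 1) u) - inf w (k u) and so
  telescope to w. The slab of u at level k lies between the layers k and k - 1.\<close>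

lemma slab_mean_unit: "v \<le> slab_mean u v j u" "slab_mean u v j u \<le> (1/2) ^ j *\<^sub>R u + v"
proof -
  let ?N = "2 ^ j :: real" and ?n = "2 ^ j :: nat"
  define w where "w = ?N *\<^sub>R v"
  have w: "0 \<le> w" "w \<le> ?N *\<^sub>R u" using v by (simp_all add: w_def scaleR_nonneg_nonneg scaleR_left_mono)
  let ?g = "\<lambda>k. inf u (pprt (w - k *\<^sub>R u))"
  have g: "?g k = inf w ((k + 1) *\<^sub>R u) - inf w (k *\<^sub>R u)" for k
  proof -
    have "?g k + inf w (k *\<^sub>R u) = inf (u + inf w (k *\<^sub>R u)) w"
      unfolding diff_inf_pprt[symmetric] by (simp only: add_inf_distrib_right diff_add_cancel)
    also have "u + inf w (k *\<^sub>R u) = inf (u + w) ((k + 1) *\<^sub>R u)"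
      by (simp only: add_inf_distrib_left scaleR_left_distrib scaleR_one add.commute)
    also have "inf (inf (u + w) ((k + 1) *\<^sub>R u)) w = inf (inf (u + w) w) ((k + 1) *\<^sub>R u)"
      by (simp only: inf_aci)
    also have "inf (u + w) w = w" using u by (simp add: inf_absorb2)
    finally show ?thesis by (simp only: eq_diff_eq)
  qed
  have "(\<Sum>k<?n. ?g (real k)) = (\<Sum>k<?n. inf w (real (Suc k) *\<^sub>R u) - inf w (real k *\<^sub>R u))"
    unfolding g by (simp only: of_nat_Suc add.commute)
  also have "\<dots> = inf w (real ?n *\<^sub>R u) - inf w (real 0 *\<^sub>R u)"
    by (rule sum_lessThan_telescope)
  also have "\<dots> = w" using w by (simp add: inf_absorb1 inf_absorb2)
  finally have sg: "(\<Sum>k<?n. ?g (real k)) = w" .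
  have wv: "(1/2) ^ j *\<^sub>R w = v" by (simp add: w_def power_one_over)
  have "v = (1/2) ^ j *\<^sub>R (\<Sum>k<?n. ?g (real k))" by (simp only: sg wv)
  also have "\<dots> \<le> slab_mean u v j u"
    unfolding slab_mean_def slab_def w_def
  proof (intro scaleR_left_mono sum_mono inf_mono order_refl)
    show "pprt x \<le> ?N *\<^sub>R pprt x" for x :: 'a
      using scaleR_right_mono[of 1 ?N "pprt x"] by simp
  qed simp
  finally show "v \<le> slab_mean u v j u" .
  have "slab u v ?N k u \<le> ?g (k - 1)" for k
  proof -
    have "slab u v ?N k u \<le> pprt (1 *\<^sub>R (w - k *\<^sub>R u) + u)"
      unfolding slab_def w_def by (rule inf_scaleR_pprt_le[OF u]) auto
    also have "1 *\<^sub>R (w - k *\<^sub>R u) + u = w - (k - 1) *\<^sub>R u" by (simp add: algebra_simps)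
    finally show ?thesis using slab_bounds(2) by simp
  qed
  then have "(\<Sum>k<?n. slab u v ?N (real k) u) \<le> (\<Sum>k<?n. ?g (real k - 1))" by (rule sum_mono)
  also have "\<dots> \<le> u + (\<Sum>k<?n. ?g (real k))"
    by (rule sum_shift_le[of ?g u ?n]) (simp_all add: u)
  also note sg
  finally have "slab_mean u v j u \<le> (1/2) ^ j *\<^sub>R (u + w)"
    unfolding slab_mean_def by (rule scaleR_left_mono) simp
  then show "slab_mean u v j u \<le> (1/2) ^ j *\<^sub>R u + v" by (simp add: scaleR_right_distrib wv)
qed

text \<open>The operator is multiplication by v / u, the limit of the slab means. Norm completeness
  supplies the limit where order suprema may be missing: once 2^j u dominates y, consecutive means
  of y differ by at most y / 2^j, and the defects in additivity and at u vanish likewise.\<close>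

lemma ideal_multiplier: obtains X where "center_on (ideal_cone u) X" "X u = v"
proof -
  let ?D = "ideal_cone u"
  note D = solid_cone_ideal[of u]
  have ev: "\<forall>\<^sub>F j in sequentially. c \<le> 2 ^ j" for c :: real
    by real_asymp
  have half: "(\<lambda>j. (1/2) ^ j *\<^sub>R z) \<longlonglongrightarrow> 0" for z :: 'a
    using tendsto_scaleR[OF LIMSEQ_power_zero[of "1/2::real"] tendsto_const[of z]] by simp
  define p where "p y = lim (\<lambda>j. slab_mean u v j y)" for y
  have p: "(\<lambda>j. slab_mean u v j y) \<longlonglongrightarrow> p y" if y: "y \<in> ?D" for y
  proof -
    obtain c where c: "0 \<le> y" "y \<le> c *\<^sub>R u" using y by (auto simp: ideal_cone_def)
    have "convergent (\<lambda>j. slab_mean u v j y)"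
    proof (rule convergent_of_geometric_steps)
      show "\<forall>\<^sub>F j in sequentially. norm (slab_mean u v (Suc j) y - slab_mean u v j y) \<le> norm y * (1/2) ^ j"
        using ev[of c]
      proof (rule eventually_mono)
        fix j assume "c \<le> 2 ^ j"
        from norm_le_of_abs_le[OF slab_mean_step[OF c this]]
        show "norm (slab_mean u v (Suc j) y - slab_mean u v j y) \<le> norm y * (1/2) ^ j"
          by (simp add: mult.commute)
      qed
    qed
    then show ?thesis by (simp add: p_def convergent_LIMSEQ_iff)
  qed
  have bounds: "0 \<le> p y" "p y \<le> y" if y: "y \<in> ?D" for y
  proof -
    have y0: "0 \<le> y" by (rule solid_coneD(2)[OF D y])
    show "0 \<le> p y" by (rule lim_nonneg[OF p[OF y] slab_mean_bounds(1)[OF y0]])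
    show "p y \<le> y" by (rule lim_le[OF p[OF y] tendsto_const slab_mean_bounds(2)[OF y0]])
  qed
  have add: "additive_on ?D p"
    unfolding additive_on_def
  proof (intro conjI ballI)
    fix y assume y: "y \<in> ?D"
    show "0 \<le> p y" by (rule bounds[OF y])
    fix z assume z: "z \<in> ?D"
    have yz: "y + z \<in> ?D" by (rule solid_coneD(3)[OF D y z])
    have y0: "0 \<le> y" and z0: "0 \<le> z" using solid_coneD(2)[OF D] y z by blast+
    show "p (y + z) = p y + p z"
    proof (rule order.antisym)
      show "p (y + z) \<le> p y + p z"
        by (rule lim_le[OF p[OF yz] tendsto_add[OF p[OF y] p[OF z]]]) (rule slab_mean_subadd[OF y0 z0])
      obtain c where c: "y + z \<le> c *\<^sub>R u" using yz by (auto simp: ideal_cone_def)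
      have "p y + p z \<le> p (y + z) + 0"
      proof (rule lim_le_eventually[OF tendsto_add[OF p[OF y] p[OF z]] tendsto_add[OF p[OF yz] half[of "y + z"]]])
        show "\<forall>\<^sub>F j in sequentially. slab_mean u v j y + slab_mean u v j z
            \<le> slab_mean u v j (y + z) + (1/2) ^ j *\<^sub>R (y + z)"
          using ev[of c] by (rule eventually_mono) (rule slab_mean_superadd[OF y0 z0 c])
      qed
      then show "p y + p z \<le> p (y + z)" by simp
    qed
  qed
  have uD: "u \<in> ?D" by (rule ideal_cone_self[OF u])
  have "v \<le> p u" by (rule lim_le[OF tendsto_const p[OF uD]]) (rule slab_mean_unit)
  moreover have "p u \<le> 0 + v"
    by (rule lim_le[OF p[OF uD] tendsto_add[OF half[of u] tendsto_const]]) (rule slab_mean_unit)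
  ultimately have "p u = v" by simp
  show thesis
  proof
    show "center_on ?D (cone_ext p)" by (rule center_on_cone_ext[OF D add bounds(2)])
    show "cone_ext p u = v" using cone_ext_eq[OF D add uD] \<open>p u = v\<close> by simp
  qed
qed

end

text \<open>\<open>L\<close> lives on the ideal only, so h composed with \<open>L\<close> is not a
  functional on the whole space. For h >= 0 it is dominated by h there and extends to a bounded
  functional, on which the x n are null; a general h is a difference of two positive ones.\<close>

lemma center_on_weakly_null:
  fixes x :: "nat \<Rightarrow> 'a::banach_lattice" and h :: "'a \<Rightarrow>\<^sub>L real"
  assumes L: "center_on (ideal_cone u) L" and xD: "\<And>n. \<bar>x n\<bar> \<in> ideal_cone u"
    and x: "\<And>h :: 'a \<Rightarrow>\<^sub>L real. (\<lambda>n. blinfun_apply h (x n)) \<longlonglongrightarrow> 0"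
  shows "(\<lambda>n. blinfun_apply h (L (x n))) \<longlonglongrightarrow> 0"
proof -
  let ?D = "ideal_cone u"
  note D = solid_cone_ideal[of u]
  have pos: "(\<lambda>n. h (L (x n))) \<longlonglongrightarrow> 0" if h: "0 \<le> h" for h :: "'a \<Rightarrow>\<^sub>L real"
  proof -
    have "additive_on ?D (\<lambda>y. h (L y))"
      unfolding additive_on_def
    proof (intro conjI ballI)
      fix y assume y: "y \<in> ?D"
      show "0 \<le> h (L y)" by (rule blinfun_nonneg[OF h center_onD(3)[OF L y]])
      fix z assume z: "z \<in> ?D"
      show "h (L (y + z)) = h (L y) + h (L z)"
        using center_onD(1)[OF L abs_mem_cone[OF D y] abs_mem_cone[OF D z]] by (simp add: blinfun.add_right)
    qed
    then obtain r where r: "\<And>y. y \<in> ?D \<Longrightarrow> blinfun_apply r y = h (L y)"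
      by (rule functional_extension[OF _ h]) (use blinfun_mono[OF h center_onD(4)[OF L]] in auto)
    have "h (L (x n)) = r (x n)" for n
    proof -
      note a = abs_in_cone[OF D xD[of n]]
      have "L (x n) = L (pprt (x n)) - L (- nprt (x n))"
        using center_on_diff[OF L abs_mem_cone[OF D a(1)] abs_mem_cone[OF D a(2)]] by (simp flip: prts)
      then have "h (L (x n)) = r (pprt (x n)) - r (- nprt (x n))" by (simp add: blinfun.diff_right r a)
      also have "\<dots> = r (x n)" by (simp flip: blinfun.diff_right prts)
      finally show ?thesis .
    qed
    then show ?thesis using x[of r] by simp
  qed
  have "(\<lambda>n. pprt h (L (x n)) - (- nprt h) (L (x n))) \<longlonglongrightarrow> 0 - 0"
    by (intro tendsto_diff pos) simp_all
  moreover have "pprt h y - (- nprt h) y = h y" for y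
    by (simp flip: blinfun.diff_left prts)
  ultimately show ?thesis by simp
qed

subsection \<open>Approximation of dominated operators\<close>

lemma sum_list_concat_map:
  "sum_list (map f (concat (map h xs))) = (\<Sum>x\<leftarrow>xs. sum_list (map f (h x)))"
  for f :: "'b \<Rightarrow> 'a::comm_monoid_add"
  by (induction xs) simp_all

lemma blinfun_sum_list: "blinfun_apply g (\<Sum>x\<leftarrow>xs. f x) = (\<Sum>x\<leftarrow>xs. blinfun_apply g (f x))"
  by (induction xs) (simp_all add: blinfun.zero_right blinfun.add_right)

lemma abs_sum_list_le: "\<bar>\<Sum>x\<leftarrow>xs. f x\<bar> \<le> (\<Sum>x\<leftarrow>xs. \<bar>f x\<bar>)"
  for f :: "'b \<Rightarrow> 'a::ordered_ab_group_add_abs"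
  by (induction xs) (simp_all add: order_trans[OF abs_triangle_ineq])

text \<open>For b > 0 the parabola is concave with its maximum at a / b, which lies in [0, 1], so
  clipping moves l towards the maximum.\<close>

lemma quadratic_clip:
  fixes a b l :: real
  assumes "0 \<le> a" "a \<le> b"
  shows "2 * l * a - l\<^sup>2 * b \<le> 2 * (max 0 (min 1 l)) * a - (max 0 (min 1 l))\<^sup>2 * b"
proof -
  consider "l < 0" | "0 \<le> l" "l \<le> 1" | "1 < l" by linarith
  then show ?thesis
  proof cases
    case 1
    then have "2 * l * a \<le> 0" using assms by (simp add: mult_nonpos_nonneg)
    moreover have "0 \<le> l\<^sup>2 * b" using assms by simp
    ultimately have "2 * l * a - l\<^sup>2 * b \<le> 0" by linarith
    then show ?thesis using 1 by simp
  next
    case 3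
    have "0 \<le> (l - 1) * ((l + 1) * b - 2 * a)"
    proof (intro mult_nonneg_nonneg)
      have "2 * b \<le> (l + 1) * b" using 3 assms by (intro mult_right_mono) auto
      then show "0 \<le> (l + 1) * b - 2 * a" using assms by linarith
    qed (use 3 in simp)
    then show ?thesis using 3 by (simp add: algebra_simps power2_eq_square)
  qed simp
qed

text \<open>A list of triples \<open>(l, P, L)\<close> encodes the operator \<open>\<Sum> l P T L\<close>, where the tensors
  \<open>P \<otimes> L\<close> form a partition of unity. The coefficients of a list almost maximising
  \<open>\<Sum> 2 l g(P S L u) - l\<^sup>2 g(P T L u)\<close> approximate the density of \<open>S\<close> with respect to \<open>T\<close>
  in quadratic mean, because refining the partition by \<open>x / u\<close> and by the sign of
  \<open>S L x - l T L x\<close> can increase this quantity only a little.\<close>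

lemma dominated_operator_approx:
  fixes S T :: "'a::banach_lattice \<Rightarrow> 'b::{banach_lattice, sigma_dedekind_complete}"
    and g :: "'b \<Rightarrow>\<^sub>L real"
  assumes S: "positive_operator S" and T: "positive_operator T"
    and ST: "\<And>x. 0 \<le> x \<Longrightarrow> S x \<le> T x"
    and u: "0 \<le> u" and g: "0 \<le> g" and e: "0 < e"
  obtains ps :: "(real \<times> ('b \<Rightarrow> 'b) \<times> ('a \<Rightarrow> 'a)) list"
  where "\<And>l P L. (l, P, L) \<in> set ps \<Longrightarrow>
      0 \<le> l \<and> l \<le> 1 \<and> center_on {x. 0 \<le> x} P \<and> center_on (ideal_cone u) L"
    "\<And>x. x \<in> ideal_cone u \<Longrightarrow> (\<Sum>(l, P, L)\<leftarrow>ps. P (T (L x))) = T x"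
    "\<And>x. 0 \<le> x \<Longrightarrow> x \<le> u \<Longrightarrow>
      blinfun_apply g \<bar>S x - (\<Sum>(l, P, L)\<leftarrow>ps. l *\<^sub>R P (T (L x)))\<bar> \<le> e"
proof -
  let ?D = "ideal_cone u" and ?C = "{x::'b. 0 \<le> x}"
  note D = solid_cone_ideal[of u] and C = solid_cone_nonneg[where 'a = 'b]
  have uD: "u \<in> ?D" by (rule ideal_cone_self[OF u])
  have linS: "linear S" and linT: "linear T" using S T by (simp_all add: positive_operator_def)
  \<comment> \<open>The coefficients are left unrestricted, so that perturbing them by \<delta>
    preserves admissibility.\<close>
  define adm where "adm ps \<longleftrightarrow> (\<forall>(l, P, L)\<in>set ps. center_on ?C P \<and> center_on ?D L) \<and>
    (\<forall>x\<in>?D. (\<Sum>(l, P, L)\<leftarrow>ps. P (S (L x))) = S x \<and> (\<Sum>(l, P, L)\<leftarrow>ps. P (T (L x))) = T x)"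
    for ps :: "(real \<times> ('b \<Rightarrow> 'b) \<times> ('a \<Rightarrow> 'a)) list"
  \<comment> \<open>If S had a density s with respect to T, then 2 l s - l^2 = s^2 - (s - l)^2, so
    maximising the total is a least squares problem for s.\<close>
  define q where "q = (\<lambda>(l, P, L). 2 * l * g (P (S (L u))) - l\<^sup>2 * g (P (T (L u))))"
  define \<Phi> where "\<Phi> ps = sum_list (map q ps)" for ps
  have linP: "linear P" if "center_on ?C P" for P :: "'b \<Rightarrow> 'b"
    using center_on_bounded_linear[OF that] by (rule bounded_linear.linear)
  have posP: "positive_operator P" if "center_on ?C P" for P :: "'b \<Rightarrow> 'b"
    using linP[OF that] center_onD(3)[OF that] by (simp add: positive_operator_def)
  have quad: "0 \<le> g (P (S (L u)))" "g (P (S (L u))) \<le> g (P (T (L u)))"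
    if "center_on ?C P" "center_on ?D L" for P L
  proof -
    have Lu: "0 \<le> L u" by (rule center_onD(3)[OF that(2) uD])
    have "0 \<le> P (S (L u))" using S posP[OF that(1)] Lu by (simp add: positive_operator_def)
    then show "0 \<le> g (P (S (L u)))" by (rule blinfun_nonneg[OF g])
    show "g (P (S (L u))) \<le> g (P (T (L u)))"
      by (intro blinfun_mono[OF g] positive_operator_mono[OF posP[OF that(1)]] ST Lu)
  qed
  have bound: "\<Phi> ps \<le> g (S u)" if "adm ps" for ps
  proof -
    have "\<Phi> ps \<le> (\<Sum>(l, P, L)\<leftarrow>ps. g (P (S (L u))))"
      unfolding \<Phi>_def
    proof (rule sum_list_mono)
      fix p assume p: "p \<in> set ps"
      obtain l P L where [simp]: "p = (l, P, L)" by (cases p)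
      have c: "center_on ?C P" "center_on ?D L" using that p unfolding adm_def by auto
      have "0 \<le> (1 - l)\<^sup>2 * g (P (S (L u)))" using quad(1)[OF c] by simp
      moreover have "l\<^sup>2 * g (P (S (L u))) \<le> l\<^sup>2 * g (P (T (L u)))"
        by (rule mult_left_mono[OF quad(2)[OF c]]) simp
      ultimately show "q p \<le> (case p of (l, P, L) \<Rightarrow> g (P (S (L u))))"
        by (simp add: q_def power2_eq_square algebra_simps)
    qed
    also have "\<dots> = g (\<Sum>(l, P, L)\<leftarrow>ps. P (S (L u)))"
      by (simp add: blinfun_sum_list case_prod_unfold)
    also have "\<dots> = g (S u)" using that uD unfolding adm_def by simp
    finally show ?thesis .
  qed
  have "adm [(0, \<lambda>y. y, \<lambda>x. x)]"
    unfolding adm_def by (simp add: center_on_id[OF D] center_on_id[OF C])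
  then have ne: "{\<Phi> ps | ps. adm ps} \<noteq> {}" by blast
  have bdd: "bdd_above {\<Phi> ps | ps. adm ps}" by (rule bdd_aboveI[of _ "g (S u)"]) (use bound in auto)
  \<comment> \<open>The 1 keeps \<open>K\<close> positive. With \<delta> = e / K the second-order
    cost \<delta>^2 g (T x) of a perturbation is at most e \<delta>, the optimality gap allowed for
    \<open>ps0\<close>.\<close>
  define K where "K = g (T u) + 1"
  have gTu: "0 \<le> g (T u)" using T u by (intro blinfun_nonneg[OF g]) (simp add: positive_operator_def)
  have K: "0 < K" using gTu by (simp add: K_def)
  define \<delta> where "\<delta> = e / K"
  have \<delta>: "0 < \<delta>" using e K by (simp add: \<delta>_def)
  have "Sup {\<Phi> ps | ps. adm ps} - e * \<delta> < Sup {\<Phi> ps | ps. adm ps}" using e \<delta> by simp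
  then obtain ps0 where ps0: "adm ps0" "Sup {\<Phi> ps | ps. adm ps} - e * \<delta> < \<Phi> ps0"
    using less_cSup_iff[OF ne bdd] by blast
  \<comment> \<open>Clipping leaves the tensors alone and does not lower \<Phi>; coefficients in
    [0, 1] later place the approximant between 0 and T.\<close>
  define clip where "clip = (\<lambda>(l::real, P :: 'b \<Rightarrow> 'b, L :: 'a \<Rightarrow> 'a). (max 0 (min 1 l), P, L))"
  define ps where "ps = map clip ps0"
  have adm: "adm ps"
    using ps0(1) unfolding adm_def ps_def by (auto simp: clip_def case_prod_unfold o_def)
  have l01: "0 \<le> l \<and> l \<le> 1" if "(l, P, L) \<in> set ps" for l P L
    using that by (auto simp: ps_def clip_def)
  have cP: "center_on ?C P" and cL: "center_on ?D L" if "(l, P, L) \<in> set ps" for l P L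
    using that adm unfolding adm_def by auto
  have "\<Phi> ps0 \<le> \<Phi> ps"
    unfolding \<Phi>_def ps_def map_map
  proof (rule sum_list_mono)
    fix p assume p: "p \<in> set ps0"
    obtain l P L where [simp]: "p = (l, P, L)" by (cases p)
    have c: "center_on ?C P" "center_on ?D L" using ps0(1) p unfolding adm_def by auto
    show "q p \<le> (q \<circ> clip) p"
      using quadratic_clip[OF quad[OF c], of l] by (simp add: q_def clip_def)
  qed
  then have opt: "\<Phi> ps' < \<Phi> ps + e * \<delta>" if "adm ps'" for ps'
    using cSup_upper[OF _ bdd, of "\<Phi> ps'"] that ps0(2) by force
  have approx: "g \<bar>S x - (\<Sum>(l, P, L)\<leftarrow>ps. l *\<^sub>R P (T (L x)))\<bar> \<le> e" if x: "0 \<le> x" "x \<le> u" for x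
  proof -
    have xD: "x \<in> ?D" by (rule solid_coneD(4)[OF D uD x])
    obtain X where X: "center_on ?D X" "X u = x" using ideal_multiplier[OF u x] by blast
    have "\<exists>Q. center_on ?C Q \<and> Q d = pprt d" for d :: 'b using band_multiplier by blast
    then obtain B where B: "\<And>d. center_on ?C (B d)" "\<And>d. B d d = pprt d" by metis
    define d where "d l L = S (L x) - l *\<^sub>R T (L x)" for l and L :: "'a \<Rightarrow> 'a"
    \<comment> \<open>\<open>X\<close> cuts the part x out of u, and \<open>B (d l L)\<close>
      projects onto the band where the residual is positive. On x the coefficient moves by \<delta>
      in the direction of the sign of the residual; on u - x it stays.\<close>
    define h where "h = (\<lambda>(l, P :: 'b \<Rightarrow> 'b, L).
      [(l + \<delta>, \<lambda>y. P (B (d l L) y), \<lambda>y. L (X y)),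
       (l - \<delta>, \<lambda>y. P (y - B (d l L) y), \<lambda>y. L (X y)),
       (l, P, \<lambda>y. L (y - X y))])"
    define ps' where "ps' = concat (map h ps)"
    have parts: "(\<Sum>(l, P, L)\<leftarrow>ps'. P (A (L y))) = (\<Sum>(l, P, L)\<leftarrow>ps. P (A (L y)))"
      if A: "linear A" and y: "y \<in> ?D" for A y
      unfolding ps'_def sum_list_concat_map
    proof (rule arg_cong[where f = sum_list], rule map_cong[OF refl])
      fix p assume p: "p \<in> set ps"
      obtain l P L where [simp]: "p = (l, P, L)" by (cases p)
      have c: "center_on ?C P" "center_on ?D L" using cP cL p by auto
      have "L (y - X y) = L y - L (X y)"
        by (rule center_on_diff[OF c(2)]) (use abs_mem_cone[OF D] y center_on_mem[OF D X(1)] in auto)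
      then show "(\<Sum>(l, P, L)\<leftarrow>h p. P (A (L y))) = (case p of (l, P, L) \<Rightarrow> P (A (L y)))"
        by (simp add: h_def linear_diff[OF A] linear_diff[OF linP[OF c(1)]])
    qed
    have adm': "adm ps'"
      unfolding adm_def
    proof (intro conjI ballI)
      fix y assume y: "y \<in> ?D"
      show "(\<Sum>(l, P, L)\<leftarrow>ps'. P (S (L y))) = S y" "(\<Sum>(l, P, L)\<leftarrow>ps'. P (T (L y))) = T y"
        using parts[OF linS y] parts[OF linT y] adm y unfolding adm_def by auto
    next
      fix p' assume "p' \<in> set ps'"
      then obtain p where p: "p \<in> set ps" "p' \<in> set (h p)" by (auto simp: ps'_def)
      obtain l P L where [simp]: "p = (l, P, L)" by (cases p)
      have c: "center_on ?C P" "center_on ?D L" using cP cL p by auto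
      show "case p' of (l, P, L) \<Rightarrow> center_on ?C P \<and> center_on ?D L"
        using p(2) center_on_compose[OF C c(1) B(1)] center_on_compose[OF D c(2) X(1)]
          center_on_compose[OF C c(1) center_on_compl[OF C B(1)]]
          center_on_compose[OF D c(2) center_on_compl[OF D X(1)]] c
        by (auto simp: h_def)
    qed
    \<comment> \<open>Moving with the sign of the residual gains 2 \<delta> g (P |d|) to first order
      and loses a term in \<delta>^2. Near-optimality of \<open>ps\<close> therefore bounds the sum
      of the g (P |d|).\<close>
    have "\<Phi> ps' = (\<Sum>(l, P, L)\<leftarrow>ps. q (l, P, L) + (2 * \<delta> * g (P \<bar>d l L\<bar>) - \<delta>\<^sup>2 * g (P (T (L x)))))"
      unfolding \<Phi>_def ps'_def sum_list_concat_map
    proof (rule arg_cong[where f = sum_list], rule map_cong[OF refl])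
      fix p assume p: "p \<in> set ps"
      obtain l P L where [simp]: "p = (l, P, L)" by (cases p)
      have c: "center_on ?C P" "center_on ?D L" using cP cL p by auto
      let ?Q = "B (d l L)"
      note lin = linear_diff[OF linP[OF c(1)]] linear_add[OF linP[OF c(1)]] linear_scale[OF linP[OF c(1)]]
      note linQ = linear_diff[OF linP[OF B(1)]] linear_scale[OF linP[OF B(1)]]
      have Lu: "L (u - x) = L u - L x"
        by (rule center_on_diff[OF c(2)]) (use abs_mem_cone[OF D] uD xD in auto)
      have "\<bar>d l L\<bar> = 2 *\<^sub>R pprt (d l L) - d l L"
        using prts[of "d l L"] by (simp add: abs_prts scaleR_2 algebra_simps)
      also have "pprt (d l L) = ?Q (S (L x)) - l *\<^sub>R ?Q (T (L x))"
        unfolding B(2)[symmetric] by (simp add: d_def linQ)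
      finally have E: "g (P \<bar>d l L\<bar>) = 2 * (g (P (?Q (S (L x)))) - l * g (P (?Q (T (L x)))))
          - (g (P (S (L x))) - l * g (P (T (L x))))"
        by (simp add: d_def lin blinfun.diff_right blinfun.scaleR_right)
      show "sum_list (map q (h p)) = (case p of (l, P, L) \<Rightarrow>
          q (l, P, L) + (2 * \<delta> * g (P \<bar>d l L\<bar>) - \<delta>\<^sup>2 * g (P (T (L x)))))"
        by (simp add: E h_def q_def X(2) Lu lin linear_diff[OF linS] linear_diff[OF linT]
            blinfun.diff_right power2_eq_square algebra_simps)
    qed
    also have "\<dots> = \<Phi> ps + (2 * \<delta> * (\<Sum>(l, P, L)\<leftarrow>ps. g (P \<bar>d l L\<bar>)) - \<delta>\<^sup>2 * (\<Sum>(l, P, L)\<leftarrow>ps. g (P (T (L x)))))"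
      by (simp add: \<Phi>_def case_prod_unfold sum_list_addf sum_list_subtractf sum_list_const_mult)
    also have "(\<Sum>(l, P, L)\<leftarrow>ps. g (P (T (L x)))) = g (\<Sum>(l, P, L)\<leftarrow>ps. P (T (L x)))"
      by (simp add: blinfun_sum_list case_prod_unfold)
    also have "(\<Sum>(l, P, L)\<leftarrow>ps. P (T (L x))) = T x" using adm xD unfolding adm_def by simp
    finally have "2 * \<delta> * (\<Sum>(l, P, L)\<leftarrow>ps. g (P \<bar>d l L\<bar>)) < e * \<delta> + \<delta>\<^sup>2 * g (T x)"
      using opt[OF adm'] by linarith
    also have "\<dots> \<le> e * \<delta> + \<delta> * (\<delta> * K)"
      using blinfun_mono[OF g positive_operator_mono[OF T x(2)]] \<delta>
      by (simp add: power2_eq_square K_def mult.assoc)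
    also have "\<dots> = 2 * \<delta> * e" using K by (simp add: \<delta>_def)
    finally have sum_le: "(\<Sum>(l, P, L)\<leftarrow>ps. g (P \<bar>d l L\<bar>)) < e" using \<delta> by simp
    have "S x - (\<Sum>(l, P, L)\<leftarrow>ps. l *\<^sub>R P (T (L x))) = (\<Sum>(l, P, L)\<leftarrow>ps. P (S (L x))) - (\<Sum>(l, P, L)\<leftarrow>ps. l *\<^sub>R P (T (L x)))"
      using adm xD unfolding adm_def by simp
    also have "\<dots> = (\<Sum>(l, P, L)\<leftarrow>ps. P (S (L x)) - l *\<^sub>R P (T (L x)))"
      by (simp add: case_prod_unfold sum_list_subtractf)
    finally have "\<bar>S x - (\<Sum>(l, P, L)\<leftarrow>ps. l *\<^sub>R P (T (L x)))\<bar> \<le> (\<Sum>p\<leftarrow>ps. \<bar>case p of (l, P, L) \<Rightarrow> P (S (L x)) - l *\<^sub>R P (T (L x))\<bar>)"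
      by (simp add: abs_sum_list_le)
    also have "\<dots> \<le> (\<Sum>(l, P, L)\<leftarrow>ps. P \<bar>d l L\<bar>)"
    proof (rule sum_list_mono)
      fix p assume p: "p \<in> set ps"
      obtain l P L where [simp]: "p = (l, P, L)" by (cases p)
      have c: "center_on ?C P" using cP p by auto
      have "P (S (L x)) - l *\<^sub>R P (T (L x)) = P (d l L)"
        by (simp add: d_def linear_diff[OF linP[OF c]] linear_scale[OF linP[OF c]])
      then show "\<bar>case p of (l, P, L) \<Rightarrow> P (S (L x)) - l *\<^sub>R P (T (L x))\<bar> \<le> (case p of (l, P, L) \<Rightarrow> P \<bar>d l L\<bar>)"
        using positive_operator_abs[OF posP[OF c], of "d l L"] by simp
    qed
    finally have "g \<bar>S x - (\<Sum>(l, P, L)\<leftarrow>ps. l *\<^sub>R P (T (L x)))\<bar> \<le> g (\<Sum>(l, P, L)\<leftarrow>ps. P \<bar>d l L\<bar>)"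
      by (rule blinfun_mono[OF g])
    also have "\<dots> = (\<Sum>(l, P, L)\<leftarrow>ps. g (P \<bar>d l L\<bar>))" by (simp add: blinfun_sum_list case_prod_unfold)
    finally show ?thesis using sum_le by simp
  qed
  show thesis
  proof (rule that)
    show "0 \<le> l \<and> l \<le> 1 \<and> center_on ?C P \<and> center_on ?D L" if "(l, P, L) \<in> set ps" for l P L
      using l01[OF that] cP[OF that] cL[OF that] by blast
    show "(\<Sum>(l, P, L)\<leftarrow>ps. P (T (L x))) = T x" if "x \<in> ?D" for x
      using adm that unfolding adm_def by blast
  qed (rule approx)
qed

text \<open>A norm convergent weighted sum of the |x k| dominates a positive multiple of each of
  them, so one principal ideal holds the whole sequence. The 1 in the weight covers the case x k =
  0.\<close>

lemma ideal_cone_of_sequence: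
  fixes x :: "nat \<Rightarrow> 'a::banach_lattice"
  obtains e where "0 \<le> e" "\<And>n u. e \<le> u \<Longrightarrow> \<bar>x n\<bar> \<in> ideal_cone u"
proof -
  define c where "c k = (1/2) ^ k / (1 + norm (x k))" for k
  have n0: "0 < 1 + norm (x k)" for k using norm_ge_zero[of "x k"] by linarith
  have c: "0 < c k" for k using n0[of k] by (simp add: c_def)
  let ?y = "\<lambda>k. c k *\<^sub>R \<bar>x k\<bar>"
  have y0: "0 \<le> ?y k" for k using c[of k] by (intro scaleR_nonneg_nonneg) simp_all
  have "summable ?y"
  proof (rule summable_comparison_test'[of "\<lambda>k. (1/2) ^ k" 0])
    show "norm (?y k) \<le> (1/2) ^ k" for k
    proof -
      have "norm (?y k) = (1/2) ^ k * (norm (x k) / (1 + norm (x k)))"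
        using n0[of k] by (simp add: c_def)
      also have "\<dots> \<le> (1/2) ^ k * 1" by (intro mult_left_mono) (use n0[of k] in simp_all)
      finally show ?thesis by simp
    qed
  qed (simp add: summable_geometric)
  then have s: "(\<lambda>N. sum ?y {..<N}) \<longlonglongrightarrow> suminf ?y" by (rule summable_LIMSEQ)
  have le: "?y k \<le> suminf ?y" for k
  proof (rule lim_le[OF tendsto_const LIMSEQ_ignore_initial_segment[OF s, of "Suc k"]])
    fix N
    have "sum ?y {k} \<le> sum ?y {..<N + Suc k}" by (rule sum_mono2) (use y0 in auto)
    then show "?y k \<le> sum ?y {..<N + Suc k}" by simp
  qed
  show thesis
  proof
    show "0 \<le> suminf ?y" by (rule order_trans[OF y0 le])
    fix n u assume u: "suminf ?y \<le> u"
    have "?y n \<le> u" by (rule order_trans[OF le u])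
    then have "(1 / c n) *\<^sub>R ?y n \<le> (1 / c n) *\<^sub>R u" using c[of n] by (intro scaleR_left_mono) simp_all
    then have "\<bar>x n\<bar> \<le> (1 / c n) *\<^sub>R u" using c[of n] by simp
    then show "\<bar>x n\<bar> \<in> ideal_cone u"
      using c[of n] unfolding ideal_cone_def by (intro CollectI conjI exI[of _ "1 / c n"]) simp_all
  qed
qed

subsection \<open>Domination\<close>

theorem theorem3p1:
  fixes S T :: "'e::banach_lattice \<Rightarrow> 'f::{banach_lattice, sigma_dedekind_complete}"
  assumes "positive_operator S" and "positive_operator T"
    and "\<And>x. 0 \<le> x \<Longrightarrow> S x \<le> T x"
    and "weak_star_dunford_pettis T"
  shows "weak_star_dunford_pettis S"
  unfolding weak_star_dunford_pettis_iff
proof (intro conjI allI impI)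
  note S = assms(1) and T = assms(2) and ST = assms(3) and dp = assms(4)
  show "bounded_linear S" by (rule positive_operator_bounded[OF S])
  have blT: "bounded_linear T" by (rule positive_operator_bounded[OF T])
  have linS: "linear S" and linT: "linear T" using S T by (simp_all add: positive_operator_def)
  fix x :: "nat \<Rightarrow> 'e" and f :: "nat \<Rightarrow> 'f \<Rightarrow>\<^sub>L real"
  assume "\<forall>h :: 'e \<Rightarrow>\<^sub>L real. (\<lambda>n. blinfun_apply h (x n)) \<longlonglongrightarrow> 0"
    and "\<forall>y. (\<lambda>n. blinfun_apply (f n) y) \<longlonglongrightarrow> 0"
  then have x: "\<And>h :: 'e \<Rightarrow>\<^sub>L real. (\<lambda>n. blinfun_apply h (x n)) \<longlonglongrightarrow> 0"
    and f: "\<And>y. (\<lambda>n. blinfun_apply (f n) y) \<longlonglongrightarrow> 0" by blast+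
  show "(\<lambda>n. f n (S (x n))) \<longlonglongrightarrow> 0"
  proof (rule LIMSEQ_I)
    fix r :: real assume r: "0 < r"
    \<comment> \<open>One e for the approximant, and 3 e each for the positive and the negative part
      of x n: 2 e inside [0, u] and e for the tail above u.\<close>
    define e where "e = r / 7"
    have e: "0 < e" using r by (simp add: e_def)
    obtain m where m: "\<forall>\<^sub>F n in sequentially. \<bar>f n\<bar> (T (pprt (\<bar>x n\<bar> - weighted_partial_sum x m))) \<le> e"
      using weak_star_dunford_pettis_truncation[OF T dp x f e] by blast
    obtain w where w: "0 \<le> w" "\<And>n u. w \<le> u \<Longrightarrow> \<bar>x n\<bar> \<in> ideal_cone u"
      using ideal_cone_of_sequence[of x] by blast
    \<comment> \<open>\<open>w\<close> puts every x n into the ideal of \<open>u\<close>; the other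
      summand keeps the part of |x n| above \<open>u\<close> below the remainder controlled by
      \<open>m\<close>.\<close>
    define u where "u = w + weighted_partial_sum x m"
    have u: "0 \<le> u" "w \<le> u" "weighted_partial_sum x m \<le> u"
      using w(1) weighted_partial_sum_nonneg[of x m] by (simp_all add: u_def)
    let ?D = "ideal_cone u"
    note D = solid_cone_ideal[of u]
    have xD: "\<bar>x n\<bar> \<in> ?D" for n by (rule w(2)[OF u(2)])
    have Tu: "0 \<le> T u" using T u(1) by (simp add: positive_operator_def)
    obtain k where k: "\<And>n. pprt (\<bar>f n\<bar> - weighted_partial_sum f k) (T u) \<le> e"
      using weak_star_null_uniformly_dominated[OF f Tu e] by blast
    let ?g = "weighted_partial_sum f k"
    have g: "0 \<le> ?g" by (rule weighted_partial_sum_nonneg)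
    obtain ps :: "(real \<times> ('f \<Rightarrow> 'f) \<times> ('e \<Rightarrow> 'e)) list" where
      ps: "\<And>l P L. (l, P, L) \<in> set ps \<Longrightarrow>
        0 \<le> l \<and> l \<le> 1 \<and> center_on {x. 0 \<le> x} P \<and> center_on ?D L"
      and psT: "\<And>y. y \<in> ?D \<Longrightarrow> (\<Sum>(l, P, L)\<leftarrow>ps. P (T (L y))) = T y"
      and approx: "\<And>y. 0 \<le> y \<Longrightarrow> y \<le> u \<Longrightarrow>
        blinfun_apply ?g \<bar>S y - (\<Sum>(l, P, L)\<leftarrow>ps. l *\<^sub>R P (T (L y)))\<bar> \<le> e"
      by (rule dominated_operator_approx[OF S T _ u(1) g e]) (erule ST, rule that)
    define R where "R y = (\<Sum>(l, P, L)\<leftarrow>ps. l *\<^sub>R P (T (L y)))" for y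
    have linP: "linear P" if "center_on {x. 0 \<le> x} P" for P :: "'f \<Rightarrow> 'f"
      using center_on_bounded_linear[OF that] by (rule bounded_linear.linear)
    have R_diff: "R (y - z) = R y - R z" if "\<bar>y\<bar> \<in> ?D" "\<bar>z\<bar> \<in> ?D" for y z
    proof -
      have "R (y - z) = (\<Sum>(l, P, L)\<leftarrow>ps. l *\<^sub>R P (T (L y)) - l *\<^sub>R P (T (L z)))"
        unfolding R_def
      proof (rule arg_cong[where f = sum_list], rule map_cong[OF refl])
        fix p assume p: "p \<in> set ps"
        obtain l P L where [simp]: "p = (l, P, L)" by (cases p)
        have c: "center_on {x. 0 \<le> x} P" "center_on ?D L" using ps p by auto
        show "(case p of (l, P, L) \<Rightarrow> l *\<^sub>R P (T (L (y - z)))) =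
            (case p of (l, P, L) \<Rightarrow> l *\<^sub>R P (T (L y)) - l *\<^sub>R P (T (L z)))"
          by (simp add: center_on_diff[OF c(2) that] linear_diff[OF linT] linear_diff[OF linP[OF c(1)]]
              scaleR_diff_right)
      qed
      then show ?thesis by (simp add: R_def case_prod_unfold sum_list_subtractf)
    qed
    have R_bounds: "0 \<le> R y" "R y \<le> T y" if y: "y \<in> ?D" for y
    proof -
      have b: "0 \<le> P (T (L y)) \<and> 0 \<le> l *\<^sub>R P (T (L y)) \<and> l *\<^sub>R P (T (L y)) \<le> P (T (L y))"
        if "(l, P, L) \<in> set ps" for l P L
      proof -
        have c: "0 \<le> l" "l \<le> 1" "center_on {x. 0 \<le> x} P" "center_on ?D L" using ps[OF that] by auto
        have "0 \<le> T (L y)" using T center_onD(3)[OF c(4) y] by (simp add: positive_operator_def)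
        then have "0 \<le> P (T (L y))" using center_onD(3)[OF c(3)] by simp
        then show ?thesis
          using scaleR_right_mono[OF c(2), of "P (T (L y))"] c(1) by (simp add: scaleR_nonneg_nonneg)
      qed
      show "0 \<le> R y" unfolding R_def by (rule sum_list_nonneg) (use b in auto)
      have "R y \<le> (\<Sum>(l, P, L)\<leftarrow>ps. P (T (L y)))"
        unfolding R_def by (rule sum_list_mono) (use b in auto)
      then show "R y \<le> T y" by (simp only: psT[OF y])
    qed
    \<comment> \<open>Both \<open>S y\<close> and \<open>R y\<close> lie in [0, T y]. This holds on
      the whole ideal, also where the approximation on [0, u] says nothing.\<close>
    have diff_le: "\<bar>S y - R y\<bar> \<le> T y" if y: "y \<in> ?D" for y
    proof -
      have y0: "0 \<le> y" by (rule solid_coneD(2)[OF D y])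
      have Sy: "0 \<le> S y" "S y \<le> T y" using S ST[OF y0] y0 by (simp_all add: positive_operator_def)
      show ?thesis
      proof (rule abs_leI)
        show "S y - R y \<le> T y" using Sy(2) R_bounds(1)[OF y] by (simp add: diff_le_eq add_increasing2)
        show "- (S y - R y) \<le> T y" using Sy(1) R_bounds(2)[OF y] by (simp add: diff_le_eq add_increasing2)
      qed
    qed
    \<comment> \<open>|f n| is at most \<open>?g\<close> plus a remainder. The approximation costs e
      on \<open>?g\<close>; the remainder costs e because |S y - R y| <= T u, the element for which
      k was chosen.\<close>
    have interval: "\<bar>f n (S y - R y)\<bar> \<le> 2 * e" if y: "0 \<le> y" "y \<le> u" for n y
    proof -
      have yD: "y \<in> ?D" by (rule solid_coneD(4)[OF D ideal_cone_self[OF u(1)] y])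
      let ?z = "\<bar>S y - R y\<bar>"
      have "?z \<le> T u" using diff_le[OF yD] positive_operator_mono[OF T y(2)] by (rule order_trans)
      then have "pprt (\<bar>f n\<bar> - ?g) ?z \<le> e"
        by (rule order_trans[OF blinfun_mono[OF zero_le_pprt] k])
      moreover have "\<bar>f n\<bar> \<le> ?g + pprt (\<bar>f n\<bar> - ?g)"
        using le_pprt[of "\<bar>f n\<bar> - ?g"] by (simp add: diff_le_eq add.commute)
      then have "\<bar>f n\<bar> ?z \<le> ?g ?z + pprt (\<bar>f n\<bar> - ?g) ?z"
        using blinfun_leD[of "\<bar>f n\<bar>" "?g + pprt (\<bar>f n\<bar> - ?g)" ?z] by (simp add: blinfun.add_left)
      moreover have "?g ?z \<le> e" using approx[OF y] by (simp add: R_def)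
      ultimately show ?thesis using abs_blinfun_apply_le[of "f n" "S y - R y"] by linarith
    qed
    \<comment> \<open>Above \<open>u\<close> only |S y - R y| <= T y is at hand, and the truncation
      property of \<open>T\<close> makes |f n| small on that bound.\<close>
    have tail: "\<bar>f n (S y - R y)\<bar> \<le> e"
      if n: "\<bar>f n\<bar> (T (pprt (\<bar>x n\<bar> - weighted_partial_sum x m))) \<le> e"
        and y: "0 \<le> y" "y \<le> pprt (\<bar>x n\<bar> - u)" for n y
    proof -
      have "pprt (\<bar>x n\<bar> - u) \<le> \<bar>x n\<bar>" using u(1) by (simp add: pprt_le_iff diff_le_eq)
      then have "y \<le> \<bar>x n\<bar>" using y(2) by (rule order_trans[rotated])
      then have yD: "y \<in> ?D" by (rule solid_coneD(4)[OF D xD y(1)])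
      have "y \<le> pprt (\<bar>x n\<bar> - weighted_partial_sum x m)"
        by (rule order_trans[OF y(2)]) (intro pprt_mono diff_left_mono u(3))
      then have "\<bar>S y - R y\<bar> \<le> T (pprt (\<bar>x n\<bar> - weighted_partial_sum x m))"
        by (intro order_trans[OF diff_le[OF yD]] positive_operator_mono[OF T])
      then have "\<bar>f n\<bar> \<bar>S y - R y\<bar> \<le> e"
        by (rule order_trans[OF blinfun_mono[OF abs_ge_zero] n])
      then show ?thesis using abs_blinfun_apply_le[of "f n" "S y - R y"] by linarith
    qed
    have "(\<lambda>n. f n (R (x n))) \<longlonglongrightarrow> 0"
    proof -
      have "(\<lambda>n. \<Sum>(l, P, L)\<leftarrow>qs. l * f n (P (T (L (x n))))) \<longlonglongrightarrow> 0" if "set qs \<subseteq> set ps" for qs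
        using that
      proof (induction qs)
        case (Cons p qs)
        obtain l P L where p: "p = (l, P, L)" by (cases p)
        have c: "center_on {x. 0 \<le> x} P" "center_on ?D L" using ps Cons.prems p by auto
        have "(\<lambda>n. (f n o\<^sub>L Blinfun P) (T (L (x n)))) \<longlonglongrightarrow> 0"
        proof -
          have f': "(\<lambda>n. (f n o\<^sub>L Blinfun P) y) \<longlonglongrightarrow> 0" for y using f by simp
          have "(\<lambda>n. h (L (x n))) \<longlonglongrightarrow> 0" for h :: "'e \<Rightarrow>\<^sub>L real"
            by (rule center_on_weakly_null[OF c(2) xD x])
          then show ?thesis by (rule weak_star_dunford_pettisD[OF dp]) (rule f')
        qed
        then have "(\<lambda>n. f n (P (T (L (x n))))) \<longlonglongrightarrow> 0"
          by (simp add: bounded_linear_Blinfun_apply[OF center_on_bounded_linear[OF c(1)]])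
        from tendsto_add[OF tendsto_mult_right_zero[OF this, of l] Cons.IH] Cons.prems
        show ?case by (simp add: p)
      qed simp
      from this[OF subset_refl] show ?thesis
        by (simp add: R_def blinfun_sum_list case_prod_unfold blinfun.scaleR_right)
    qed
    then have "\<forall>\<^sub>F n in sequentially. \<bar>f n (R (x n))\<bar> < e"
      using e by (auto simp: tendsto_iff dist_real_def)
    with m have "\<forall>\<^sub>F n in sequentially. \<bar>f n (S (x n))\<bar> < r"
    proof eventually_elim
      case (elim n)
      have split: "\<exists>a b. p = a + b \<and> \<bar>f n (S a - R a)\<bar> \<le> 2 * e \<and> \<bar>f n (S b - R b)\<bar> \<le> e \<and> \<bar>a\<bar> \<in> ?D \<and> \<bar>b\<bar> \<in> ?D"
        if p: "0 \<le> p" "p \<le> \<bar>x n\<bar>" for p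
      proof (intro exI conjI)
        have b: "p - inf p u = pprt (p - u)" by (rule diff_inf_pprt)
        show "p = inf p u + pprt (p - u)" unfolding b[symmetric] by (simp only: add.commute[of "inf p u"] diff_add_cancel)
        show "\<bar>f n (S (inf p u) - R (inf p u))\<bar> \<le> 2 * e"
          by (rule interval) (use p u in simp_all)
        show "\<bar>f n (S (pprt (p - u)) - R (pprt (p - u)))\<bar> \<le> e"
          by (rule tail[OF elim(1)]) (simp_all add: p diff_right_mono)
        have pD: "p \<in> ?D" by (rule solid_coneD(4)[OF D xD p])
        show "\<bar>inf p u\<bar> \<in> ?D"
          by (rule abs_mem_cone[OF D solid_coneD(4)[OF D pD]]) (use p u in simp_all)
        have "pprt (p - u) \<le> p" using p u by (simp add: pprt_le_iff diff_le_eq)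
        then show "\<bar>pprt (p - u)\<bar> \<in> ?D"
          by (intro abs_mem_cone[OF D] solid_coneD(4)[OF D pD]) simp_all
      qed
      have est: "\<bar>f n (S p - R p)\<bar> \<le> 3 * e" if p: "0 \<le> p" "p \<le> \<bar>x n\<bar>" for p
      proof -
        obtain a b where ab: "p = a + b" "\<bar>f n (S a - R a)\<bar> \<le> 2 * e" "\<bar>f n (S b - R b)\<bar> \<le> e"
          "\<bar>a\<bar> \<in> ?D" "\<bar>b\<bar> \<in> ?D" using split[OF p] by blast
        have "\<bar>p\<bar> \<in> ?D" by (rule abs_mem_cone[OF D solid_coneD(4)[OF D xD p]])
        then have "R a = R p - R b" using R_diff[of p b] ab by simp
        then have "S p - R p = (S a - R a) + (S b - R b)"
          by (simp add: ab(1) linear_add[OF linS])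
        then have "f n (S p - R p) = f n (S a - R a) + f n (S b - R b)" by (simp only: blinfun.add_right)
        then show ?thesis using ab(2,3) by linarith
      qed
      let ?p = "pprt (x n)" and ?q = "- nprt (x n)"
      have pq: "\<bar>f n (S ?p - R ?p)\<bar> \<le> 3 * e" "\<bar>f n (S ?q - R ?q)\<bar> \<le> 3 * e"
        by (rule est; simp add: pprt_le_abs uminus_nprt_le_abs)+
      have x_eq: "x n = ?p - ?q" by (simp flip: prts)
      have "S (x n) = S ?p - S ?q" by (subst x_eq) (rule linear_diff[OF linS])
      moreover have "R (x n) = R ?p - R ?q"
        by (subst x_eq) (intro R_diff abs_mem_cone[OF D] abs_in_cone[OF D xD])
      ultimately have "S (x n) = R (x n) + ((S ?p - R ?p) - (S ?q - R ?q))" by simp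
      then have "f n (S (x n)) = f n (R (x n)) + (f n (S ?p - R ?p) - f n (S ?q - R ?q))"
        by (simp only: blinfun.add_right blinfun.diff_right)
      then have "\<bar>f n (S (x n))\<bar> < 7 * e" using pq elim(2) by linarith
      then show ?case by (simp add: e_def)
    qed
    then show "\<exists>N. \<forall>n\<ge>N. norm (f n (S (x n)) - 0) < r" by (simp add: eventually_sequentially)
  qed
qed

end
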